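(* Let $a=0$ and let $V(t,x,\pi)=\sup_{0\le\tau\le 1-t}\mathbb{E}_\pi[X^{t,x}_{t+\tau}]$. For all $t\in[0,1)$, $x\in\mathbb{R}$ and $\pi\in[0,1]$, $$x\le V(t,x,\pi)\le V_1^0(t,x).$$ Moreover, for each fixed $(t,x)$ the map $\pi\mapsto V(t,x,\pi)$ is increasing (in the weak sense, i.e. nondecreasing) on $[0,1]$, with $V(t,x,0)=x$ and $V(t,x,1)=V_1^0(t,x)$.
   Context: Setting (case $a=0$). The process $X$ is either a driftless Brownian motion ($\theta=0$) or a Brownian bridge pinning to $0$ at time $1$ ($\theta=1$), and $\theta$ is not observed. Learning starts at time $0$ with $X_0=0$ and prior belief $\pi\in[0,1]$ that $\theta=1$. If the process is at $x$ at time $t\in[0,1)$, the updated belief that $\theta=1$ is $$\Pi(t,x,\pi):=\frac{\frac{\pi}{1-\pi}L^0(t,x)}{1+\frac{\pi}{1-\pi}L^0(t,x)}=\frac{\pi L^0(t,x)}{1-\pi+\pi L^0(t,x)},\qquad L^0(t,x):=\frac{1}{\sqrt{1-t}}\exp\Bigl(-\frac{x^2}{2(1-t)}\Bigr)$$ (the last expression for $\Pi$ is used for $\pi=1$, giving $\Pi(t,x,1)=1$). Embedded problem. Given $(t,x,\pi)$, under $\mathbb{P}_\pi$ the process $X=X^{t,x}$ starts at $X_t=x$, the hidden variable $\theta$ takes the value $1$ with probability $\Pi(t,x,\pi)$ and $0$ with probability $1-\Pi(t,x,\pi)$, and $$dX_{t+s}=-\theta\,\frac{X_{t+s}}{1-t-s}\,ds+dB_{t+s},\qquad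 0\le s<1-t,$$ where $B$ is a standard Brownian motion independent of $\theta$; $X_1$ is the limit of $X_{t+s}$ as $s\uparrow 1-t$. (Equivalently, in the observation filtration, $dX_{t+s}=\Pi_{t+s}\,\rho(t+s,X_{t+s})\,ds+d\bar B_{t+s}$ and $d\Pi_{t+s}=\rho(t+s,X_{t+s})\Pi_{t+s}(1-\Pi_{t+s})\,d\bar B_{t+s}$ with $\Pi_t=\Pi(t,x,\pi)$, $\rho(u,y)=-y/(1-u)$, and $\bar B$ the innovation Brownian motion.) The supremum defining $V$ is over stopping times $\tau$ of the observed process $(X_{t+s})_{s\ge0}$ with $0\le\tau\le1-t$. Known-pinning value function. Let $\pi_\circ=3.14159\ldots$ be the circle constant, $\Phi$ the standard normal distribution function, and $\alpha\approx 0.839924$ the unique positive solution of $\sqrt{2\pi_\circ}(1-\alpha^2)e^{\alpha^2/2}\Phi(\alpha)=\alpha$. For $t<1$, $$V_1^0(t,x):=\begin{cases}\sqrt{2\pi_\circ(1-t)}\,(1-\alpha^2)\exp\bigl(\frac{x^2}{2(1-t)}\bigr)\Phi\bigl(\frac{x}{\sqrt{1-t}}\bigr), & x<\alpha\sqrt{1-t},\\ x, & x\ge\alpha\sqrt{1-t}.\end{cases}$$ *)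

theory Defs
  imports "HOL-Probability.Probability"
begin

definition generated_algebra :: "'w measure \<Rightarrow> (real \<Rightarrow> 'w \<Rightarrow> real) \<Rightarrow> real set \<Rightarrow> 'w measure" where
  "generated_algebra M Y I =
     sigma (space M) (\<Union>r\<in>I. {Y r -` A \<inter> space M | A. A \<in> sets borel})"

definition natural_filtration :: "'w measure \<Rightarrow> (real \<Rightarrow> 'w \<Rightarrow> real) \<Rightarrow> real \<Rightarrow> 'w measure" where
  "natural_filtration M Y s = generated_algebra M Y {0..s}"

locale standard_brownian_motion = prob_space M
  for M :: "'w measure" +
  fixes B :: "real \<Rightarrow> 'w \<Rightarrow> real"
  assumes random_variable_B: "\<And>s. 0 \<le> s \<Longrightarrow> random_variable borel (B s)"
    and start_at_0: "AE w in M. B 0 w = 0"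
    and independent_increments:
      "\<And>(u :: nat \<Rightarrow> real) n. 0 \<le> u 0 \<Longrightarrow> mono u \<Longrightarrow>
         indep_vars (\<lambda>_. borel) (\<lambda>i w. B (u (Suc i)) w - B (u i) w) {..<n}"
    and gaussian_increments:
      "\<And>s u. 0 \<le> s \<Longrightarrow> s < u \<Longrightarrow>
         distributed M lborel (\<lambda>w. B u w - B s w) (normal_density 0 (sqrt (u - s)))"
    and continuous_paths: "AE w in M. continuous_on {0..} (\<lambda>s. B s w)"

definition L0 :: "real \<Rightarrow> real \<Rightarrow> real" where
  "L0 t x = 1 / sqrt (1 - t) * exp (- (x\<^sup>2 / (2 * (1 - t))))"

definition belief :: "real \<Rightarrow> real \<Rightarrow> real \<Rightarrow> real" where
  "belief t x p = p * L0 t x / (1 - p + p * L0 t x)"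

text \<open>
  The process X is indexed by calendar time in \<open>[t, 1]\<close>, and the stochastic differential equation
  is read in integrated form, which is an ordinary pathwise integral equation because its
  diffusion coefficient is 1. Continuity of the paths on the closed interval \<open>[t, 1]\<close> includes
  that \<open>X 1\<close> is the limit of \<open>X (t + s)\<close> as s increases to \<open>1 - t\<close>. Continuity is required for
  every outcome, rather than for almost every one, so that X evaluated at a stopping time is
  measurable although M need not be complete.
\<close>

locale embedded_problem = standard_brownian_motion M B
  for M :: "'w measure" and B :: "real \<Rightarrow> 'w \<Rightarrow> real" +
  fixes t x p :: real
    and \<theta> :: "'w \<Rightarrow> real"
    and X :: "real \<Rightarrow> 'w \<Rightarrow> real"
  assumes random_variable_theta: "random_variable borel \<theta>"
    and prob_theta_1: "prob {w \<in> space M. \<theta> w = 1} = belief t x p"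
    and prob_theta_0: "prob {w \<in> space M. \<theta> w = 0} = 1 - belief t x p"
    and independent_theta_B:
      "indep_set (sets (vimage_algebra (space M) \<theta> borel)) (sets (generated_algebra M B {0..}))"
    and random_variable_X: "\<And>u. u \<in> {t..1} \<Longrightarrow> random_variable borel (X u)"
    and continuous_X: "\<And>w. w \<in> space M \<Longrightarrow> continuous_on {t..1} (\<lambda>u. X u w)"
    and X_equation:
      "AE w in M. \<forall>s\<in>{0..<1 - t}.
         X (t + s) w =
           x - integral {0..s} (\<lambda>r. \<theta> w * (X (t + r) w / (1 - t - r))) + (B (t + s) w - B t w)"

text \<open>Stopping times measure the time elapsed since t.\<close>

definition admissible_times :: "'w measure \<Rightarrow> (real \<Rightarrow> 'w \<Rightarrow> real) \<Rightarrow> real \<Rightarrow> ('w \<Rightarrow> real) set" where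
  "admissible_times M X t =
     {\<tau>. stopping_time (natural_filtration M (\<lambda>s. X (t + s))) \<tau> \<and>
          (\<forall>w\<in>space M. 0 \<le> \<tau> w \<and> \<tau> w \<le> 1 - t)}"

text \<open>
  The supremum is taken in the extended reals, so that it is meaningful without presupposing
  that it is finite. In an embedded problem the maximum of \<open>\<bar>X\<bar>\<close> over \<open>[t, 1]\<close> is integrable, so
  the convention that a non-integrable function has Bochner integral 0 plays no role.
\<close>

definition value_function :: "'w measure \<Rightarrow> (real \<Rightarrow> 'w \<Rightarrow> real) \<Rightarrow> real \<Rightarrow> ereal" where
  "value_function M X t =
     (SUP \<tau>\<in>admissible_times M X t. ereal (\<integral>w. X (t + \<tau> w) w \<partial>M))"

definition Phi :: "real \<Rightarrow> real" where
  "Phi = cdf std_normal_distribution"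

definition alpha :: real where
  "alpha = (THE a. 0 < a \<and> sqrt (2 * pi) * (1 - a\<^sup>2) * exp (a\<^sup>2 / 2) * Phi a = a)"

definition V10 :: "real \<Rightarrow> real \<Rightarrow> real" where
  "V10 t x =
     (if x < alpha * sqrt (1 - t)
      then sqrt (2 * pi * (1 - t)) * (1 - alpha\<^sup>2) * exp (x\<^sup>2 / (2 * (1 - t))) * Phi (x / sqrt (1 - t))
      else x)"

end

theory Submission
  imports Defs
begin

text \<open>
  Conditionally on \<open>\<theta> = 0\<close> the observed process is a Brownian motion, so every stopping time earns x; the
  same stopping times are available conditionally on \<open>\<theta> = 1\<close>. Hence
  \<open>V t x p = (1 - belief t x p) * x + belief t x p * V10 t x\<close>, an affine function of the belief, as soon as
  \<open>V10\<close> is known to be the value of stopping the bridge and to be attained by one rule that is a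
  functional of X.

  For the bridge, \<open>Z s = X (t + s) / (1 - t - s)\<close> is a Brownian motion in the clock
  \<open>r s = 1 / (1 - t - s)\<close> and the payoff is \<open>Z s / r s\<close>. The exponential martingales
  \<open>exp (l * Z - l\<^sup>2 * r / 2)\<close>, integrated over \<open>l \<ge> 0\<close>, give the positive martingale
  \<open>exp_mixture r Z\<close>. By the equation for \<open>alpha\<close>, \<open>(1 - alpha\<^sup>2) * exp_mixture r w\<close> dominates \<open>w / r\<close> and
  touches it exactly on the stopping boundary \<open>w = alpha * sqrt r\<close>; the domination yields the upper bound, and
  stopping at the boundary attains it. No stochastic calculus is needed: the increments of Z are
  limits of weighted sums of Brownian increments.
\<close>

section \<open>The exponential mixture and the stopping boundary\<close>

text \<open>The coefficient \<open>1 - alpha\<^sup>2\<close> is smooth fit. Since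
  \<open>mills\<close> has derivative \<open>z * mills z + 1\<close>, contact and tangency of
  \<open>K * mills\<close> with the identity at a point a force \<open>K = 1 - a\<^sup>2\<close>,
  and contact then is the equation that defines \<open>alpha\<close>. Two obstacles shape the rest.
  One is that X is not assumed to be adapted to B: it satisfies an equation almost everywhere.
  Recovering Z as a limit of sums of Brownian increments also shows that each observed event agrees,
  up to a null set, with an event of the Brownian past, and this is what separates it from later
  increments. The other is that the clock explodes at maturity, so the exponential martingales exist
  only up to horizons \<open>T < 1 - t\<close>. In the upper bound the mass lost in the passage to
  maturity carries no payoff, because the bridge is shown to be pinned to 0. In the attainment the
  paths not yet stopped at T lie below the boundary and contribute a term of order
  \<open>sqrt (1 - t - T)\<close>.\<close>

text \<open>This is the Mills ratio of the standard normal distribution at \<open>- z\<close>.\<close>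

definition mills :: "real \<Rightarrow> real" where
  "mills z = sqrt (2 * pi) * exp (z\<^sup>2 / 2) * Phi z"

section \<open>The standard normal distribution function\<close>

lemma Phi_nonneg: "0 \<le> Phi z"
  by (simp add: Phi_def cdf_def)

lemma has_real_derivative_Phi: "(Phi has_real_derivative std_normal_density z) (at z)"
proof -
  interpret N: real_distribution std_normal_distribution
    by (rule real_dist_normal_dist)
  \<comment> \<open>Measuring from \<open>z - 1\<close> replaces the improper integral by one over a
    compact interval, and differentiation at z becomes the fundamental theorem of calculus.\<close>
  have Phi_eq: "Phi y = Phi (z - 1) + integral {z - 1..y} std_normal_density" if "z - 1 < y" for y
  proof -
    have "Phi y - Phi (z - 1) = measure std_normal_distribution {z - 1<..y}"
      unfolding Phi_def by (rule N.cdf_diff_eq[OF that])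
    also have "\<dots> = (LINT u:{z - 1<..y}|lborel. std_normal_density u)"
      unfolding set_lebesgue_integral_def
      by (subst N.finite_measure_eq_AE[where B = "{z - 1<..y}"])
         (auto simp: measure_def emeasure_density integral_eq_nn_integral
            intro!: arg_cong[where f = enn2real] nn_integral_cong split: split_indicator)
    also have "\<dots> = (LINT u:{z - 1..y}|lborel. std_normal_density u)"
      using AE_lborel_singleton[of "z - 1"]
      by (intro set_integral_cong_set) (auto simp: set_borel_measurable_def)
    also have "\<dots> = integral {z - 1..y} std_normal_density"
      by (intro set_borel_integral_eq_integral)
         (auto simp: set_integrable_def
            intro!: integrable_mult_indicator[where 'b = real, simplified])
    finally show ?thesis by simp
  qed
  have "((\<lambda>y. integral {z - 1..y} std_normal_density) has_real_derivative std_normal_density z)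
          (at z within {z - 1..z + 1})"
    by (intro integral_has_real_derivative) (auto simp: normal_density_def intro!: continuous_intros)
  then have "((\<lambda>y. integral {z - 1..y} std_normal_density) has_real_derivative std_normal_density z) (at z)"
    by (subst (asm) at_within_interior) auto
  then have "((\<lambda>y. Phi (z - 1) + integral {z - 1..y} std_normal_density)
      has_real_derivative std_normal_density z) (at z)"
    by (auto intro!: derivative_eq_intros)
  moreover have "\<forall>\<^sub>F y in nhds z. Phi y = Phi (z - 1) + integral {z - 1..y} std_normal_density"
    by (rule eventually_mono[OF eventually_nhds_in_open[of "{z - 1<..}"]]) (auto intro: Phi_eq)
  ultimately show ?thesis
    by (subst DERIV_cong_ev[OF refl _ refl])
qed

lemma Phi_pos: "0 < Phi z"
proof -
  have "Phi (z - 1) < Phi z"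
    by (rule DERIV_pos_imp_increasing)
       (auto intro!: has_real_derivative_Phi exI[of _ "std_normal_density _"] simp: normal_density_pos)
  with Phi_nonneg[of "z - 1"] show ?thesis by simp
qed

lemma mills_pos: "0 < mills z"
  by (simp add: mills_def Phi_pos)

lemma continuous_on_Phi [continuous_intros]:
  "continuous_on A f \<Longrightarrow> continuous_on A (\<lambda>x. Phi (f x))"
  by (rule continuous_on_compose2[of UNIV Phi])
     (auto intro!: continuous_at_imp_continuous_on DERIV_isCont has_real_derivative_Phi)

text \<open>After multiplication by \<open>exp (- z\<^sup>2 / 2)\<close> the difference of the two sides has the derivative
  \<open>(z\<^sup>2 - a\<^sup>2) exp (- z\<^sup>2 / 2)\<close>, so on the positive half-line its minimum is the zero at a.\<close>

lemma le_mills_of_root: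
  assumes a: "0 < a" and root: "(1 - a\<^sup>2) * mills a = a"
  shows "z \<le> (1 - a\<^sup>2) * mills z"
proof -
  have K: "0 < 1 - a\<^sup>2"
    using a root mills_pos[of a] by (metis zero_less_mult_pos2)
  show ?thesis
  proof (cases "z \<le> 0")
    case True
    then show ?thesis using K mills_pos[of z] by (smt (verit) mult_pos_pos)
  next
    case False
    define q where "q y = (1 - a\<^sup>2) * sqrt (2 * pi) * Phi y - y * exp (- (y\<^sup>2 / 2))" for y
    have dq: "(q has_real_derivative (y\<^sup>2 - a\<^sup>2) * exp (- (y\<^sup>2 / 2))) (at y)" for y
      unfolding q_def[abs_def]
      by (auto intro!: derivative_eq_intros has_real_derivative_Phi
          simp: normal_density_def field_simps real_sqrt_mult power2_eq_square)
    have mills_q: "(1 - a\<^sup>2) * mills y = exp (y\<^sup>2 / 2) * q y + y" for y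
      by (simp add: q_def mills_def algebra_simps exp_minus)
    have "q a = 0" using mills_q[of a] root by simp
    moreover have "q a \<le> q z"
    proof (cases "a \<le> z")
      case True
      then show ?thesis
        using a by (intro DERIV_nonneg_imp_nondecreasing[of a z q]) (auto intro!: exI conjI dq power_mono)
    next
      case False
      then show ?thesis
        using \<open>\<not> z \<le> 0\<close>
        by (intro DERIV_nonpos_imp_nonincreasing[of z a q])
           (auto intro!: exI conjI dq power_mono mult_nonpos_nonneg)
    qed
    ultimately show ?thesis by (simp add: mills_q)
  qed
qed

text \<open>Existence is the intermediate value theorem:
  \<open>a - (1 - a\<^sup>2) * mills a\<close> equals \<open>- mills 0\<close> at 0 and 1 at 1.
  Uniqueness comes from extremality: for a root b, \<open>(1 - b\<^sup>2) * mills\<close> lies above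
  the identity everywhere and meets it at b, so evaluation at each of two roots compares their
  coefficients in both directions.\<close>

lemma ex1_alpha: "\<exists>!a. 0 < a \<and> sqrt (2 * pi) * (1 - a\<^sup>2) * exp (a\<^sup>2 / 2) * Phi a = a"
proof -
  have eq: "sqrt (2 * pi) * (1 - a\<^sup>2) * exp (a\<^sup>2 / 2) * Phi a = (1 - a\<^sup>2) * mills a" for a
    by (simp add: mills_def)
  have "\<exists>a\<ge>0. a \<le> 1 \<and> a - (1 - a\<^sup>2) * mills a = 0"
    using mills_pos[of 0]
    by (intro IVT') (auto simp: mills_def intro!: continuous_intros)
  then obtain a where a: "0 \<le> a" "(1 - a\<^sup>2) * mills a = a" by auto
  moreover have "a \<noteq> 0" using a mills_pos[of 0] by auto
  moreover have "b = b'"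
    if b: "0 < b" "(1 - b\<^sup>2) * mills b = b" and b': "0 < b'" "(1 - b'\<^sup>2) * mills b' = b'" for b b'
  proof -
    have "(1 - b'\<^sup>2) * mills b' \<le> (1 - b\<^sup>2) * mills b'" "(1 - b\<^sup>2) * mills b \<le> (1 - b'\<^sup>2) * mills b"
      using le_mills_of_root[OF b, of b'] le_mills_of_root[OF b', of b] b b' by auto
    then have "b\<^sup>2 = b'\<^sup>2"
      using mills_pos[of b] mills_pos[of b'] by (auto simp: mult_le_cancel_right)
    with b b' show ?thesis by (simp add: power2_eq_iff_nonneg)
  qed
  ultimately show ?thesis unfolding eq by (intro ex1I[of _ a]) auto
qed

lemma alpha_pos: "0 < alpha" and alpha_root: "(1 - alpha\<^sup>2) * mills alpha = alpha"
  using theI'[OF ex1_alpha] by (auto simp: alpha_def mills_def mult_ac)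

lemma alpha_sq_less_1: "alpha\<^sup>2 < 1"
  using alpha_pos alpha_root mills_pos[of alpha] by (metis diff_gt_0_iff_gt zero_less_mult_pos2)

lemma le_mills: "z \<le> (1 - alpha\<^sup>2) * mills z"
  by (rule le_mills_of_root[OF alpha_pos alpha_root])

section \<open>The integrated exponential martingale\<close>

definition exp_mixture :: "real \<Rightarrow> real \<Rightarrow> real" where
  "exp_mixture r w = mills (w / sqrt r) / sqrt r"

lemma exp_mixture_nonneg: "0 < r \<Longrightarrow> 0 \<le> exp_mixture r w"
  using mills_pos[of "w / sqrt r"] by (simp add: exp_mixture_def)

text \<open>Completing the square at \<open>l = w / r\<close> leaves a Gaussian in l. The
  substitution \<open>l = w / r - y / sqrt r\<close> has Jacobian \<open>1 / sqrt r\<close> and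
  sends the half-line \<open>l \<ge> 0\<close> to \<open>y \<le> w / sqrt r\<close>, which is where
  \<open>Phi\<close> comes from.\<close>

lemma nn_integral_exp_mixture:
  assumes r: "0 < r"
  shows "(\<integral>\<^sup>+l\<in>{0..}. ennreal (exp (l * w - l\<^sup>2 * r / 2)) \<partial>lborel) = ennreal (exp_mixture r w)"
proof -
  interpret N: real_distribution std_normal_distribution
    by (rule real_dist_normal_dist)
  obtain q where q: "r = q\<^sup>2" "0 < q"
    using r by (metis real_sqrt_gt_0_iff real_sqrt_pow2 less_imp_le)
  have square: "(w / r - y / q) * w - (w / r - y / q)\<^sup>2 * r / 2 = w\<^sup>2 / (2 * r) - y\<^sup>2 / 2" for y
    using q by (simp add: field_simps power2_eq_square)
  have gauss: "exp (w\<^sup>2 / (2 * r) - y\<^sup>2 / 2) = (exp (w\<^sup>2 / (2 * r)) * sqrt (2 * pi)) * std_normal_density y" for y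
  proof -
    have "sqrt (2 * pi) * std_normal_density y = exp (- (y\<^sup>2 / 2))"
      by (simp add: normal_density_def)
    then show ?thesis by (simp add: mult.assoc flip: exp_add)
  qed
  have range: "0 \<le> w / r - y / q \<longleftrightarrow> y \<le> w / q" for y
    using q by (simp add: field_simps power2_eq_square)
  have "(\<integral>\<^sup>+l\<in>{0..}. ennreal (exp (l * w - l\<^sup>2 * r / 2)) \<partial>lborel)
      = ennreal (1 / sqrt r) * (\<integral>\<^sup>+y. ennreal (exp (w\<^sup>2 / (2 * r) - y\<^sup>2 / 2)) * indicator {..w / sqrt r} y \<partial>lborel)"
    using q square range
    by (subst nn_integral_real_affine[where c = "- (1 / q)" and t = "w / r"])
       (auto split: split_indicator intro!: nn_integral_cong arg_cong2[where f = "(*)"])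
  also have "\<dots> = ennreal (1 / sqrt r) * (\<integral>\<^sup>+y. ennreal (exp (w\<^sup>2 / (2 * r)) * sqrt (2 * pi)) *
        (ennreal (std_normal_density y) * indicator {..w / sqrt r} y) \<partial>lborel)"
    by (simp add: gauss ennreal_mult mult.assoc)
  also have "\<dots> = ennreal (1 / sqrt r) * (ennreal (exp (w\<^sup>2 / (2 * r)) * sqrt (2 * pi)) * ennreal (Phi (w / sqrt r)))"
    by (subst nn_integral_cmult) (auto simp: Phi_def cdf_def N.emeasure_eq_measure[symmetric] emeasure_density)
  also have "\<dots> = ennreal (exp_mixture r w)"
    using r Phi_nonneg by (simp add: exp_mixture_def mills_def power_divide mult_ac flip: ennreal_mult')
  finally show ?thesis .
qed

text \<open>In the integral representation with \<open>r = 1\<close> the integrand increases with w,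
  because only \<open>l \<ge> 0\<close> enters.\<close>

lemma mills_mono: "y \<le> z \<Longrightarrow> mills y \<le> mills z"
proof -
  assume "y \<le> z"
  then have "ennreal (exp_mixture 1 y) \<le> ennreal (exp_mixture 1 z)"
    unfolding nn_integral_exp_mixture[OF zero_less_one, symmetric]
    by (intro nn_integral_mono) (auto split: split_indicator intro!: mult_left_mono)
  then show ?thesis using mills_pos[of y] mills_pos[of z] by (simp add: exp_mixture_def)
qed

text \<open>Back in the original coordinates: with e the time left and y the position of the bridge,
  the clock is \<open>1 / e\<close> and Z is \<open>y / e\<close>.\<close>

lemma exp_mixture_bridge:
  assumes "0 < e"
  shows "exp_mixture (1 / e) (y / e) = sqrt e * mills (y / sqrt e)"
proof -
  obtain s where s: "e = s\<^sup>2" "0 < s"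
    using assms by (metis real_sqrt_gt_0_iff real_sqrt_pow2 less_imp_le)
  have "y / s\<^sup>2 / (1 / s) = y / s" using s by (simp add: power2_eq_square)
  then show ?thesis using s by (simp add: exp_mixture_def real_sqrt_divide mult.commute)
qed

lemma V10_eq:
  assumes "t < 1"
  shows "V10 t x = (if x < alpha * sqrt (1 - t)
    then (1 - alpha\<^sup>2) * exp_mixture (1 / (1 - t)) (x / (1 - t)) else x)"
proof -
  have "sqrt (2 * pi * (1 - t)) = sqrt (2 * pi) * sqrt (1 - t)"
    by (rule real_sqrt_mult)
  then show ?thesis
    using assms by (simp add: V10_def exp_mixture_bridge mills_def power_divide mult.left_commute)
qed

lemma div_le_exp_mixture:
  assumes "0 < r"
  shows "w / r \<le> (1 - alpha\<^sup>2) * exp_mixture r w"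
proof -
  have "w / sqrt r / sqrt r \<le> (1 - alpha\<^sup>2) * mills (w / sqrt r) / sqrt r"
    using assms by (intro divide_right_mono le_mills) auto
  then show ?thesis using assms by (simp add: exp_mixture_def)
qed

lemma le_V10: "t < 1 \<Longrightarrow> x \<le> V10 t x"
  using div_le_exp_mixture[of "1 / (1 - t)" "x / (1 - t)"] by (simp add: V10_eq)

text \<open>For a start in the stopping region the clock is shifted by d so that the start becomes a
  point of the stopping boundary \<open>w = alpha * sqrt r\<close>.\<close>

lemma ex_exp_mixture_majorant:
  assumes t: "t < 1"
  obtains K d where "0 \<le> K" "0 \<le> d" "K * exp_mixture (1 / (1 - t) + d) (x / (1 - t)) = V10 t x"
    "\<And>r w. 1 / (1 - t) \<le> r \<Longrightarrow> w / r \<le> K * exp_mixture (r + d) w"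
proof (cases "x < alpha * sqrt (1 - t)")
  case True
  show ?thesis
  proof (rule that[of "1 - alpha\<^sup>2" 0])
    fix r w :: real assume "1 / (1 - t) \<le> r"
    then have "0 < r" using t by (meson diff_gt_0_iff_gt less_le_trans zero_less_divide_1_iff)
    then show "w / r \<le> (1 - alpha\<^sup>2) * exp_mixture (r + 0) w" using div_le_exp_mixture by simp
  qed (use True t alpha_sq_less_1 in \<open>auto simp: V10_eq\<close>)
next
  case False
  define c where "c = 1 / (1 - t)"
  \<comment> \<open>The clock value at which the start would be on the boundary:
    \<open>x * c = alpha * sqrt e\<close>, where \<open>x * c\<close> is the starting value of Z.
    The shift is \<open>e - c\<close>, nonnegative because x is in the stopping region.\<close>
  define e where "e = (x * c / alpha)\<^sup>2"
  have c: "0 < c" using t by (simp add: c_def)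
  have x: "alpha * sqrt (1 - t) \<le> x" "0 < x"
    using False alpha_pos t by (auto intro: less_le_trans[of _ "alpha * sqrt (1 - t)"])
  have ce: "c \<le> e"
  proof -
    have "sqrt (1 - t) * c \<le> x * c / alpha"
      using x alpha_pos c by (simp add: field_simps)
    then have "(sqrt (1 - t) * c)\<^sup>2 \<le> e"
      unfolding e_def using t c by (intro power_mono) auto
    moreover have "(sqrt (1 - t) * c)\<^sup>2 = c"
      using t by (simp add: c_def power_mult_distrib power2_eq_square)
    ultimately show ?thesis by simp
  qed
  have e: "0 < e" and sqrt_e: "sqrt e = x * c / alpha"
    using ce c x alpha_pos by (auto simp: e_def)
  show ?thesis
  \<comment> \<open>The factor \<open>e / c\<close> compensates for evaluation at
    \<open>r + (e - c)\<close> in place of r: for \<open>r \<ge> c\<close> the ratio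
    \<open>(r + (e - c)) / r\<close> is largest at \<open>r = c\<close>, where it equals
    \<open>e / c\<close>. Hence the bound is exact at the start.\<close>
  proof (rule that[of "(1 - alpha\<^sup>2) * (e / c)" "e - c"])
    show "0 \<le> (1 - alpha\<^sup>2) * (e / c)" "0 \<le> e - c"
      using alpha_sq_less_1 e c ce by auto
    have "(1 - alpha\<^sup>2) * (e / c) * exp_mixture e (x * c) = (e / c) * ((1 - alpha\<^sup>2) * mills alpha) / sqrt e"
      using x c alpha_pos by (simp add: exp_mixture_def sqrt_e)
    also have "\<dots> = (sqrt e * sqrt e / c) * alpha / sqrt e" using e by (simp add: alpha_root)
    also have "\<dots> = x" using x c alpha_pos by (simp add: sqrt_e)
    finally show "(1 - alpha\<^sup>2) * (e / c) * exp_mixture (1 / (1 - t) + (e - c)) (x / (1 - t)) = V10 t x"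
      using False t by (simp add: c_def[symmetric] V10_def) (simp add: c_def)
    fix r w :: real assume "1 / (1 - t) \<le> r"
    then have r: "c \<le> r" by (simp add: c_def)
    show "w / r \<le> (1 - alpha\<^sup>2) * (e / c) * exp_mixture (r + (e - c)) w"
    proof (cases "w \<le> 0")
      case True
      have "w / r \<le> 0" using True r c by (simp add: divide_nonpos_pos)
      also have "\<dots> \<le> (1 - alpha\<^sup>2) * (e / c) * exp_mixture (r + (e - c)) w"
        using r c ce e alpha_sq_less_1 by (intro mult_nonneg_nonneg exp_mixture_nonneg) auto
      finally show ?thesis .
    next
      case False
      have "w / r \<le> (e / c) * (w / (r + (e - c)))"
      proof -
        have "c * (r + (e - c)) \<le> e * r"
          using mult_nonneg_nonneg[of "r - c" "e - c"] r ce by (simp add: algebra_simps)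
        then have "w * (c * (r + (e - c))) \<le> w * (e * r)" using False by (intro mult_left_mono) auto
        moreover have "0 < r + (e - c)" "0 < r" using r c ce by auto
        ultimately show ?thesis
          using c by (simp add: divide_le_eq le_divide_eq mult_ac)
      qed
      also have "\<dots> \<le> (e / c) * ((1 - alpha\<^sup>2) * exp_mixture (r + (e - c)) w)"
        using r c ce e by (intro mult_left_mono div_le_exp_mixture) auto
      finally show ?thesis by (simp add: mult_ac)
    qed
  qed
qed

section \<open>Optional stopping of exponential martingales\<close>

text \<open>Bounded second moments make the sequence uniformly integrable. Fatou's lemma passes the
  bound on to g. The deviation \<open>D\<close> is cut at a level K: dominated convergence handles
  the part below, and the part above is of order \<open>C / K\<close>.\<close>

lemma (in finite_measure) L2_bounded_limit:
  fixes f :: "nat \<Rightarrow> 'a \<Rightarrow> real"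
  assumes [measurable]: "\<And>n. f n \<in> borel_measurable M" "g \<in> borel_measurable M"
    and lim: "AE x in M. (\<lambda>n. f n x) \<longlonglongrightarrow> g x"
    and C: "0 \<le> C" and bound: "\<And>n. (\<integral>\<^sup>+x. ennreal ((f n x)\<^sup>2) \<partial>M) \<le> ennreal C"
  shows "integrable M (f n)" and "integrable M g"
    and "(\<lambda>n. integral\<^sup>L M (f n)) \<longlonglongrightarrow> integral\<^sup>L M g"
proof -
  have sq: "integrable M (\<lambda>x. (h x)\<^sup>2)" "integrable M h" "(\<integral>x. (h x)\<^sup>2 \<partial>M) \<le> C"
    if [measurable]: "h \<in> borel_measurable M" and h: "(\<integral>\<^sup>+x. ennreal ((h x)\<^sup>2) \<partial>M) \<le> ennreal C" for h
  proof -
    show i: "integrable M (\<lambda>x. (h x)\<^sup>2)"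
      using le_less_trans[OF h ennreal_less_top] by (intro integrableI_nonneg) auto
    then show "integrable M h"
      by (rule square_integrable_imp_integrable[rotated]) simp
    show "(\<integral>x. (h x)\<^sup>2 \<partial>M) \<le> C"
      using h C i by (simp add: nn_integral_eq_integral)
  qed
  have g: "(\<integral>\<^sup>+x. ennreal ((g x)\<^sup>2) \<partial>M) \<le> ennreal C"
  proof -
    have "(\<integral>\<^sup>+x. ennreal ((g x)\<^sup>2) \<partial>M) = (\<integral>\<^sup>+x. liminf (\<lambda>n. ennreal ((f n x)\<^sup>2)) \<partial>M)"
    proof (rule nn_integral_cong_AE)
      show "AE x in M. ennreal ((g x)\<^sup>2) = liminf (\<lambda>n. ennreal ((f n x)\<^sup>2))"
        using lim
      proof eventually_elim
        case (elim x)
        then have "(\<lambda>n. ennreal ((f n x)\<^sup>2)) \<longlonglongrightarrow> ennreal ((g x)\<^sup>2)"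
          by (intro tendsto_ennrealI tendsto_power)
        then show ?case by (rule lim_imp_Liminf[OF sequentially_bot, symmetric])
      qed
    qed
    also have "\<dots> \<le> liminf (\<lambda>n. \<integral>\<^sup>+x. ennreal ((f n x)\<^sup>2) \<partial>M)"
      by (rule nn_integral_liminf) simp
    also have "\<dots> \<le> ennreal C"
      by (intro Liminf_le always_eventually allI bound) simp
    finally show ?thesis .
  qed
  note f' = sq[OF assms(1) bound] and g' = sq[OF assms(2) g]
  show "integrable M (f n)" by (rule f')
  show "integrable M g" by (rule g')
  define D where "D n x = \<bar>f n x - g x\<bar>" for n x
  have [measurable]: "D n \<in> borel_measurable M" for n by (simp add: D_def[abs_def])
  have D_int: "integrable M (D n)" for n using f' g' by (simp add: D_def[abs_def])
  have D_sq: "(D n x)\<^sup>2 \<le> 2 * (f n x)\<^sup>2 + 2 * (g x)\<^sup>2" for n x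
    using zero_le_power2[of "f n x + g x"] by (simp add: D_def power2_eq_square algebra_simps)
  have D_sq_int: "integrable M (\<lambda>x. (D n x)\<^sup>2)" for n
    by (rule Bochner_Integration.integrable_bound[where f = "\<lambda>x. 2 * (f n x)\<^sup>2 + 2 * (g x)\<^sup>2"])
       (use f' g' D_sq in \<open>auto intro!: AE_I2\<close>)
  have D_sq_le: "(\<integral>x. (D n x)\<^sup>2 \<partial>M) \<le> 4 * C" for n
  proof -
    have "(\<integral>x. (D n x)\<^sup>2 \<partial>M) \<le> (\<integral>x. 2 * (f n x)\<^sup>2 + 2 * (g x)\<^sup>2 \<partial>M)"
      using f' g' D_sq D_sq_int by (intro integral_mono) auto
    also have "\<dots> \<le> 2 * C + 2 * C"
      using f'(1)[of n] f'(3)[of n] g' by simp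
    finally show ?thesis by simp
  qed
  have trunc: "(\<integral>x. D n x \<partial>M) \<le> (\<integral>x. min (D n x) K \<partial>M) + 4 * C / K" if "0 < K" for n K
  proof -
    have "D n x \<le> min (D n x) K + (D n x)\<^sup>2 / K" for x
    proof (cases "D n x \<le> K")
      case False
      then have "D n x * K \<le> D n x * D n x" using that by (intro mult_left_mono) auto
      then have "D n x \<le> (D n x)\<^sup>2 / K" using that by (simp add: le_divide_eq power2_eq_square)
      then show ?thesis using False that by simp
    qed (use that in auto)
    moreover have "integrable M (\<lambda>x. min (D n x) K)"
      by (rule Bochner_Integration.integrable_bound[OF D_int[of n]]) (use that in \<open>auto simp: D_def\<close>)
    ultimately have "(\<integral>x. D n x \<partial>M) \<le> (\<integral>x. min (D n x) K + (D n x)\<^sup>2 / K \<partial>M)"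
      using D_int D_sq_int by (intro integral_mono) auto
    also have "\<dots> = (\<integral>x. min (D n x) K \<partial>M) + (\<integral>x. (D n x)\<^sup>2 \<partial>M) / K"
      using D_sq_int \<open>integrable M (\<lambda>x. min (D n x) K)\<close> by simp
    also have "\<dots> \<le> (\<integral>x. min (D n x) K \<partial>M) + 4 * C / K"
      using D_sq_le[of n] that by (simp add: divide_right_mono)
    finally show ?thesis .
  qed
  have trunc_lim: "(\<lambda>n. \<integral>x. min (D n x) K \<partial>M) \<longlonglongrightarrow> 0" if "0 < K" for K
  proof -
    have "(\<lambda>n. \<integral>x. min (D n x) K \<partial>M) \<longlonglongrightarrow> (\<integral>x. 0 \<partial>M)"
    proof (rule integral_dominated_convergence[where w = "\<lambda>_. K"])
      show "AE x in M. (\<lambda>n. min (D n x) K) \<longlonglongrightarrow> 0"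
        using lim
      proof (eventually_elim)
        case (elim x)
        then have "(\<lambda>n. min (\<bar>f n x - g x\<bar>) K) \<longlonglongrightarrow> min \<bar>g x - g x\<bar> K" by (intro tendsto_intros)
        then show ?case using that by (simp add: D_def)
      qed
    qed (use that in \<open>auto simp: D_def\<close>)
    then show ?thesis by simp
  qed
  have "(\<lambda>n. \<integral>x. D n x \<partial>M) \<longlonglongrightarrow> 0"
  proof (rule LIMSEQ_I)
    fix e :: real assume e: "0 < e"
    \<comment> \<open>Large enough for the tail bound \<open>4 * C / K\<close> to be at most
      \<open>e / 2\<close>; the summand 1 keeps K positive when \<open>C = 0\<close>.\<close>
    define K where "K = 8 * C / e + 1"
    have K: "0 < K" "4 * C / K < e / 2 \<or> C = 0"
      using e C by (auto simp: K_def field_simps add_nonneg_pos)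
    obtain m where m: "\<And>n. n \<ge> m \<Longrightarrow> norm ((\<integral>x. min (D n x) K \<partial>M) - 0) < e / 2"
      using LIMSEQ_D[OF trunc_lim[OF K(1)], of "e / 2"] e by auto
    have "norm ((\<integral>x. D n x \<partial>M) - 0) < e" if "n \<ge> m" for n
    proof -
      have "0 \<le> (\<integral>x. D n x \<partial>M)" by (rule integral_nonneg_AE) (simp add: D_def)
      moreover have "4 * C / K \<le> e / 2" using K e by auto
      ultimately show ?thesis using trunc[OF K(1), of n] m[OF that] by simp
    qed
    then show "\<exists>m. \<forall>n\<ge>m. norm ((\<integral>x. D n x \<partial>M) - 0) < e" by auto
  qed
  then have "(\<lambda>n. integral\<^sup>L M (f n) - integral\<^sup>L M g) \<longlonglongrightarrow> 0"
  proof (rule Lim_null_comparison[rotated])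
    have "norm (integral\<^sup>L M (f n) - integral\<^sup>L M g) \<le> (\<integral>x. D n x \<partial>M)" for n
      using f' g' integral_norm_bound[of M "\<lambda>x. f n x - g x"] by (simp add: D_def)
    then show "\<forall>\<^sub>F n in sequentially. norm (integral\<^sup>L M (f n) - integral\<^sup>L M g) \<le> (\<integral>x. D n x \<partial>M)"
      by simp
  qed
  then show "(\<lambda>n. integral\<^sup>L M (f n)) \<longlonglongrightarrow> integral\<^sup>L M g"
    by (simp add: LIM_zero_iff)
qed

lemma (in finite_measure) L2_bounded_limit_nn_integral:
  fixes f :: "nat \<Rightarrow> 'a \<Rightarrow> real"
  assumes [measurable]: "\<And>n. f n \<in> borel_measurable M" "g \<in> borel_measurable M"
    and nonneg: "\<And>n x. x \<in> space M \<Longrightarrow> 0 \<le> f n x" "\<And>x. x \<in> space M \<Longrightarrow> 0 \<le> g x"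
    and lim: "AE x in M. (\<lambda>n. f n x) \<longlonglongrightarrow> g x"
    and C: "0 \<le> C" "\<And>n. (\<integral>\<^sup>+x. ennreal ((f n x)\<^sup>2) \<partial>M) \<le> ennreal C"
  shows "(\<lambda>n. \<integral>\<^sup>+x. f n x \<partial>M) \<longlonglongrightarrow> (\<integral>\<^sup>+x. g x \<partial>M)"
proof -
  note L = L2_bounded_limit[OF assms(1,2) lim C]
  have "(\<lambda>n. ennreal (integral\<^sup>L M (f n))) \<longlonglongrightarrow> ennreal (integral\<^sup>L M g)"
    by (intro tendsto_ennrealI L)
  then show ?thesis
    using L nonneg by (simp add: nn_integral_eq_integral)
qed

text \<open>Rounding the random time down to multiples of \<open>1 / (n + 1)\<close> leaves
  countably many values, where measurability is that of single variables; path continuity recovers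
  the time itself.\<close>

lemma measurable_continuous_process:
  fixes X :: "real \<Rightarrow> 'a \<Rightarrow> real"
  assumes X: "\<And>s. s \<in> {a..b} \<Longrightarrow> X s \<in> borel_measurable M"
    and cont: "\<And>w. w \<in> space M \<Longrightarrow> continuous_on {a..b} (\<lambda>s. X s w)"
    and [measurable]: "\<sigma> \<in> borel_measurable M"
    and \<sigma>: "\<And>w. w \<in> space M \<Longrightarrow> \<sigma> w \<in> {a..b}"
  shows "(\<lambda>w. X (\<sigma> w) w) \<in> borel_measurable M"
proof (cases "space M = {}")
  case True
  then show ?thesis by (simp add: measurable_def)
next
  case False
  then have ab: "a \<le> b" using \<sigma> by fastforce
  \<comment> \<open>Rounding down can fall below a, so times are clamped to the interval.\<close>
  define Y where "Y s = X (max a (min b s))" for s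
  have Y: "Y s \<in> borel_measurable M" for s using X ab by (simp add: Y_def)
  have Y_cont: "isCont (\<lambda>s. Y s w) s" if "w \<in> space M" for w s
  proof -
    have "continuous_on UNIV (\<lambda>s. X (max a (min b s)) w)"
      using ab by (intro continuous_on_compose2[OF cont[OF that]] continuous_intros) auto
    then show ?thesis by (simp add: Y_def continuous_on_eq_continuous_at)
  qed
  have "(\<lambda>w. Y (\<sigma> w) w) \<in> borel_measurable M"
  proof (rule borel_measurable_LIMSEQ_real)
    fix n :: nat
    show "(\<lambda>w. Y (real_of_int \<lfloor>real (Suc n) * \<sigma> w\<rfloor> / real (Suc n)) w) \<in> borel_measurable M"
      by (rule measurable_compose_countable[where f = "\<lambda>i. Y (real_of_int i / real (Suc n))"]) (auto intro: Y)
  next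
    fix w assume w: "w \<in> space M"
    have "(\<lambda>n. real_of_int \<lfloor>real (Suc n) * \<sigma> w\<rfloor> / real (Suc n)) \<longlonglongrightarrow> \<sigma> w"
    proof (rule tendsto_sandwich[where f = "\<lambda>n. \<sigma> w - 1 / real (Suc n)" and h = "\<lambda>n. \<sigma> w"])
      have floor: "y - 1 / m \<le> real_of_int \<lfloor>m * y\<rfloor> / m \<and> real_of_int \<lfloor>m * y\<rfloor> / m \<le> y" if "0 < m" for m y :: real
      proof -
        have "(m * y - 1) / m \<le> real_of_int \<lfloor>m * y\<rfloor> / m" "real_of_int \<lfloor>m * y\<rfloor> / m \<le> m * y / m"
          using that by (intro divide_right_mono; linarith)+
        then show ?thesis using that by (simp add: diff_divide_distrib)
      qed
      show "\<forall>\<^sub>F n in sequentially. \<sigma> w - 1 / real (Suc n) \<le> real_of_int \<lfloor>real (Suc n) * \<sigma> w\<rfloor> / real (Suc n)"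
        "\<forall>\<^sub>F n in sequentially. real_of_int \<lfloor>real (Suc n) * \<sigma> w\<rfloor> / real (Suc n) \<le> \<sigma> w"
        using floor[of "real (Suc _)" "\<sigma> w"] by (simp_all del: of_nat_Suc)
      have "(\<lambda>n. \<sigma> w - 1 / real (Suc n)) \<longlonglongrightarrow> \<sigma> w - 0"
        using LIMSEQ_inverse_real_of_nat by (intro tendsto_intros) (simp add: divide_inverse)
      then show "(\<lambda>n. \<sigma> w - 1 / real (Suc n)) \<longlonglongrightarrow> \<sigma> w" by simp
    qed simp
    with Y_cont[OF w] show "(\<lambda>n. Y (real_of_int \<lfloor>real (Suc n) * \<sigma> w\<rfloor> / real (Suc n)) w) \<longlonglongrightarrow> Y (\<sigma> w) w"
      by (rule isCont_tendsto_compose)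
  qed
  then show ?thesis
  proof (rule measurable_cong[THEN iffD1, rotated])
    fix w assume "w \<in> space M"
    from \<sigma>[OF this] show "Y (\<sigma> w) w = X (\<sigma> w) w" by (simp add: Y_def)
  qed
qed

text \<open>The process Q dominates the squares of Y along the approximations of \<open>\<tau>\<close> by times on finite
  grids and so yields their uniform integrability.\<close>

lemma (in finite_measure) optional_stopping:
  fixes Y Q :: "real \<Rightarrow> 'a \<Rightarrow> real" and F :: "real \<Rightarrow> 'a measure"
  assumes T: "0 < T"
    and F: "\<And>s. sets (F s) \<subseteq> sets M" "\<And>s u. s \<le> u \<Longrightarrow> sets (F s) \<subseteq> sets (F u)"
    and [measurable]: "\<tau> \<in> borel_measurable M"
    and \<tau>: "\<And>w. w \<in> space M \<Longrightarrow> \<tau> w \<in> {0..T}"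
    and stop: "\<And>s. s \<in> {0..<T} \<Longrightarrow> {w \<in> space M. \<tau> w \<le> s} \<in> sets (F s)"
    and Y_meas: "\<And>s. s \<in> {0..T} \<Longrightarrow> Y s \<in> borel_measurable M"
    and Y_cont: "\<And>w. w \<in> space M \<Longrightarrow> continuous_on {0..T} (\<lambda>s. Y s w)"
    and Y_nonneg: "\<And>s w. 0 \<le> Y s w"
    and Y_mart: "\<And>s A. s \<in> {0..<T} \<Longrightarrow> A \<in> sets (F s) \<Longrightarrow>
      (\<integral>\<^sup>+w. indicator A w * ennreal (Y s w) \<partial>M) = (\<integral>\<^sup>+w. indicator A w * ennreal (Y T w) \<partial>M)"
    and Q_meas: "\<And>s. s \<in> {0..T} \<Longrightarrow> Q s \<in> borel_measurable M"
    and Q_mart: "\<And>s A. s \<in> {0..<T} \<Longrightarrow> A \<in> sets (F s) \<Longrightarrow>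
      (\<integral>\<^sup>+w. indicator A w * ennreal (Q s w) \<partial>M) = (\<integral>\<^sup>+w. indicator A w * ennreal (Q T w) \<partial>M)"
    and Q_bound: "\<And>s w. s \<in> {0..T} \<Longrightarrow> (Y s w)\<^sup>2 \<le> Q s w"
    and Q_fin: "(\<integral>\<^sup>+w. ennreal (Q T w) \<partial>M) < \<infinity>"
  shows "(\<integral>\<^sup>+w. ennreal (Y (\<tau> w) w) \<partial>M) = (\<integral>\<^sup>+w. ennreal (Y T w) \<partial>M)"
proof -
  \<comment> \<open>Rounding up matters: \<open>k n w \<le> j\<close> then says that
    \<open>\<tau>\<close> has occurred by the j-th grid time, an event known at that time. Rounding
    down would anticipate.\<close>
  define k where "k n w = nat \<lceil>real (Suc n) * \<tau> w / T\<rceil>" for n w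
  define \<rho> where "\<rho> n w = T * real (k n w) / real (Suc n)" for n w
  have [measurable]: "k n \<in> measurable M (count_space UNIV)" for n
    unfolding k_def by measurable
  have k_le: "k n w \<le> j \<longleftrightarrow> \<tau> w \<le> T * real j / real (Suc n)" for n w j
    using T by (simp add: k_def nat_le_iff ceiling_le_iff divide_le_eq le_divide_eq mult_ac del: of_nat_Suc)
  have k_le_Suc: "k n w \<le> Suc n" if "w \<in> space M" for n w
    using \<tau>[OF that] T by (simp add: k_le)
  have grid: "T * real j / real (Suc n) \<in> {0..T}" if "j \<le> Suc n" for j n
  proof -
    have "T * real j \<le> T * real (Suc n)" using that T by (intro mult_left_mono) auto
    then show ?thesis using T by (simp add: pos_divide_le_eq del: of_nat_Suc)
  qed
  have grid_less: "T * real j / real (Suc n) \<in> {0..<T}" if "j < Suc n" for j n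
  proof -
    have "T * real j < T * real (Suc n)" using that T by (intro mult_strict_left_mono) auto
    then show ?thesis using T by (simp add: pos_divide_less_eq del: of_nat_Suc)
  qed
  have \<rho>_range: "\<rho> n w \<in> {0..T}" if "w \<in> space M" for n w
    unfolding \<rho>_def using grid k_le_Suc[OF that] by blast
  have \<rho>_lim: "(\<lambda>n. \<rho> n w) \<longlonglongrightarrow> \<tau> w" if w: "w \<in> space M" for w
  proof (rule tendsto_sandwich[where f = "\<lambda>n. \<tau> w" and h = "\<lambda>n. \<tau> w + T * (1 / real (Suc n))"])
    have "\<tau> w \<le> \<rho> n w" for n using k_le[of n w "k n w"] by (simp add: \<rho>_def)
    moreover have "\<rho> n w \<le> \<tau> w + T * (1 / real (Suc n))" for n
    proof -
      have "real (k n w) \<le> real (Suc n) * \<tau> w / T + 1"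
      proof -
        have "0 \<le> real (Suc n) * \<tau> w / T" using \<tau>[OF w] T by (auto simp del: of_nat_Suc)
        then show ?thesis unfolding k_def by linarith
      qed
      then have "\<rho> n w \<le> T * (real (Suc n) * \<tau> w / T + 1) / real (Suc n)"
        unfolding \<rho>_def using T by (intro divide_right_mono mult_left_mono) auto
      also have "\<dots> = \<tau> w + T * (1 / real (Suc n))" using T by (simp add: distrib_left add_divide_distrib del: of_nat_Suc)
      finally show ?thesis .
    qed
    ultimately show "\<forall>\<^sub>F n in sequentially. \<tau> w \<le> \<rho> n w"
      "\<forall>\<^sub>F n in sequentially. \<rho> n w \<le> \<tau> w + T * (1 / real (Suc n))" by auto
    have "(\<lambda>n. \<tau> w + T * (1 / real (Suc n))) \<longlonglongrightarrow> \<tau> w + T * 0"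
      using LIMSEQ_inverse_real_of_nat by (intro tendsto_intros) (simp add: divide_inverse)
    then show "(\<lambda>n. \<tau> w + T * (1 / real (Suc n))) \<longlonglongrightarrow> \<tau> w" by simp
  qed simp
  have sum_grid: "ennreal (H (\<rho> n w) w) =
      (\<Sum>j\<le>Suc n. indicator {w \<in> space M. k n w = j} w * ennreal (H (T * real j / real (Suc n)) w))"
    if "w \<in> space M" for H :: "real \<Rightarrow> 'a \<Rightarrow> real" and n w
  proof -
    have "(\<Sum>j\<le>Suc n. indicator {w \<in> space M. k n w = j} w * ennreal (H (T * real j / real (Suc n)) w))
      = (\<Sum>j\<le>Suc n. if k n w = j then ennreal (H (T * real j / real (Suc n)) w) else 0)"
      using that by (intro sum.cong) auto
    then show ?thesis using k_le_Suc[OF that, of n] by (simp add: \<rho>_def)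
  qed
  have level: "{w \<in> space M. k n w = j} \<in> sets (F (T * real j / real (Suc n)))" if "j < Suc n" for n j
  proof -
    have le: "{w \<in> space M. k n w \<le> i} \<in> sets (F (T * real j / real (Suc n)))" if "i \<le> j" for i
    proof -
      have "{w \<in> space M. k n w \<le> i} \<in> sets (F (T * real i / real (Suc n)))"
        unfolding k_le using that \<open>j < Suc n\<close> by (intro stop grid_less) simp
      moreover have "T * real i / real (Suc n) \<le> T * real j / real (Suc n)"
        using that T by (intro divide_right_mono mult_left_mono) auto
      ultimately show ?thesis using F(2) by blast
    qed
    show ?thesis
    proof (cases j)
      case 0
      then show ?thesis using le[of 0] by simp
    next
      case (Suc i)
      have "{w \<in> space M. k n w = j} = {w \<in> space M. k n w \<le> j} - {w \<in> space M. k n w \<le> i}"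
        using Suc by auto
      then show ?thesis using le[of j] le[of i] Suc by auto
    qed
  qed
  \<comment> \<open>The integral splits over the level sets of \<open>k n\<close>; on the set
    \<open>k n w = j\<close> the martingale property moves H from the j-th grid time to T.\<close>
  have grid_integral: "(\<integral>\<^sup>+w. ennreal (H (\<rho> n w) w) \<partial>M) = (\<integral>\<^sup>+w. ennreal (H T w) \<partial>M)"
    if H_meas: "\<And>s. s \<in> {0..T} \<Longrightarrow> H s \<in> borel_measurable M"
      and H_mart: "\<And>s A. s \<in> {0..<T} \<Longrightarrow> A \<in> sets (F s) \<Longrightarrow>
      (\<integral>\<^sup>+w. indicator A w * ennreal (H s w) \<partial>M) = (\<integral>\<^sup>+w. indicator A w * ennreal (H T w) \<partial>M)"
    for H :: "real \<Rightarrow> 'a \<Rightarrow> real" and n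
  proof -
    have [measurable]: "H T \<in> borel_measurable M" using T by (intro H_meas) auto
    have summand: "(\<lambda>w. indicator {w \<in> space M. k n w = j} w * ennreal (H (T * real j / real (Suc n)) w))
        \<in> borel_measurable M" if "j \<in> {..Suc n}" for j
    proof -
      have [measurable]: "H (T * real j / real (Suc n)) \<in> borel_measurable M"
        using that by (intro H_meas grid) simp
      show ?thesis by measurable
    qed
    have "(\<integral>\<^sup>+w. ennreal (H (\<rho> n w) w) \<partial>M) = (\<integral>\<^sup>+w. (\<Sum>j\<le>Suc n. indicator {w \<in> space M. k n w = j} w
        * ennreal (H (T * real j / real (Suc n)) w)) \<partial>M)"
      by (intro nn_integral_cong sum_grid)
    also have "\<dots> = (\<Sum>j\<le>Suc n. \<integral>\<^sup>+w. indicator {w \<in> space M. k n w = j} w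
        * ennreal (H (T * real j / real (Suc n)) w) \<partial>M)"
      by (rule nn_integral_sum[OF summand])
    also have "\<dots> = (\<Sum>j\<le>Suc n. \<integral>\<^sup>+w. indicator {w \<in> space M. k n w = j} w * ennreal (H T w) \<partial>M)"
    proof (intro sum.cong refl)
      fix j assume j: "j \<in> {..Suc n}"
      show "(\<integral>\<^sup>+w. indicator {w \<in> space M. k n w = j} w * ennreal (H (T * real j / real (Suc n)) w) \<partial>M)
        = (\<integral>\<^sup>+w. indicator {w \<in> space M. k n w = j} w * ennreal (H T w) \<partial>M)"
      proof (cases "j = Suc n")
        case False
        then have "j < Suc n" using j by simp
        then show ?thesis by (intro H_mart level grid_less)
      next
        case True
        then show ?thesis by (simp del: of_nat_Suc)
      qed
    qed
    also have "\<dots> = (\<integral>\<^sup>+w. (\<Sum>j\<le>Suc n. indicator {w \<in> space M. k n w = j} w * ennreal (H T w)) \<partial>M)"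
      by (rule nn_integral_sum[symmetric]) measurable
    also have "\<dots> = (\<integral>\<^sup>+w. ennreal (H T w) \<partial>M)"
      by (intro nn_integral_cong sum_grid[of _ "\<lambda>_. H T", symmetric])
    finally show ?thesis .
  qed
  obtain C where C: "0 \<le> C" "(\<integral>\<^sup>+w. ennreal (Q T w) \<partial>M) = ennreal C"
    using Q_fin by (cases "\<integral>\<^sup>+w. ennreal (Q T w) \<partial>M" rule: ennreal_cases) auto
  have [measurable]: "\<rho> n \<in> borel_measurable M" for n
    unfolding \<rho>_def by measurable
  have "(\<lambda>n. \<integral>\<^sup>+w. ennreal (Y (\<rho> n w) w) \<partial>M) \<longlonglongrightarrow> (\<integral>\<^sup>+w. ennreal (Y (\<tau> w) w) \<partial>M)"
  proof (rule L2_bounded_limit_nn_integral[OF _ _ _ _ _ C(1)])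
    show "(\<lambda>w. Y (\<rho> n w) w) \<in> borel_measurable M" for n
      by (rule measurable_continuous_process[of 0 T]) (use \<rho>_range Y_meas Y_cont in auto)
    show "(\<lambda>w. Y (\<tau> w) w) \<in> borel_measurable M"
      by (rule measurable_continuous_process[of 0 T]) (use \<tau> Y_meas Y_cont in auto)
    show "AE w in M. (\<lambda>n. Y (\<rho> n w) w) \<longlonglongrightarrow> Y (\<tau> w) w"
    proof (rule AE_I2)
      fix w assume w: "w \<in> space M"
      show "(\<lambda>n. Y (\<rho> n w) w) \<longlonglongrightarrow> Y (\<tau> w) w"
        using continuous_on_tendsto_compose[OF Y_cont[OF w] \<rho>_lim[OF w] \<tau>[OF w]] \<rho>_range[OF w] by simp
    qed
    fix n
    have "(\<integral>\<^sup>+w. ennreal ((Y (\<rho> n w) w)\<^sup>2) \<partial>M) \<le> (\<integral>\<^sup>+w. ennreal (Q (\<rho> n w) w) \<partial>M)"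
      using Q_bound \<rho>_range by (intro nn_integral_mono ennreal_leI) auto
    also have "\<dots> = (\<integral>\<^sup>+w. ennreal (Q T w) \<partial>M)"
      by (rule grid_integral[of Q]) (fact Q_meas, fact Q_mart)
    also note C(2)
    finally show "(\<integral>\<^sup>+w. ennreal ((Y (\<rho> n w) w)\<^sup>2) \<partial>M) \<le> ennreal C" .
  qed (auto simp: Y_nonneg)
  moreover have "(\<integral>\<^sup>+w. ennreal (Y (\<rho> n w) w) \<partial>M) = (\<integral>\<^sup>+w. ennreal (Y T w) \<partial>M)" for n
    by (rule grid_integral[of Y]) (fact Y_meas, fact Y_mart)
  ultimately show ?thesis
    by (simp add: LIMSEQ_const_iff)
qed

text \<open>The martingale property is stated between a time s and the horizon T, integrated over
  events of \<open>F s\<close> with values in \<open>ennreal\<close>, so no conditional expectation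
  appears. The measure is finite but not normalised, since it will be the restriction of M to a
  value of \<theta>. That increments of Z are Gaussian in the clock r enters through their
  exponential moments alone.\<close>

locale exponential_martingale = finite_measure N
  for N :: "'w measure" +
  fixes F :: "real \<Rightarrow> 'w measure" and Z :: "real \<Rightarrow> 'w \<Rightarrow> real" and r :: "real \<Rightarrow> real" and T z :: real
  assumes T_pos: "0 < T"
    and space_F: "\<And>s. space (F s) = space N"
    and sets_F: "\<And>s. sets (F s) \<subseteq> sets N"
    and F_mono: "\<And>s u. s \<le> u \<Longrightarrow> sets (F s) \<subseteq> sets (F u)"
    and measurable_Z: "\<And>s. s \<in> {0..T} \<Longrightarrow> Z s \<in> borel_measurable N"
    and continuous_Z: "\<And>w. w \<in> space N \<Longrightarrow> continuous_on {0..T} (\<lambda>s. Z s w)"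
    and Z_0: "AE w in N. Z 0 w = z"
    and continuous_r: "continuous_on {0..T} r"
    and r_le: "\<And>s. s \<in> {0..T} \<Longrightarrow> r s \<le> r T"
    and exp_increment: "\<And>s A l. s \<in> {0..<T} \<Longrightarrow> A \<in> sets (F s) \<Longrightarrow>
      (\<integral>\<^sup>+w. indicator A w * ennreal (exp (l * Z T w)) \<partial>N)
        = ennreal (exp (l\<^sup>2 * (r T - r s) / 2)) * (\<integral>\<^sup>+w. indicator A w * ennreal (exp (l * Z s w)) \<partial>N)"
begin

definition E :: "real \<Rightarrow> real \<Rightarrow> 'w \<Rightarrow> real" where
  "E l s w = exp (l * Z s w - l\<^sup>2 * r s / 2)"

lemma measurable_E: "s \<in> {0..T} \<Longrightarrow> E l s \<in> borel_measurable N"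
  using measurable_Z[of s] unfolding E_def by simp

lemma continuous_E: "w \<in> space N \<Longrightarrow> continuous_on {0..T} (\<lambda>s. E l s w)"
  unfolding E_def by (intro continuous_intros continuous_Z continuous_r) auto

lemma E_martingale:
  assumes s: "s \<in> {0..<T}" and A: "A \<in> sets (F s)"
  shows "(\<integral>\<^sup>+w. indicator A w * ennreal (E l s w) \<partial>N) = (\<integral>\<^sup>+w. indicator A w * ennreal (E l T w) \<partial>N)"
proof -
  have [measurable]: "A \<in> sets N" "Z s \<in> borel_measurable N" "Z T \<in> borel_measurable N"
    using A sets_F s by (auto intro!: measurable_Z)
  have E_eq: "(\<integral>\<^sup>+w. indicator A w * ennreal (E l u w) \<partial>N)
      = ennreal (exp (- (l\<^sup>2 * r u / 2))) * (\<integral>\<^sup>+w. indicator A w * ennreal (exp (l * Z u w)) \<partial>N)"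
    if "Z u \<in> borel_measurable N" for u
    using that
    by (subst nn_integral_cmult[symmetric])
       (auto simp: E_def mult_ac simp flip: ennreal_mult' exp_add intro!: nn_integral_cong split: split_indicator)
  have "l\<^sup>2 * (r T - r s) / 2 - l\<^sup>2 * r T / 2 = - (l\<^sup>2 * r s / 2)"
    by (simp add: algebra_simps diff_divide_distrib)
  then have "exp (- (l\<^sup>2 * r T / 2)) * exp (l\<^sup>2 * (r T - r s) / 2) = exp (- (l\<^sup>2 * r s / 2))"
    by (simp flip: exp_add)
  then show ?thesis
    unfolding E_eq[OF \<open>Z s \<in> _\<close>] E_eq[OF \<open>Z T \<in> _\<close>] exp_increment[OF s A]
    by (simp flip: mult.assoc ennreal_mult')
qed

lemma nn_integral_E_T:
  "(\<integral>\<^sup>+w. ennreal (E l T w) \<partial>N) = ennreal (exp (l * z - l\<^sup>2 * r 0 / 2)) * emeasure N (space N)"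
proof -
  have "space N \<in> sets (F 0)" using space_F sets.top by metis
  then have "(\<integral>\<^sup>+w. indicator (space N) w * ennreal (E l T w) \<partial>N)
      = (\<integral>\<^sup>+w. indicator (space N) w * ennreal (E l 0 w) \<partial>N)"
    using T_pos by (intro E_martingale[symmetric]) auto
  moreover have "(\<integral>\<^sup>+w. ennreal (E l u w) \<partial>N) = (\<integral>\<^sup>+w. indicator (space N) w * ennreal (E l u w) \<partial>N)" for u
    by (rule nn_integral_cong) simp
  moreover have "(\<integral>\<^sup>+w. ennreal (E l 0 w) \<partial>N) = (\<integral>\<^sup>+w. ennreal (exp (l * z - l\<^sup>2 * r 0 / 2)) \<partial>N)"
    using Z_0 by (intro nn_integral_cong_AE) (auto simp: E_def elim: eventually_mono)
  ultimately show ?thesis by simp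
qed

lemma nn_integral_E_stopped:
  assumes [measurable]: "\<tau> \<in> borel_measurable N"
    and \<tau>: "\<And>w. w \<in> space N \<Longrightarrow> \<tau> w \<in> {0..T}"
    and stop: "\<And>s. s \<in> {0..<T} \<Longrightarrow> {w \<in> space N. \<tau> w \<le> s} \<in> sets (F s)"
  shows "(\<integral>\<^sup>+w. ennreal (E l (\<tau> w) w) \<partial>N) = ennreal (exp (l * z - l\<^sup>2 * r 0 / 2)) * emeasure N (space N)"
proof -
  \<comment> \<open>The square of \<open>E l s\<close> is \<open>E (2 * l) s\<close> times
    \<open>exp (l\<^sup>2 * r s)\<close>, and the clock is at most \<open>r T\<close>; so a constant
    multiple of the martingale for \<open>2 * l\<close> dominates the square.\<close>
  define Q where "Q s w = exp (l\<^sup>2 * r T) * E (2 * l) s w" for s w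
  have Q_int: "(\<integral>\<^sup>+w. c w * ennreal (Q s w) \<partial>N) = ennreal (exp (l\<^sup>2 * r T)) * (\<integral>\<^sup>+w. c w * ennreal (E (2 * l) s w) \<partial>N)"
    if [measurable]: "c \<in> borel_measurable N" and "s \<in> {0..T}" for s and c :: "'w \<Rightarrow> ennreal"
    using that measurable_E[of s "2 * l"]
    by (subst nn_integral_cmult[symmetric]) (auto simp: Q_def ennreal_mult' mult_ac)
  have "(\<integral>\<^sup>+w. ennreal (E l (\<tau> w) w) \<partial>N) = (\<integral>\<^sup>+w. ennreal (E l T w) \<partial>N)"
  proof (rule optional_stopping[where F = F and Q = Q])
    show "(E l s w)\<^sup>2 \<le> Q s w" if "s \<in> {0..T}" for s w
    proof -
      have "(E l s w)\<^sup>2 = exp (l\<^sup>2 * r s) * E (2 * l) s w"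
        by (simp add: E_def power2_eq_square algebra_simps flip: exp_add)
      also have "\<dots> \<le> Q s w"
        unfolding Q_def using r_le[OF that] by (intro mult_right_mono) (auto simp: mult_left_mono E_def)
      finally show ?thesis .
    qed
    show "Q s \<in> borel_measurable N" if "s \<in> {0..T}" for s
      using measurable_E[OF that, of "2 * l"] by (simp add: Q_def[abs_def])
    show "(\<integral>\<^sup>+w. indicator A w * ennreal (Q s w) \<partial>N) = (\<integral>\<^sup>+w. indicator A w * ennreal (Q T w) \<partial>N)"
      if s: "s \<in> {0..<T}" and A: "A \<in> sets (F s)" for s A
    proof -
      have [measurable]: "A \<in> sets N" using A sets_F by blast
      show ?thesis using s T_pos E_martingale[OF s A, of "2 * l"] by (simp add: Q_int)
    qed
    show "(\<integral>\<^sup>+w. ennreal (Q T w) \<partial>N) < \<infinity>"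
    proof -
      have "emeasure N (space N) < \<top>" using emeasure_finite top.not_eq_extremum by blast
      then show ?thesis
        using Q_int[of "\<lambda>_. 1" T] T_pos by (simp add: nn_integral_E_T ennreal_mult_less_top)
    qed
  qed (fact T_pos sets_F F_mono assms(1) \<tau> stop E_martingale measurable_E continuous_E
      | simp add: E_def)+
  then show ?thesis by (simp add: nn_integral_E_T)
qed

end

section \<open>Increments of Brownian motion\<close>

text \<open>The assumption on \<open>\<E>\<close> expresses that g has the constant conditional
  expectation k given G. It extends from a generating \<pi>-system to all of G by uniqueness for the
  measures with densities g and k, both restricted to G. The lemma serves for Brownian increments
  given the past and for \<theta> given B.\<close>

lemma nn_integral_mult_subalgebra:
  assumes "finite_measure M" and sub: "subalgebra M G"
    and gen: "Int_stable \<E>" "sets G = sigma_sets (space M) \<E>" "space M \<in> \<E>" "\<E> \<subseteq> Pow (space M)"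
    and [measurable]: "g \<in> borel_measurable M" and k: "k < \<infinity>"
    and eq: "\<And>A. A \<in> \<E> \<Longrightarrow> (\<integral>\<^sup>+w. indicator A w * g w \<partial>M) = k * emeasure M A"
    and f: "f \<in> borel_measurable G"
  shows "(\<integral>\<^sup>+w. f w * g w \<partial>M) = (k :: ennreal) * (\<integral>\<^sup>+w. f w \<partial>M)"
proof -
  interpret finite_measure M by fact
  have sub': "subalgebra (density M h) G" for h
    using sub by (auto simp: subalgebra_def)
  have \<E>_M: "A \<in> sets M" if "A \<in> \<E>" for A
    using that sub gen by (auto simp: subalgebra_def)
  have \<E>_G: "A \<in> sets G" if "A \<in> \<E>" for A
    using that gen by auto
  have eq': "emeasure (restr_to_subalg (density M g) G) A = emeasure (restr_to_subalg (density M (\<lambda>_. k)) G) A"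
    if "A \<in> \<E>" for A
    using eq[OF that] \<E>_M[OF that] \<E>_G[OF that]
    by (simp add: emeasure_restr_to_subalg[OF sub'] emeasure_density mult.commute[of "g _"] nn_integral_cmult)
  have same: "restr_to_subalg (density M g) G = restr_to_subalg (density M (\<lambda>_. k)) G"
  proof (rule measure_eqI_generator_eq[OF gen(1,4) eq'])
    show "emeasure (restr_to_subalg (density M g) G) (space M) \<noteq> \<infinity>"
      using gen(3) k emeasure_finite[of "space M"] \<E>_G[OF gen(3)]
      by (subst eq') (auto simp: emeasure_restr_to_subalg[OF sub'] emeasure_density nn_integral_cmult
          ennreal_mult_eq_top_iff less_top)
  qed (use gen in \<open>auto simp: sets_restr_to_subalg[OF sub']\<close>)
  have f_M [measurable]: "f \<in> borel_measurable M"
    using f sub by (rule measurable_from_subalg[rotated])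
  have "(\<integral>\<^sup>+w. f w * g w \<partial>M) = (\<integral>\<^sup>+w. f w \<partial>density M g)"
    by (simp add: nn_integral_density mult.commute)
  also have "\<dots> = (\<integral>\<^sup>+w. f w \<partial>density M (\<lambda>_. k))"
    using f same by (simp flip: nn_integral_subalgebra2[OF sub'])
  also have "\<dots> = k * (\<integral>\<^sup>+w. f w \<partial>M)"
    by (simp add: nn_integral_density nn_integral_cmult)
  finally show ?thesis .
qed

lemma space_generated_algebra [simp]: "space (generated_algebra M Y I) = space M"
  unfolding generated_algebra_def by (rule space_measure_of) auto

lemma sets_generated_algebra:
  "sets (generated_algebra M Y I) = sigma_sets (space M) (\<Union>r\<in>I. {Y r -` A \<inter> space M | A. A \<in> sets borel})"
  unfolding generated_algebra_def by (rule sets_measure_of) auto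

lemma sets_generated_algebra_mono:
  "I \<subseteq> J \<Longrightarrow> sets (generated_algebra M Y I) \<subseteq> sets (generated_algebra M Y J)"
  unfolding sets_generated_algebra by (rule sigma_sets_mono') auto

lemma measurable_generated_algebra:
  "r \<in> I \<Longrightarrow> Y r \<in> borel_measurable (generated_algebra M Y I)"
  by (rule measurableI) (auto simp: sets_generated_algebra)

lemma sets_generated_algebra_subset:
  assumes "\<And>r. r \<in> I \<Longrightarrow> Y r \<in> borel_measurable M"
  shows "sets (generated_algebra M Y I) \<subseteq> sets M"
  unfolding sets_generated_algebra
  using assms by (intro sets.sigma_sets_subset) (auto dest: measurable_sets)

text \<open>Exponential tilting moves the mean of a centred normal density to
  \<open>c * \<sigma>\<^sup>2\<close> and leaves a constant factor, which is the integral.\<close>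

lemma nn_integral_exp_normal:
  assumes \<sigma>: "0 < \<sigma>" and X: "distributed M lborel X (normal_density 0 \<sigma>)"
  shows "(\<integral>\<^sup>+w. ennreal (exp (c * X w)) \<partial>M) = ennreal (exp (c\<^sup>2 * \<sigma>\<^sup>2 / 2))"
proof -
  have *: "normal_density 0 \<sigma> y * exp (c * y) = exp (c\<^sup>2 * \<sigma>\<^sup>2 / 2) * normal_density (c * \<sigma>\<^sup>2) \<sigma> y" for y
  proof -
    have "- y\<^sup>2 / (2 * \<sigma>\<^sup>2) + c * y = c\<^sup>2 * \<sigma>\<^sup>2 / 2 + - (y - c * \<sigma>\<^sup>2)\<^sup>2 / (2 * \<sigma>\<^sup>2)"
      using \<sigma> by (simp add: field_simps power2_eq_square)
    then have "exp (- y\<^sup>2 / (2 * \<sigma>\<^sup>2)) * exp (c * y) = exp (c\<^sup>2 * \<sigma>\<^sup>2 / 2) * exp (- (y - c * \<sigma>\<^sup>2)\<^sup>2 / (2 * \<sigma>\<^sup>2))"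
      by (simp flip: exp_add)
    then show ?thesis by (simp add: normal_density_def)
  qed
  have "(\<integral>\<^sup>+w. ennreal (exp (c * X w)) \<partial>M) = (\<integral>\<^sup>+y. ennreal (normal_density 0 \<sigma> y) * ennreal (exp (c * y)) \<partial>lborel)"
    by (rule distributed_nn_integral[OF X, symmetric]) simp
  also have "\<dots> = (\<integral>\<^sup>+y. ennreal (exp (c\<^sup>2 * \<sigma>\<^sup>2 / 2)) * ennreal (normal_density (c * \<sigma>\<^sup>2) \<sigma> y) \<partial>lborel)"
    by (simp add: * flip: ennreal_mult')
  also have "\<dots> = ennreal (exp (c\<^sup>2 * \<sigma>\<^sup>2 / 2)) * 1"
    using \<sigma> by (subst nn_integral_cmult) (simp_all add: nn_integral_eq_integral)
  finally show ?thesis by simp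
qed

context standard_brownian_motion
begin

lemma nn_integral_exp_increment_self:
  assumes "0 \<le> u" "u \<le> v"
  shows "(\<integral>\<^sup>+w. ennreal (exp (c * (B v w - B u w))) \<partial>M) = ennreal (exp (c\<^sup>2 * (v - u) / 2))"
proof (cases "u = v")
  case True
  then show ?thesis by (simp add: emeasure_space_1)
next
  case False
  then show ?thesis
    using assms gaussian_increments[of u v] nn_integral_exp_normal[of "sqrt (v - u)" M "\<lambda>w. B v w - B u w" c]
    by simp
qed

text \<open>Independence is available for increments along one increasing sequence of times. Sorting
  the times of J together with 0 and u turns the values \<open>B s\<close> into partial sums of
  increments that all precede the increment from u to v.\<close>

lemma nn_integral_exp_increment_cylinder:
  assumes u: "0 \<le> u" "u \<le> v" and J: "finite J" "J \<subseteq> {0..u}" and A: "\<And>s. A s \<in> sets borel"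
  shows "(\<integral>\<^sup>+w. indicator {w \<in> space M. \<forall>s\<in>J. B s w \<in> A s} w * ennreal (exp (c * (B v w - B u w))) \<partial>M)
    = ennreal (exp (c\<^sup>2 * (v - u) / 2)) * emeasure M {w \<in> space M. \<forall>s\<in>J. B s w \<in> A s}"
proof -
  define L where "L = sorted_list_of_set (insert 0 (insert u J))"
  define n where "n = length L"
  \<comment> \<open>Index \<open>n - 1\<close> is u and every later index is v. The sequence is thus
    monotone on all natural numbers, and its increment of index \<open>n - 1\<close> is the one from
    u to v.\<close>
  define s where "s i = (if i < n then L ! i else v)" for i
  have set_L: "set L = insert 0 (insert u J)" and "sorted L"
    using J(1) unfolding L_def
    by (simp_all only: set_sorted_list_of_set finite_insert sorted_sorted_list_of_set)
  have "n \<noteq> 0" using set_L by (auto simp: n_def)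
  have L_range: "L ! i \<in> {0..u}" if "i < n" for i
    using nth_mem[of i L] that set_L J(2) u by (auto simp: n_def)
  have L_mono: "L ! i \<le> L ! j" if "i \<le> j" "j < n" for i j
    using \<open>sorted L\<close> that by (auto simp: n_def intro: sorted_nth_mono)
  obtain i j where ij: "i < n" "L ! i = 0" "j < n" "L ! j = u"
    using set_L unfolding n_def by (metis in_set_conv_nth insertCI)
  have L_0: "L ! 0 = 0"
    using L_mono[of 0 i] L_range[of 0] ij by simp
  have L_last: "L ! (n - 1) = u"
    using L_mono[of j "n - 1"] L_range[of "n - 1"] ij by force
  have "mono s"
  proof (rule monoI)
    fix i j :: nat assume "i \<le> j"
    then show "s i \<le> s j"
      using L_mono[of i j] L_range[of i] u by (auto simp: s_def)
  qed
  define D where "D i w = B (s (Suc i)) w - B (s i) w" for i w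
  have "indep_vars (\<lambda>_. borel) D {..<n}"
    unfolding D_def using independent_increments[OF _ \<open>mono s\<close>] L_0 \<open>n \<noteq> 0\<close> by (simp add: s_def)
  then have indep: "indep_var (PiM {..<n - 1} (\<lambda>_. borel)) (\<lambda>w. restrict (\<lambda>i. D i w) {..<n - 1})
      (PiM {n - 1} (\<lambda>_. borel)) (\<lambda>w. restrict (\<lambda>i. D i w) {n - 1})"
    using \<open>n \<noteq> 0\<close> by (intro indep_var_restrict) auto
  \<comment> \<open>The indicator of the cylinder as a function of the increments. Since
    \<open>i < j < n\<close>, it reads only indices below \<open>n - 1\<close>, which separates it
    from R.\<close>
  define P :: "(nat \<Rightarrow> real) \<Rightarrow> ennreal" where
    "P d = (\<Prod>j<n. if L ! j \<in> J then indicator (A (L ! j)) (\<Sum>i<j. d i) else 1)" for d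
  define R :: "(nat \<Rightarrow> real) \<Rightarrow> ennreal" where "R d = ennreal (exp (c * d (n - 1)))" for d
  have P: "P \<in> borel_measurable (PiM {..<n - 1} (\<lambda>_. borel))"
  proof -
    have "(\<lambda>d. if L ! j \<in> J then indicator (A (L ! j)) (\<Sum>i<j. d i) else 1 :: ennreal)
        \<in> borel_measurable (PiM {..<n - 1} (\<lambda>_. borel))" if "j < n" for j
    proof -
      have [measurable]: "(\<lambda>d. \<Sum>i<j. d i) \<in> borel_measurable (PiM {..<n - 1} (\<lambda>_. borel :: real measure))"
        using that by (intro borel_measurable_sum measurable_component_singleton) auto
      note A[measurable]
      show ?thesis by measurable
    qed
    then show ?thesis unfolding P_def by (intro borel_measurable_prod_ennreal) auto
  qed
  have R: "R \<in> borel_measurable (PiM {n - 1} (\<lambda>_. borel))"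
    unfolding R_def by measurable
  have "indep_vars (\<lambda>_. borel) (case_bool (P \<circ> (\<lambda>w. restrict (\<lambda>i. D i w) {..<n - 1}))
      (R \<circ> (\<lambda>w. restrict (\<lambda>i. D i w) {n - 1}))) UNIV"
    using indep_var_compose[OF indep P R] unfolding indep_var_def
    by (simp add: case_bool_if cong: if_cong)
  from indep_vars_nn_integral[OF _ this]
  have prod: "(\<integral>\<^sup>+w. P (restrict (\<lambda>i. D i w) {..<n - 1}) * R (restrict (\<lambda>i. D i w) {n - 1}) \<partial>M)
      = (\<integral>\<^sup>+w. P (restrict (\<lambda>i. D i w) {..<n - 1}) \<partial>M) * (\<integral>\<^sup>+w. R (restrict (\<lambda>i. D i w) {n - 1}) \<partial>M)"
    by (simp add: UNIV_bool mult.commute comp_def)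
  have R_eq: "R (restrict (\<lambda>i. D i w) {n - 1}) = ennreal (exp (c * (B v w - B u w)))" for w
    using \<open>n \<noteq> 0\<close> L_last by (simp add: R_def D_def s_def)
  \<comment> \<open>Only almost everywhere: the partial sums telescope to
    \<open>B s w - B 0 w\<close>, and \<open>B 0\<close> vanishes outside a null set.\<close>
  have P_eq: "AE w in M. P (restrict (\<lambda>i. D i w) {..<n - 1}) = indicator {w \<in> space M. \<forall>s\<in>J. B s w \<in> A s} w"
    using start_at_0 AE_space
  proof eventually_elim
    case (elim w)
    have sum: "(\<Sum>i<j. restrict (\<lambda>i. D i w) {..<n - 1} i) = B (L ! j) w" if "j < n" for j
    proof -
      have "(\<Sum>i<j. restrict (\<lambda>i. D i w) {..<n - 1} i) = (\<Sum>i<j. D i w)"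
        using that by (intro sum.cong) auto
      also have "\<dots> = B (s j) w - B (s 0) w"
        unfolding D_def by (rule sum_lessThan_telescope)
      finally show ?thesis using that elim L_0 \<open>n \<noteq> 0\<close> by (simp add: s_def)
    qed
    have "P (restrict (\<lambda>i. D i w) {..<n - 1})
        = (\<Prod>j<n. if L ! j \<in> J then indicator (A (L ! j)) (B (L ! j) w) else 1)"
      unfolding P_def using sum by (intro prod.cong refl) (simp del: restrict_apply)
    also have "\<dots> = indicator {w \<in> space M. \<forall>s\<in>J. B s w \<in> A s} w"
    proof (cases "\<forall>s\<in>J. B s w \<in> A s")
      case True
      then show ?thesis using \<open>w \<in> space M\<close> by (simp cong: if_cong)
    next
      case False
      then obtain j where "j < n" "L ! j \<in> J" "B (L ! j) w \<notin> A (L ! j)"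
        using set_L unfolding n_def by (metis in_set_conv_nth insertCI)
      then show ?thesis using False by (auto intro!: prod_zero bexI[of _ j])
    qed
    finally show ?case .
  qed
  have C: "{w \<in> space M. \<forall>s\<in>J. B s w \<in> A s} \<in> sets M"
  proof (rule sets.sets_Collect_finite_All[OF _ J(1)])
    fix s assume "s \<in> J"
    then have "B s \<in> borel_measurable M" using J(2) by (intro random_variable_B) auto
    then show "{w \<in> space M. B s w \<in> A s} \<in> sets M" using A by measurable
  qed
  have "(\<integral>\<^sup>+w. indicator {w \<in> space M. \<forall>s\<in>J. B s w \<in> A s} w * ennreal (exp (c * (B v w - B u w))) \<partial>M)
      = (\<integral>\<^sup>+w. P (restrict (\<lambda>i. D i w) {..<n - 1}) * R (restrict (\<lambda>i. D i w) {n - 1}) \<partial>M)"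
    unfolding R_eq using P_eq by (intro nn_integral_cong_AE) (elim eventually_mono, simp)
  also have "\<dots> = (\<integral>\<^sup>+w. indicator {w \<in> space M. \<forall>s\<in>J. B s w \<in> A s} w \<partial>M)
      * (\<integral>\<^sup>+w. ennreal (exp (c * (B v w - B u w))) \<partial>M)"
    using prod nn_integral_cong_AE[OF P_eq] by (simp only: R_eq)
  finally show ?thesis
    using C u by (simp add: nn_integral_exp_increment_self mult.commute)
qed

lemma subalgebra_past: "subalgebra M (generated_algebra M B {0..u})"
  unfolding subalgebra_def using sets_generated_algebra_subset[of "{0..u}" B M] random_variable_B by auto

text \<open>Cylinder events are closed under intersection and generate the past, so the
  factorisation on cylinders carries over to nonnegative functions of the past.\<close>

lemma nn_integral_exp_increment:
  assumes u: "0 \<le> u" "u \<le> v" and f: "f \<in> borel_measurable (generated_algebra M B {0..u})"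
  shows "(\<integral>\<^sup>+w. f w * ennreal (exp (c * (B v w - B u w))) \<partial>M)
    = ennreal (exp (c\<^sup>2 * (v - u) / 2)) * (\<integral>\<^sup>+w. f w \<partial>M)"
proof -
  define \<E> where "\<E> = {{w \<in> space M. \<forall>s\<in>J. B s w \<in> A s} | J A.
    finite J \<and> J \<subseteq> {0..u} \<and> (\<forall>s. A s \<in> sets (borel :: real measure))}"
  show ?thesis
  proof (rule nn_integral_mult_subalgebra[OF finite_measure_axioms subalgebra_past _ _ _ _ _ _ _ f, of \<E>])
    show "Int_stable \<E>"
    proof (rule Int_stableI)
      fix a b assume "a \<in> \<E>" "b \<in> \<E>"
      then obtain J A J' A' where a: "a = {w \<in> space M. \<forall>s\<in>J. B s w \<in> A s}"
        and b: "b = {w \<in> space M. \<forall>s\<in>J'. B s w \<in> A' s}"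
        and J: "finite J" "J \<subseteq> {0..u}" "\<And>s. A s \<in> sets borel"
        and J': "finite J'" "J' \<subseteq> {0..u}" "\<And>s. A' s \<in> sets borel"
        unfolding \<E>_def by blast
      \<comment> \<open>A coordinate constrained by only one of the two cylinders gets
        \<open>UNIV\<close> from the other.\<close>
      let ?A = "\<lambda>s. (if s \<in> J then A s else UNIV) \<inter> (if s \<in> J' then A' s else UNIV)"
      have "a \<inter> b = {w \<in> space M. \<forall>s\<in>J \<union> J'. B s w \<in> ?A s}"
        unfolding a b by auto
      moreover have "\<forall>s. ?A s \<in> sets borel" using J J' by auto
      ultimately show "a \<inter> b \<in> \<E>"
        unfolding \<E>_def using J J' by (intro CollectI exI[of _ "J \<union> J'"] exI[of _ ?A]) auto
    qed
    show \<E>_Pow: "\<E> \<subseteq> Pow (space M)" unfolding \<E>_def by auto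
    show "space M \<in> \<E>" unfolding \<E>_def by (intro CollectI exI[of _ "{}"] exI[of _ "\<lambda>_. UNIV"]) auto
    show "sets (generated_algebra M B {0..u}) = sigma_sets (space M) \<E>"
      unfolding sets_generated_algebra
    proof (rule sigma_sets_eqI)
      fix a assume "a \<in> (\<Union>r\<in>{0..u}. {B r -` A \<inter> space M | A. A \<in> sets borel})"
      then obtain r A where "r \<in> {0..u}" "A \<in> sets borel" "a = B r -` A \<inter> space M" by blast
      then have "a \<in> \<E>"
        unfolding \<E>_def by (intro CollectI exI[of _ "{r}"] exI[of _ "\<lambda>_. A"]) auto
      then show "a \<in> sigma_sets (space M) \<E>" ..
    next
      fix a assume "a \<in> \<E>"
      then obtain J A where a: "a = {w \<in> space M. \<forall>s\<in>J. B s w \<in> A s}"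
        and J: "finite J" "J \<subseteq> {0..u}" "\<And>s. A s \<in> sets borel"
        unfolding \<E>_def by blast
      have "{w \<in> space (generated_algebra M B {0..u}). \<forall>s\<in>J. B s w \<in> A s} \<in> sets (generated_algebra M B {0..u})"
      proof (rule sets.sets_Collect_finite_All[OF _ J(1)])
        fix s assume "s \<in> J"
        then have "B s \<in> borel_measurable (generated_algebra M B {0..u})"
          using J(2) by (intro measurable_generated_algebra) auto
        from measurable_sets[OF this J(3)[of s]]
        show "{w \<in> space (generated_algebra M B {0..u}). B s w \<in> A s} \<in> sets (generated_algebra M B {0..u})"
          by (simp add: vimage_def Int_def conj_commute)
      qed
      then show "a \<in> sigma_sets (space M) (\<Union>r\<in>{0..u}. {B r -` A \<inter> space M | A. A \<in> sets borel})"
        by (simp add: a sets_generated_algebra)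
    qed
    show "(\<lambda>w. ennreal (exp (c * (B v w - B u w)))) \<in> borel_measurable M"
      using random_variable_B[of u] random_variable_B[of v] u by simp
    show "(\<integral>\<^sup>+w. indicator C w * ennreal (exp (c * (B v w - B u w))) \<partial>M)
      = ennreal (exp (c\<^sup>2 * (v - u) / 2)) * emeasure M C" if "C \<in> \<E>" for C
      using that nn_integral_exp_increment_cylinder[OF u] unfolding \<E>_def by blast
  qed simp
qed

end

section \<open>Exponential martingales of the observed process\<close>

text \<open>The grid of index n has \<open>Suc n\<close> cells.\<close>

definition grid :: "real \<Rightarrow> real \<Rightarrow> nat \<Rightarrow> nat \<Rightarrow> real" where
  "grid s v n k = s + real k * (v - s) / real (Suc n)"

lemma grid_0 [simp]: "grid s v n 0 = s"
  by (simp add: grid_def)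

lemma grid_Suc_n [simp]: "grid s v n (Suc n) = v"
  by (simp add: grid_def del: of_nat_Suc)

lemma grid_step: "grid s v n (Suc k) = grid s v n k + (v - s) / real (Suc n)"
  by (simp add: grid_def add_divide_distrib distrib_right)

lemma mono_grid: "s \<le> v \<Longrightarrow> mono (grid s v n)"
  unfolding grid_def by (intro monoI add_left_mono divide_right_mono mult_right_mono) auto

lemma grid_bounds: "s \<le> v \<Longrightarrow> k \<le> Suc n \<Longrightarrow> grid s v n k \<in> {s..v}"
  using monoD[OF mono_grid, of s v 0 k n] monoD[OF mono_grid, of s v k "Suc n" n] by simp

text \<open>The variance of the sum of Brownian increments with weights
  \<open>1 / (S - grid s v n k)\<close>. It is a Riemann sum for the integral of
  \<open>1 / (S - r)\<^sup>2\<close>, which is the increment of the clock.\<close>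

definition grid_quadratic :: "real \<Rightarrow> real \<Rightarrow> real \<Rightarrow> nat \<Rightarrow> real" where
  "grid_quadratic S s v n = (\<Sum>k<Suc n. (1 / (S - grid s v n k))\<^sup>2 * (grid s v n (Suc k) - grid s v n k))"

text \<open>On each cell the summand is the increment of \<open>1 / (S - r)\<close> times a factor
  between \<open>1 - h / (S - v)\<close> and 1, with h the mesh; these increments telescope.\<close>

lemma grid_quadratic_bounds:
  assumes "s \<le> v" "v < S"
  shows "grid_quadratic S s v n \<le> 1 / (S - v) - 1 / (S - s)"
    and "(1 - (v - s) / real (Suc n) * (1 / (S - v))) * (1 / (S - v) - 1 / (S - s)) \<le> grid_quadratic S s v n"
proof -
  define g h where "g = grid s v n" and "h = (v - s) / real (Suc n)"
  have h: "0 \<le> h" "g (Suc k) = g k + h" for k using assms by (simp_all add: h_def g_def grid_step)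
  have telescope: "1 / (S - v) - 1 / (S - s) = (\<Sum>k<Suc n. 1 / (S - g (Suc k)) - 1 / (S - g k))"
    by (subst sum_lessThan_telescope) (simp add: g_def)
  have term_eq: "(1 / (S - g k))\<^sup>2 * h = (1 - h * (1 / (S - g k))) * (1 / (S - g (Suc k)) - 1 / (S - g k))"
    and increment_nonneg: "0 \<le> 1 / (S - g (Suc k)) - 1 / (S - g k)"
    and weight: "0 \<le> h * (1 / (S - g k))" "h * (1 / (S - g k)) \<le> h * (1 / (S - v))" if "k < Suc n" for k
  proof -
    have k: "g k < S" "g k + h < S" "g k \<le> v"
      using grid_bounds[of s v k n] grid_bounds[of s v "Suc k" n] that assms h(2)[of k] by (auto simp: g_def)
    then show "(1 / (S - g k))\<^sup>2 * h = (1 - h * (1 / (S - g k))) * (1 / (S - g (Suc k)) - 1 / (S - g k))"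
      unfolding h(2) by (simp add: divide_simps power2_eq_square)
    show "0 \<le> 1 / (S - g (Suc k)) - 1 / (S - g k)"
      unfolding h(2) using k h(1) by (simp add: frac_le)
    show "0 \<le> h * (1 / (S - g k))" "h * (1 / (S - g k)) \<le> h * (1 / (S - v))"
      using k h(1) assms by (auto intro!: mult_left_mono frac_le)
  qed
  have eq: "grid_quadratic S s v n = (\<Sum>k<Suc n. (1 - h * (1 / (S - g k))) * (1 / (S - g (Suc k)) - 1 / (S - g k)))"
    unfolding grid_quadratic_def by (intro sum.cong refl) (use h(2) term_eq in \<open>simp add: g_def[symmetric]\<close>)
  show "grid_quadratic S s v n \<le> 1 / (S - v) - 1 / (S - s)"
    unfolding eq telescope
  proof (rule sum_mono)
    fix k assume "k \<in> {..<Suc n}"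
    then have "(1 - h * (1 / (S - g k))) * (1 / (S - g (Suc k)) - 1 / (S - g k))
        \<le> 1 * (1 / (S - g (Suc k)) - 1 / (S - g k))"
      by (intro mult_right_mono increment_nonneg) (use weight(1)[of k] in auto)
    then show "(1 - h * (1 / (S - g k))) * (1 / (S - g (Suc k)) - 1 / (S - g k))
        \<le> 1 / (S - g (Suc k)) - 1 / (S - g k)" by simp
  qed
  show "(1 - (v - s) / real (Suc n) * (1 / (S - v))) * (1 / (S - v) - 1 / (S - s)) \<le> grid_quadratic S s v n"
    unfolding eq telescope sum_distrib_left h_def[symmetric]
    by (intro sum_mono mult_right_mono) (use increment_nonneg weight in auto)
qed

lemma grid_quadratic_limit:
  assumes "s \<le> v" "v < S"
  shows "grid_quadratic S s v \<longlonglongrightarrow> 1 / (S - v) - 1 / (S - s)"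
proof (rule tendsto_sandwich)
  have "(\<lambda>n. (1 - (v - s) * inverse (real (Suc n)) * (1 / (S - v))) * (1 / (S - v) - 1 / (S - s)))
      \<longlonglongrightarrow> (1 - (v - s) * 0 * (1 / (S - v))) * (1 / (S - v) - 1 / (S - s))"
    by (intro tendsto_intros LIMSEQ_inverse_real_of_nat)
  then show "(\<lambda>n. (1 - (v - s) / real (Suc n) * (1 / (S - v))) * (1 / (S - v) - 1 / (S - s)))
      \<longlonglongrightarrow> 1 / (S - v) - 1 / (S - s)"
    by (simp add: divide_inverse)
qed (use grid_quadratic_bounds[OF assms] in auto)

text \<open>The equation says \<open>d\<beta> = dX + X / (S - r) dr\<close>, so with \<open>Z = X / (S - r)\<close> each summand is the
  increment of Z plus the integral of \<open>Z - Z (grid s v n (Suc k))\<close> over the grid cell divided by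
  \<open>S - grid s v n k\<close>.\<close>

lemma bridge_Riemann_sums:
  fixes X \<beta> :: "real \<Rightarrow> real"
  assumes cont: "continuous_on {0..v} X" and sv: "0 \<le> s" "s \<le> v" "v < S"
    and X: "\<And>u. u \<in> {0..v} \<Longrightarrow> X u = x - integral {0..u} (\<lambda>r. X r / (S - r)) + \<beta> u"
  shows "(\<lambda>n. \<Sum>k<Suc n. (1 / (S - grid s v n k)) * (\<beta> (grid s v n (Suc k)) - \<beta> (grid s v n k)))
    \<longlonglongrightarrow> X v / (S - v) - X s / (S - s)"
proof -
  define Z where "Z r = X r / (S - r)" for r
  have Z_cont: "continuous_on {0..v} Z"
    unfolding Z_def using sv by (intro continuous_intros cont) auto
  then have "uniformly_continuous_on {0..v} Z"
    by (rule compact_uniformly_continuous) auto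
  note uc = this[unfolded uniformly_continuous_on_def]
  have summand: "(1 / (S - a)) * (\<beta> b - \<beta> a) = Z b - Z a + (1 / (S - a)) * integral {a..b} (\<lambda>r. Z r - Z b)"
    if ab: "0 \<le> a" "a \<le> b" "b \<le> v" for a b
  proof -
    have int: "Z integrable_on {c..d}" if "0 \<le> c" "d \<le> v" for c d
      using that by (intro integrable_continuous_real continuous_on_subset[OF Z_cont]) auto
    have "integral {0..a} Z + integral {a..b} Z = integral {0..b} Z"
      using ab by (intro Henstock_Kurzweil_Integration.integral_combine int) auto
    moreover have "integral {a..b} (\<lambda>r. Z r - Z b) = integral {a..b} Z - (b - a) * Z b"
      using ab int[of a b] by (subst Henstock_Kurzweil_Integration.integral_diff) auto
    moreover have "X a = x - integral {0..a} Z + \<beta> a" "X b = x - integral {0..b} Z + \<beta> b"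
      using X[of a] X[of b] ab by (simp_all add: Z_def[abs_def])
    moreover have "X a = (S - a) * Z a" "X b = (S - b) * Z b"
      using ab sv by (simp_all add: Z_def)
    ultimately have "\<beta> b - \<beta> a = (S - a) * (Z b - Z a) + integral {a..b} (\<lambda>r. Z r - Z b)"
      by (simp add: algebra_simps)
    then show ?thesis using ab sv by (simp add: distrib_left)
  qed
  define err where "err n = (\<Sum>k<Suc n. (1 / (S - grid s v n k)) *
    integral {grid s v n k..grid s v n (Suc k)} (\<lambda>r. Z r - Z (grid s v n (Suc k))))" for n
  have cell: "0 \<le> grid s v n k" "grid s v n k \<le> grid s v n (Suc k)" "grid s v n (Suc k) \<le> v" if "k < Suc n" for n k
    using grid_bounds[of s v k n] grid_bounds[of s v "Suc k" n] monoD[OF mono_grid, of s v k "Suc k" n] that sv by auto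
  have sum_eq: "(\<Sum>k<Suc n. (1 / (S - grid s v n k)) * (\<beta> (grid s v n (Suc k)) - \<beta> (grid s v n k)))
      = (Z v - Z s) + err n" for n
  proof -
    have "(\<Sum>k<Suc n. (1 / (S - grid s v n k)) * (\<beta> (grid s v n (Suc k)) - \<beta> (grid s v n k)))
      = (\<Sum>k<Suc n. Z (grid s v n (Suc k)) - Z (grid s v n k)) + err n"
      unfolding err_def sum.distrib[symmetric] by (intro sum.cong refl summand cell) auto
    then show ?thesis by (subst (asm) sum_lessThan_telescope) simp
  qed
  have "err \<longlonglongrightarrow> 0"
  proof (rule LIMSEQ_I)
    fix e :: real assume e: "0 < e"
    \<comment> \<open>Scaled so that the accumulated error is
      \<open>e * ((v - s) / (v - s + 1))\<close>; the added 1 avoids division by 0 for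
      \<open>v = s\<close> and makes the final inequality strict.\<close>
    define e' where "e' = e * (S - v) / (v - s + 1)"
    have e': "0 < e'" using e sv by (simp add: e'_def)
    obtain d where d: "0 < d" "\<And>r r'. r \<in> {0..v} \<Longrightarrow> r' \<in> {0..v} \<Longrightarrow> dist r' r < d \<Longrightarrow> dist (Z r') (Z r) < e'"
      using uc e' by blast
    obtain m :: nat where m: "(v - s) / d < real m" using reals_Archimedean2 by blast
    have "norm (err n - 0) < e" if n: "m \<le> n" for n
    proof -
      define h where "h = (v - s) / real (Suc n)"
      have "(v - s) / d < real (Suc n)" using m n by linarith
      then have h: "0 \<le> h" "h < d" using d(1) sv by (auto simp: h_def field_simps)
      have "norm (err n) \<le> (\<Sum>k<Suc n. (1 / (S - v)) * (e' * h))"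
        unfolding err_def
      proof (rule sum_norm_le)
        fix k assume "k \<in> {..<Suc n}"
        then have k: "k < Suc n" by simp
        note c = cell[OF k]
        have "norm (integral {grid s v n k..grid s v n (Suc k)} (\<lambda>r. Z r - Z (grid s v n (Suc k))))
            \<le> e' * (grid s v n (Suc k) - grid s v n k)"
        proof (rule integral_bound[OF c(2)])
          show "continuous_on {grid s v n k..grid s v n (Suc k)} (\<lambda>r. Z r - Z (grid s v n (Suc k)))"
            using c by (intro continuous_intros continuous_on_subset[OF Z_cont]) auto
          fix r assume r: "r \<in> {grid s v n k..grid s v n (Suc k)}"
          have "dist r (grid s v n (Suc k)) < d"
            using r h grid_step[of s v n k] unfolding h_def by (auto simp: dist_real_def simp del: of_nat_Suc)
          then show "norm (Z r - Z (grid s v n (Suc k))) \<le> e'"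
            using d(2)[of "grid s v n (Suc k)" r] r c by (auto simp: dist_real_def)
        qed
        moreover have "grid s v n (Suc k) - grid s v n k = h" by (simp add: grid_step h_def)
        moreover have "\<bar>1 / (S - grid s v n k)\<bar> \<le> 1 / (S - v)" using c sv by (simp add: frac_le)
        ultimately show "norm (1 / (S - grid s v n k) * integral {grid s v n k..grid s v n (Suc k)}
            (\<lambda>r. Z r - Z (grid s v n (Suc k)))) \<le> (1 / (S - v)) * (e' * h)"
          unfolding norm_mult using h sv by (intro mult_mono) auto
      qed
      also have "\<dots> = (e' / (S - v)) * (v - s)" by (simp add: h_def del: of_nat_Suc)
      also have "\<dots> = e * ((v - s) / (v - s + 1))" using sv by (simp add: e'_def)
      also have "\<dots> < e" using e sv by (simp add: field_simps)
      finally show ?thesis by simp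
    qed
    then show "\<exists>m. \<forall>n\<ge>m. norm (err n - 0) < e" by blast
  qed
  then have "(\<lambda>n. (Z v - Z s) + err n) \<longlonglongrightarrow> (Z v - Z s) + 0" by (intro tendsto_intros)
  then show ?thesis unfolding sum_eq by (simp add: Z_def)
qed

text \<open>Because X is tied to B by an equation that holds almost everywhere, observed events are
  not literally events of the Brownian past. Agreement with an event of G up to a null set is stable
  under complements and countable unions, so it passes from the generating events to the generated
  \<sigma>-algebra.\<close>

lemma generated_algebra_AE_eq:
  assumes G: "space G = space N"
    and Y: "\<And>r. r \<in> I \<Longrightarrow> Y' r \<in> borel_measurable G" "\<And>r. r \<in> I \<Longrightarrow> AE w in N. Y r w = (Y' r w :: real)"
    and A: "A \<in> sets (generated_algebra N Y I)"
  shows "\<exists>A'\<in>sets G. AE w in N. w \<in> A \<longleftrightarrow> w \<in> A'"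
  using A unfolding sets_generated_algebra
proof (induction rule: sigma_sets.induct)
  case (Basic a)
  then obtain r C where r: "r \<in> I" "C \<in> sets borel" "a = Y r -` C \<inter> space N" by blast
  show ?case
  proof (intro bexI)
    show "Y' r -` C \<inter> space G \<in> sets G" using Y(1) r by (rule_tac measurable_sets) auto
    show "AE w in N. w \<in> a \<longleftrightarrow> w \<in> Y' r -` C \<inter> space G"
      using Y(2)[OF r(1)] by eventually_elim (simp add: r G)
  qed
next
  case Empty
  then show ?case by (intro bexI[of _ "{}"]) auto
next
  case (Compl a)
  then obtain a' where a': "a' \<in> sets G" "AE w in N. w \<in> a \<longleftrightarrow> w \<in> a'" by blast
  show ?case
  proof (intro bexI)
    show "space G - a' \<in> sets G" using a' by auto
    show "AE w in N. w \<in> space N - a \<longleftrightarrow> w \<in> space G - a'"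
      using a'(2) by eventually_elim (simp add: G)
  qed
next
  case (Union a)
  then obtain a' where a': "\<And>i :: nat. a' i \<in> sets G" "\<And>i. AE w in N. w \<in> a i \<longleftrightarrow> w \<in> a' i" by metis
  show ?case
  proof (intro bexI)
    show "(\<Union>i. a' i) \<in> sets G" using a' by auto
    have "AE w in N. \<forall>i. w \<in> a i \<longleftrightarrow> w \<in> a' i" using a'(2) by (simp add: AE_all_countable)
    then show "AE w in N. w \<in> (\<Union>i. a i) \<longleftrightarrow> w \<in> (\<Union>i. a' i)" by eventually_elim simp
  qed
qed


text \<open>What remains of Brownian motion after restriction to a value of \<theta>: exponentials
  of increments factor off the past. The total mass of the measure is arbitrary.\<close>

locale brownian_increments = finite_measure N for N :: "'w measure" +
  fixes B :: "real \<Rightarrow> 'w \<Rightarrow> real"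
  assumes measurable_B: "\<And>s. 0 \<le> s \<Longrightarrow> B s \<in> borel_measurable N"
    and nn_integral_exp_B: "\<And>u v f c. 0 \<le> u \<Longrightarrow> u \<le> v \<Longrightarrow> f \<in> borel_measurable (generated_algebra N B {0..u}) \<Longrightarrow>
      (\<integral>\<^sup>+w. f w * ennreal (exp (c * (B v w - B u w))) \<partial>N) = ennreal (exp (c\<^sup>2 * (v - u) / 2)) * (\<integral>\<^sup>+w. f w \<partial>N)"
begin

abbreviation past :: "real \<Rightarrow> 'w measure" where
  "past u \<equiv> generated_algebra N B {0..u}"

lemma subalgebra_past: "subalgebra N (past u)"
  unfolding subalgebra_def using sets_generated_algebra_subset[of "{0..u}" B N] measurable_B by auto

lemma past_mono: "u \<le> v \<Longrightarrow> f \<in> borel_measurable (past u) \<Longrightarrow> f \<in> borel_measurable (past v)"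
  using sets_generated_algebra_mono[of "{0..u}" "{0..v}" N B]
  by (rule_tac measurable_from_subalg[of _ "past u"]) (auto simp: subalgebra_def)

lemma measurable_B_past: "0 \<le> s \<Longrightarrow> s \<le> u \<Longrightarrow> B s \<in> borel_measurable (past u)"
  by (rule measurable_generated_algebra) auto

text \<open>By induction on n: all increments but the last are functions of the past of
  \<open>u n\<close>, so the last one integrates out as a factor.\<close>

lemma nn_integral_exp_weighted_sum:
  fixes f :: "'w \<Rightarrow> ennreal"
  assumes u: "mono u" "0 \<le> u 0" and f: "f \<in> borel_measurable (past (u 0))"
  shows "(\<integral>\<^sup>+w. f w * ennreal (exp (l * (\<Sum>k<n. c k * (B (u (Suc k)) w - B (u k) w)))) \<partial>N)
    = ennreal (exp (l\<^sup>2 * (\<Sum>k<n. (c k)\<^sup>2 * (u (Suc k) - u k)) / 2)) * (\<integral>\<^sup>+w. f w \<partial>N)"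
proof (induction n)
  case 0
  then show ?case by simp
next
  case (Suc n)
  define g where "g w = f w * ennreal (exp (l * (\<Sum>k<n. c k * (B (u (Suc k)) w - B (u k) w))))" for w
  have u_nonneg: "0 \<le> u k" for k using u monoD[OF u(1), of 0 k] by simp
  have [measurable]: "f \<in> borel_measurable (past (u n))"
    by (rule past_mono[OF _ f]) (use u in \<open>simp add: monoD\<close>)
  have "(\<lambda>w. \<Sum>k<n. c k * (B (u (Suc k)) w - B (u k) w)) \<in> borel_measurable (past (u n))"
    using u_nonneg monoD[OF u(1)]
    by (intro borel_measurable_sum borel_measurable_times borel_measurable_diff measurable_B_past) auto
  then have g: "g \<in> borel_measurable (past (u n))" unfolding g_def by measurable
  have "(\<integral>\<^sup>+w. f w * ennreal (exp (l * (\<Sum>k<Suc n. c k * (B (u (Suc k)) w - B (u k) w)))) \<partial>N)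
      = (\<integral>\<^sup>+w. g w * ennreal (exp ((l * c n) * (B (u (Suc n)) w - B (u n) w))) \<partial>N)"
    unfolding g_def by (simp add: distrib_left exp_add ennreal_mult' mult.assoc)
  also have "\<dots> = ennreal (exp ((l * c n)\<^sup>2 * (u (Suc n) - u n) / 2)) * (\<integral>\<^sup>+w. g w \<partial>N)"
    using u_nonneg u by (intro nn_integral_exp_B g) (auto simp: monoD)
  also have "\<dots> = ennreal (exp (l\<^sup>2 * (\<Sum>k<Suc n. (c k)\<^sup>2 * (u (Suc k) - u k)) / 2)) * (\<integral>\<^sup>+w. f w \<partial>N)"
  proof -
    have "exp (l\<^sup>2 * (\<Sum>k<Suc n. (c k)\<^sup>2 * (u (Suc k) - u k)) / 2)
        = exp ((l * c n)\<^sup>2 * (u (Suc n) - u n) / 2) * exp (l\<^sup>2 * (\<Sum>k<n. (c k)\<^sup>2 * (u (Suc k) - u k)) / 2)"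
      by (simp add: distrib_left add_divide_distrib power_mult_distrib mult.assoc flip: exp_add)
    then show ?thesis unfolding g_def Suc by (simp add: ennreal_mult' mult.assoc)
  qed
  finally show ?case .
qed

end

lemma space_natural_filtration [simp]: "space (natural_filtration M Y s) = space M"
  by (simp add: natural_filtration_def)

context brownian_increments
begin

text \<open>For the weighted sums the identity is exact, with \<open>grid_quadratic\<close> in the
  exponent. The limit under the integral rests on bounded second moments: the square of the
  exponential is again an exponential, with \<open>2 * l\<close>, and the square of f is integrable
  by assumption.\<close>

lemma nn_integral_exp_Riemann_limit:
  fixes f L :: "'w \<Rightarrow> real"
  assumes s: "0 \<le> t" "0 \<le> s" "s \<le> v" "v < S"
    and f: "f \<in> borel_measurable (past (t + s))" "\<And>w. 0 \<le> f w" "(\<integral>\<^sup>+w. ennreal ((f w)\<^sup>2) \<partial>N) < \<infinity>"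
    and [measurable]: "L \<in> borel_measurable N"
    and lim: "AE w in N. (\<lambda>n. \<Sum>k<Suc n. (1 / (S - grid s v n k)) *
      (B (t + grid s v n (Suc k)) w - B (t + grid s v n k) w)) \<longlonglongrightarrow> L w"
  shows "(\<integral>\<^sup>+w. ennreal (f w * exp (l * L w)) \<partial>N)
    = ennreal (exp (l\<^sup>2 * (1 / (S - v) - 1 / (S - s)) / 2)) * (\<integral>\<^sup>+w. ennreal (f w) \<partial>N)"
proof -
  define R where "R n w = (\<Sum>k<Suc n. (1 / (S - grid s v n k)) *
      (B (t + grid s v n (Suc k)) w - B (t + grid s v n k) w))" for n w
  have f_N [measurable]: "f \<in> borel_measurable N"
    by (rule measurable_from_subalg[OF subalgebra_past f(1)])
  have R_N [measurable]: "R n \<in> borel_measurable N" for n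
  proof -
    have "B (t + grid s v n k) \<in> borel_measurable N" if "k \<le> Suc n" for k
      using grid_bounds[OF s(3) that] s by (intro measurable_B) auto
    then show ?thesis
      unfolding R_def by (intro borel_measurable_sum borel_measurable_times borel_measurable_diff) auto
  qed
  have exp_R: "(\<integral>\<^sup>+w. g w * ennreal (exp (b * R n w)) \<partial>N)
      = ennreal (exp (b\<^sup>2 * grid_quadratic S s v n / 2)) * (\<integral>\<^sup>+w. g w \<partial>N)"
    if "g \<in> borel_measurable (past (t + s))" for g :: "'w \<Rightarrow> ennreal" and b n
  proof -
    have "mono (\<lambda>k. t + grid s v n k)"
      using mono_grid[OF s(3)] by (auto simp: mono_def)
    from nn_integral_exp_weighted_sum[OF this, of g b "\<lambda>k. 1 / (S - grid s v n k)" "Suc n"] that s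
    show ?thesis by (simp add: R_def grid_quadratic_def)
  qed
  obtain C where C: "0 \<le> C" "(\<integral>\<^sup>+w. ennreal ((f w)\<^sup>2) \<partial>N) = ennreal C"
    using f(3) by (cases "\<integral>\<^sup>+w. ennreal ((f w)\<^sup>2) \<partial>N" rule: ennreal_cases) auto
  have "(\<lambda>n. \<integral>\<^sup>+w. ennreal (f w * exp (l * R n w)) \<partial>N) \<longlonglongrightarrow> (\<integral>\<^sup>+w. ennreal (f w * exp (l * L w)) \<partial>N)"
  proof (rule L2_bounded_limit_nn_integral)
    show "AE w in N. (\<lambda>n. f w * exp (l * R n w)) \<longlonglongrightarrow> f w * exp (l * L w)"
      using lim unfolding R_def by eventually_elim (intro tendsto_intros)
    show "0 \<le> exp (2 * l\<^sup>2 * (1 / (S - v) - 1 / (S - s))) * C" using C by simp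
    fix n
    have "(f w * exp (l * R n w))\<^sup>2 = (f w)\<^sup>2 * exp ((2 * l) * R n w)" for w
      by (simp add: power_mult_distrib power2_eq_square[of "exp _"] flip: exp_add)
    then have "(\<integral>\<^sup>+w. ennreal ((f w * exp (l * R n w))\<^sup>2) \<partial>N)
        = (\<integral>\<^sup>+w. ennreal ((f w)\<^sup>2) * ennreal (exp ((2 * l) * R n w)) \<partial>N)"
      by (simp add: ennreal_mult')
    also have "\<dots> = ennreal (exp ((2 * l)\<^sup>2 * grid_quadratic S s v n / 2)) * ennreal C"
      using f(1) by (subst exp_R) (simp_all add: C)
    also have "\<dots> \<le> ennreal (exp (2 * l\<^sup>2 * (1 / (S - v) - 1 / (S - s)))) * ennreal C"
      using grid_quadratic_bounds(1)[OF s(3,4), of n]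
      by (intro mult_right_mono ennreal_leI) (auto simp: power_mult_distrib mult_left_mono mult.commute[of _ "l\<^sup>2"])
    finally show "(\<integral>\<^sup>+w. ennreal ((f w * exp (l * R n w))\<^sup>2) \<partial>N)
        \<le> ennreal (exp (2 * l\<^sup>2 * (1 / (S - v) - 1 / (S - s))) * C)"
      using C by (simp add: ennreal_mult')
  qed (use f(2) in auto)
  moreover have "(\<lambda>n. \<integral>\<^sup>+w. ennreal (f w * exp (l * R n w)) \<partial>N)
      \<longlonglongrightarrow> ennreal (exp (l\<^sup>2 * (1 / (S - v) - 1 / (S - s)) / 2)) * (\<integral>\<^sup>+w. ennreal (f w) \<partial>N)"
  proof -
    have "(\<lambda>n. ennreal (exp (l\<^sup>2 * grid_quadratic S s v n / 2)) * (\<integral>\<^sup>+w. ennreal (f w) \<partial>N))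
      \<longlonglongrightarrow> ennreal (exp (l\<^sup>2 * (1 / (S - v) - 1 / (S - s)) / 2)) * (\<integral>\<^sup>+w. ennreal (f w) \<partial>N)"
      by (intro tendsto_mult_ennreal tendsto_ennrealI tendsto_intros grid_quadratic_limit s) auto
    then show ?thesis using f(1,2) by (simp add: ennreal_mult' exp_R)
  qed
  ultimately show ?thesis by (rule LIMSEQ_unique)
qed

end

section \<open>The observed process as a functional of the Brownian past\<close>

locale observed_process = brownian_increments N B for N :: "'w measure" and B +
  fixes t x :: real and X :: "real \<Rightarrow> 'w \<Rightarrow> real"
  assumes t: "0 \<le> t" "t < 1"
    and measurable_X: "\<And>u. u \<in> {t..1} \<Longrightarrow> X u \<in> borel_measurable N"
    and continuous_X: "\<And>w. w \<in> space N \<Longrightarrow> continuous_on {t..1} (\<lambda>u. X u w)"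
begin

text \<open>Truncation at T, because nothing is known about \<open>X u\<close> for \<open>u > 1\<close>.\<close>

abbreviation observed_until :: "real \<Rightarrow> real \<Rightarrow> 'w measure" where
  "observed_until T s \<equiv> natural_filtration N (\<lambda>s. X (t + s)) (min s T)"

lemma continuous_X_shifted: "w \<in> space N \<Longrightarrow> continuous_on {0..1 - t} (\<lambda>s. X (t + s) w)"
  by (rule continuous_on_compose2[OF continuous_X]) (auto intro!: continuous_intros)

lemma sets_observed_until: "T \<le> 1 - t \<Longrightarrow> sets (observed_until T s) \<subseteq> sets N"
  unfolding natural_filtration_def by (rule sets_generated_algebra_subset) (auto intro!: measurable_X)

lemma observed_until_mono: "s \<le> u \<Longrightarrow> sets (observed_until T s) \<subseteq> sets (observed_until T u)"
  unfolding natural_filtration_def by (rule sets_generated_algebra_mono) auto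

lemma exponential_martingale_free:
  assumes path: "AE w in N. continuous_on {0..} (\<lambda>s. B s w)"
    and eq: "AE w in N. \<forall>s\<in>{0..<1 - t}. X (t + s) w = x + (B (t + s) w - B t w)"
  shows "exponential_martingale N (observed_until (1 - t)) (\<lambda>s. X (t + s)) (\<lambda>s. s) (1 - t) x"
proof
  show "AE w in N. X (t + 0) w = x"
    using eq by eventually_elim (use t in force)
  fix s A l assume s: "s \<in> {0..<1 - t}" and A: "A \<in> sets (observed_until (1 - t) s)"
  \<comment> \<open>A version of X built from B alone, hence measurable in the Brownian past;
    through it observed events are exchanged for events of that past.\<close>
  define Y where "Y r w = x + (B (t + r) w - B t w)" for r w
  have Y: "Y r \<in> borel_measurable (past (t + s))" if "r \<in> {0..s}" for r
    unfolding Y_def using that t by (intro borel_measurable_add borel_measurable_diff measurable_B_past) auto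
  have "\<exists>A'\<in>sets (past (t + s)). AE w in N. w \<in> A \<longleftrightarrow> w \<in> A'"
  proof (rule generated_algebra_AE_eq[of _ _ "{0..s}" Y])
    show "AE w in N. X (t + r) w = Y r w" if "r \<in> {0..s}" for r
      using eq by eventually_elim (use s that in \<open>auto simp: Y_def\<close>)
    show "A \<in> sets (generated_algebra N (\<lambda>s. X (t + s)) {0..s})"
      using A s by (simp add: natural_filtration_def)
  qed (auto intro: Y)
  then obtain A' where A': "A' \<in> sets (past (t + s))" "AE w in N. w \<in> A \<longleftrightarrow> w \<in> A'" by blast
  define f where "f w = indicator A' w * ennreal (exp (l * Y s w))" for w
  have [measurable]: "Y s \<in> borel_measurable (past (t + s))" using s by (intro Y) auto
  have f: "f \<in> borel_measurable (past (t + s))"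
    unfolding f_def using A'(1) by measurable
  have "AE w in N. X (t + (1 - t)) w = Y s w + (B (t + (1 - t)) w - B (t + s) w) \<and> X (t + s) w = Y s w"
    using eq path AE_space
  proof eventually_elim
    case (elim w)
    \<comment> \<open>The equation is given only before \<open>1 - t\<close>. At
      \<open>1 - t\<close> itself it follows from continuity of the paths of X and B along these
      times.\<close>
    define u where "u n = (1 - t) * (1 - 1 / real (Suc n))" for n
    have u: "u n \<in> {0..<1 - t}" for n using t by (simp add: u_def)
    have "u \<longlonglongrightarrow> (1 - t) * (1 - 0)"
      unfolding u_def using LIMSEQ_inverse_real_of_nat by (intro tendsto_intros) (simp add: divide_inverse)
    then have u_lim: "u \<longlonglongrightarrow> 1 - t" by simp
    have "(\<lambda>n. X (t + u n) w) \<longlonglongrightarrow> X (t + (1 - t)) w"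
      using t u less_imp_le
      by (intro continuous_on_tendsto_compose[OF continuous_X_shifted[OF elim(3)] u_lim]) (auto intro!: always_eventually)
    moreover have "(\<lambda>n. B (t + u n) w) \<longlonglongrightarrow> B (t + (1 - t)) w"
    proof (rule continuous_on_tendsto_compose[OF elim(2)])
      show "(\<lambda>n. t + u n) \<longlonglongrightarrow> t + (1 - t)" by (intro tendsto_intros u_lim)
    qed (use t u in \<open>auto intro!: always_eventually\<close>)
    then have "(\<lambda>n. Y (u n) w) \<longlonglongrightarrow> Y (1 - t) w"
      unfolding Y_def by (intro tendsto_intros)
    moreover have "X (t + u n) w = Y (u n) w" for n using elim(1) u[of n] by (simp add: Y_def)
    ultimately have "X (t + (1 - t)) w = Y (1 - t) w" by (simp add: LIMSEQ_unique)
    then show ?case using elim(1) s by (auto simp: Y_def)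
  qed
  then have "AE w in N. indicator A w * ennreal (exp (l * X (t + (1 - t)) w))
      = f w * ennreal (exp (l * (B (t + (1 - t)) w - B (t + s) w)))"
    and eq_s: "AE w in N. indicator A w * ennreal (exp (l * X (t + s) w)) = f w"
    using A'(2) by (eventually_elim; simp add: f_def distrib_left exp_add ennreal_mult' mult.assoc indicator_def)+
  then have "(\<integral>\<^sup>+w. indicator A w * ennreal (exp (l * X (t + (1 - t)) w)) \<partial>N)
      = (\<integral>\<^sup>+w. f w * ennreal (exp (l * (B (t + (1 - t)) w - B (t + s) w))) \<partial>N)"
    by (intro nn_integral_cong_AE)
  also have "\<dots> = ennreal (exp (l\<^sup>2 * ((t + (1 - t)) - (t + s)) / 2)) * (\<integral>\<^sup>+w. f w \<partial>N)"
    using s t by (intro nn_integral_exp_B f) auto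
  also have "(\<integral>\<^sup>+w. f w \<partial>N) = (\<integral>\<^sup>+w. indicator A w * ennreal (exp (l * X (t + s) w)) \<partial>N)"
    by (rule nn_integral_cong_AE[OF eq_s, symmetric])
  finally show "(\<integral>\<^sup>+w. indicator A w * ennreal (exp (l * X (t + (1 - t)) w)) \<partial>N)
      = ennreal (exp (l\<^sup>2 * (1 - t - s) / 2)) * (\<integral>\<^sup>+w. indicator A w * ennreal (exp (l * X (t + s) w)) \<partial>N)"
    by (simp add: algebra_simps)
qed (use t in \<open>auto intro!: measurable_X continuous_X_shifted continuous_intros
  dest: subsetD[OF sets_observed_until[OF order_refl]] subsetD[OF observed_until_mono]\<close>)

text \<open>The variance of an increment of Z is the increment of the clock
  \<open>1 / (1 - t - s)\<close>, which is unbounded near maturity; hence the strict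
  \<open>T < 1 - t\<close>.\<close>

lemma exponential_martingale_bridge:
  assumes T: "0 < T" "T < 1 - t"
    and eq: "AE w in N. \<forall>s\<in>{0..<1 - t}. X (t + s) w =
      x - integral {0..s} (\<lambda>r. X (t + r) w / (1 - t - r)) + (B (t + s) w - B t w)"
  shows "exponential_martingale N (observed_until T) (\<lambda>s w. X (t + s) w / (1 - t - s)) (\<lambda>s. 1 / (1 - t - s))
    T (x / (1 - t))"
proof
  define Z where "Z s w = X (t + s) w / (1 - t - s)" for s w
  have Z_meas [measurable]: "Z s \<in> borel_measurable N" if "s \<in> {0..T}" for s
    unfolding Z_def using that T by (intro borel_measurable_divide measurable_X) auto
  show Z_0: "AE w in N. X (t + 0) w / (1 - t - 0) = x / (1 - t)"
    using eq by eventually_elim (use t in force)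
  define R where "R s v n w = (\<Sum>k<Suc n. (1 / (1 - t - grid s v n k)) *
      (B (t + grid s v n (Suc k)) w - B (t + grid s v n k) w))" for s v n w
  have R_lim: "AE w in N. (\<lambda>n. R s v n w) \<longlonglongrightarrow> Z v w - Z s w" if sv: "0 \<le> s" "s \<le> v" "v \<le> T" for s v
    using eq AE_space
  proof eventually_elim
    case (elim w)
    have "(\<lambda>n. \<Sum>k<Suc n. (1 / (1 - t - grid s v n k)) *
        ((B (t + grid s v n (Suc k)) w - B t w) - (B (t + grid s v n k) w - B t w)))
      \<longlonglongrightarrow> X (t + v) w / (1 - t - v) - X (t + s) w / (1 - t - s)"
    proof (rule bridge_Riemann_sums[where X = "\<lambda>s. X (t + s) w" and \<beta> = "\<lambda>s. B (t + s) w - B t w"])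
      show "continuous_on {0..v} (\<lambda>s. X (t + s) w)"
        using sv T by (intro continuous_on_subset[OF continuous_X_shifted[OF elim(2)]]) auto
    qed (use elim(1) sv T in auto)
    then show ?case by (simp add: R_def Z_def)
  qed
  \<comment> \<open>\<open>lim\<close> is total, so this version of Z is defined everywhere and
    measurable in the Brownian past, whatever the sums do on the exceptional null set.\<close>
  define Y where "Y r w = x / (1 - t) + lim (\<lambda>n. R 0 r n w)" for r w
  have Y: "Y r \<in> borel_measurable (past (t + s))" if r: "r \<in> {0..s}" for r s
  proof -
    have "R 0 r n \<in> borel_measurable (past (t + s))" for n
    proof -
      have "B (t + grid 0 r n k) \<in> borel_measurable (past (t + s))" if "k \<le> Suc n" for k
        using grid_bounds[of 0 r k n] that r t by (intro measurable_B_past) auto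
      then show ?thesis
        unfolding R_def by (intro borel_measurable_sum borel_measurable_times borel_measurable_diff) auto
    qed
    then have "(\<lambda>w. lim (\<lambda>n. R 0 r n w)) \<in> borel_measurable (past (t + s))" by measurable
    then show ?thesis unfolding Y_def by measurable
  qed
  have Y_eq: "AE w in N. Z r w = Y r w" if "0 \<le> r" "r \<le> T" for r
    using R_lim[OF order_refl that] Z_0 by eventually_elim (auto simp: Y_def limI Z_def)
  fix s A l assume s: "s \<in> {0..<T}" and A: "A \<in> sets (observed_until T s)"
  have "\<exists>A'\<in>sets (past (t + s)). AE w in N. w \<in> A \<longleftrightarrow> w \<in> A'"
  \<comment> \<open>The factor \<open>1 - t - r\<close> undoes the scaling, since the filtration is
    generated by X and not by Z.\<close>
  proof (rule generated_algebra_AE_eq[of _ _ "{0..s}" "\<lambda>r w. (1 - t - r) * Y r w"])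
    show "AE w in N. X (t + r) w = (1 - t - r) * Y r w" if r: "r \<in> {0..s}" for r
    proof -
      have "AE w in N. Z r w = Y r w" using r s by (intro Y_eq) auto
      then show ?thesis by eventually_elim (use r s T in \<open>auto simp: Z_def field_simps\<close>)
    qed
    show "A \<in> sets (generated_algebra N (\<lambda>s. X (t + s)) {0..s})"
      using A s by (simp add: natural_filtration_def)
  qed (use Y in \<open>auto intro!: borel_measurable_times\<close>)
  then obtain A' where A': "A' \<in> sets (past (t + s))" "AE w in N. w \<in> A \<longleftrightarrow> w \<in> A'" by blast
  have Y_s [measurable]: "Y s \<in> borel_measurable (past (t + s))" using s by (intro Y) auto
  define f where "f w = indicat_real A' w * exp (l * Y s w)" for w
  have f: "f \<in> borel_measurable (past (t + s))"
    unfolding f_def using A'(1) by measurable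
  have f_nonneg: "0 \<le> f w" for w by (simp add: f_def)
  \<comment> \<open>The limit lemma asks for a square integrable f. This comes from the same lemma,
    applied to the constant function 1 with \<open>2 * l\<close> on the interval from 0 to
    s.\<close>
  have f_sq: "(\<integral>\<^sup>+w. ennreal ((f w)\<^sup>2) \<partial>N) < \<infinity>"
  proof -
    have [measurable]: "Z s \<in> borel_measurable N" "Z 0 \<in> borel_measurable N" using s T by (auto intro: Z_meas)
    have "(\<integral>\<^sup>+w. ennreal (1 * exp ((2 * l) * (Z s w - Z 0 w))) \<partial>N)
        = ennreal (exp ((2 * l)\<^sup>2 * (1 / (1 - t - s) - 1 / (1 - t - 0)) / 2)) * (\<integral>\<^sup>+w. ennreal 1 \<partial>N)"
      using R_lim[of 0 s] s T t unfolding R_def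
      by (intro nn_integral_exp_Riemann_limit) (auto simp: emeasure_finite top.not_eq_extremum[symmetric])
    also have "\<dots> < \<infinity>"
      using emeasure_finite[of "space N"] by (simp add: ennreal_mult_less_top top.not_eq_extremum del: emeasure_finite)
    finally have fin: "(\<integral>\<^sup>+w. ennreal (exp ((2 * l) * (Z s w - Z 0 w))) \<partial>N) < \<infinity>" by simp
    have "AE w in N. Z s w = Y s w" using s by (intro Y_eq) auto
    then have "AE w in N. ennreal ((f w)\<^sup>2)
        \<le> ennreal (exp ((2 * l) * (x / (1 - t)))) * ennreal (exp ((2 * l) * (Z s w - Z 0 w)))"
      using Z_0
    proof eventually_elim
      case (elim w)
      then have "(2 * l) * (x / (1 - t)) + (2 * l) * (Z s w - Z 0 w) = l * Y s w + l * Y s w"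
        by (auto simp: Z_def algebra_simps)
      moreover have "(f w)\<^sup>2 \<le> exp (l * Y s w + l * Y s w)"
        by (simp add: f_def indicator_def power2_eq_square flip: exp_add)
      ultimately have "(f w)\<^sup>2 \<le> exp ((2 * l) * (x / (1 - t))) * exp ((2 * l) * (Z s w - Z 0 w))"
        by (simp flip: exp_add)
      then show ?case by (simp add: ennreal_leI flip: ennreal_mult')
    qed
    then have "(\<integral>\<^sup>+w. ennreal ((f w)\<^sup>2) \<partial>N)
      \<le> (\<integral>\<^sup>+w. ennreal (exp ((2 * l) * (x / (1 - t)))) * ennreal (exp ((2 * l) * (Z s w - Z 0 w))) \<partial>N)"
      by (rule nn_integral_mono_AE)
    also have "\<dots> = ennreal (exp ((2 * l) * (x / (1 - t)))) * (\<integral>\<^sup>+w. ennreal (exp ((2 * l) * (Z s w - Z 0 w))) \<partial>N)"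
      by (rule nn_integral_cmult) measurable
    also have "\<dots> < \<infinity>" using fin by (simp add: ennreal_mult_less_top)
    finally show ?thesis .
  qed
  have "AE w in N. Z s w = Y s w" using s by (intro Y_eq) auto
  then have eq_s: "AE w in N. indicator A w * ennreal (exp (l * Z s w)) = ennreal (f w)"
    using A'(2) by eventually_elim (simp add: f_def indicator_def)
  have "AE w in N. indicator A w * ennreal (exp (l * Z T w)) = ennreal (f w * exp (l * (Z T w - Z s w)))"
    using \<open>AE w in N. Z s w = Y s w\<close> A'(2)
  proof eventually_elim
    case (elim w)
    have "exp (l * Y s w) * exp (l * (Z T w - Z s w)) = exp (l * Z T w)"
      using elim(1) by (simp add: right_diff_distrib flip: exp_add)
    then show ?case using elim(2) by (simp add: f_def indicator_def)
  qed
  then have "(\<integral>\<^sup>+w. indicator A w * ennreal (exp (l * Z T w)) \<partial>N)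
      = (\<integral>\<^sup>+w. ennreal (f w * exp (l * (Z T w - Z s w))) \<partial>N)"
    by (intro nn_integral_cong_AE)
  also have "\<dots> = ennreal (exp (l\<^sup>2 * (1 / (1 - t - T) - 1 / (1 - t - s)) / 2)) * (\<integral>\<^sup>+w. ennreal (f w) \<partial>N)"
  proof (rule nn_integral_exp_Riemann_limit[OF t(1) _ _ _ f f_nonneg f_sq])
    show "(\<lambda>w. Z T w - Z s w) \<in> borel_measurable N"
      using s T by (intro borel_measurable_diff Z_meas) auto
    show "AE w in N. (\<lambda>n. \<Sum>k<Suc n. 1 / (1 - t - grid s T n k) *
       (B (t + grid s T n (Suc k)) w - B (t + grid s T n k) w)) \<longlonglongrightarrow> Z T w - Z s w"
      using R_lim[of s T] s unfolding R_def by auto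
  qed (use s T in auto)
  also have "(\<integral>\<^sup>+w. ennreal (f w) \<partial>N) = (\<integral>\<^sup>+w. indicator A w * ennreal (exp (l * Z s w)) \<partial>N)"
    by (rule nn_integral_cong_AE[OF eq_s, symmetric])
  finally show "(\<integral>\<^sup>+w. indicator A w * ennreal (exp (l * (X (t + T) w / (1 - t - T)))) \<partial>N)
      = ennreal (exp (l\<^sup>2 * (1 / (1 - t - T) - 1 / (1 - t - s)) / 2))
        * (\<integral>\<^sup>+w. indicator A w * ennreal (exp (l * (X (t + s) w / (1 - t - s)))) \<partial>N)"
    by (simp add: Z_def)
next
  fix s assume "s \<in> {0..T}"
  then show "(\<lambda>w. X (t + s) w / (1 - t - s)) \<in> borel_measurable N"
    using T by (intro borel_measurable_divide measurable_X) auto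
  show "1 / (1 - t - s) \<le> 1 / (1 - t - T)"
    using T \<open>s \<in> {0..T}\<close> by (intro divide_left_mono) auto
next
  fix w assume "w \<in> space N"
  then have "continuous_on {0..T} (\<lambda>s. X (t + s) w)"
    using T by (intro continuous_on_subset[OF continuous_X_shifted]) auto
  then show "continuous_on {0..T} (\<lambda>s. X (t + s) w / (1 - t - s))"
    using T by (intro continuous_on_divide continuous_on_diff continuous_on_const continuous_on_id) auto
next
  show "continuous_on {0..T} (\<lambda>s. 1 / (1 - t - s))"
    using T by (intro continuous_intros) auto
next
  show "sets (observed_until T s) \<subseteq> sets N" for s using T by (intro sets_observed_until) simp
  show "sets (observed_until T s) \<subseteq> sets (observed_until T u)" if "s \<le> u" for s u
    using that by (rule observed_until_mono)
qed (use T in auto)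

end

section \<open>Stopping the observed process\<close>

context observed_process
begin

lemma stopping_event:
  assumes \<tau>: "\<tau> \<in> admissible_times N X t" and s: "0 \<le> s"
  shows "{w \<in> space N. \<tau> w \<le> s} \<in> sets (natural_filtration N (\<lambda>s. X (t + s)) s)"
proof -
  have "Measurable.pred (natural_filtration N (\<lambda>s. X (t + s)) s) (\<lambda>w. \<tau> w \<le> s)"
    using \<tau> by (auto simp: admissible_times_def dest: stopping_timeD)
  from predE[OF this] show ?thesis by simp
qed

lemma admissible_range: "\<tau> \<in> admissible_times N X t \<Longrightarrow> w \<in> space N \<Longrightarrow> \<tau> w \<in> {0..1 - t}"
  by (auto simp: admissible_times_def)

lemma measurable_admissible:
  assumes \<tau>: "\<tau> \<in> admissible_times N X t"
  shows "\<tau> \<in> borel_measurable N"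
proof (rule borel_measurableI_le)
  fix s
  \<comment> \<open>For \<open>s > 1 - t\<close> the filtration also involves \<open>X u\<close>
    with \<open>u > 1\<close>, whose measurability is not assumed; there the event is the whole
    space.\<close>
  consider "s < 0" | "0 \<le> s" "s \<le> 1 - t" | "1 - t < s" by linarith
  then show "{w \<in> space N. \<tau> w \<le> s} \<in> sets N"
  proof cases
    case 1
    have "\<not> \<tau> w \<le> s" if "w \<in> space N" for w using admissible_range[OF \<tau> that] 1 by simp
    then have "{w \<in> space N. \<tau> w \<le> s} = {}" by blast
    then show ?thesis by (simp only: sets.empty_sets)
  next
    case 2
    then have "sets (natural_filtration N (\<lambda>s. X (t + s)) s) \<subseteq> sets N"
      using sets_observed_until[OF order_refl, of s] by (simp only: min_absorb1)
    then show ?thesis by (rule subsetD) (rule stopping_event[OF \<tau> 2(1)])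
  next
    case 3
    have "\<tau> w \<le> s" if "w \<in> space N" for w using admissible_range[OF \<tau> that] 3 by simp
    then have "{w \<in> space N. \<tau> w \<le> s} = space N" by blast
    then show ?thesis by (simp only: sets.top)
  qed
qed

lemma measurable_X_at:
  assumes "\<sigma> \<in> borel_measurable N" "\<And>w. w \<in> space N \<Longrightarrow> \<sigma> w \<in> {0..1 - t}"
  shows "(\<lambda>w. X (t + \<sigma> w) w) \<in> borel_measurable N"
proof (rule measurable_continuous_process[OF measurable_X continuous_X])
  show "(\<lambda>w. t + \<sigma> w) \<in> borel_measurable N" using assms(1) by simp
  show "t + \<sigma> w \<in> {t..1}" if "w \<in> space N" for w using assms(2)[OF that] by simp
qed

lemma stopping_event_min:
  assumes \<tau>: "\<tau> \<in> admissible_times N X t" and s: "s \<in> {0..<T}"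
  shows "{w \<in> space N. min (\<tau> w) T \<le> s} \<in> sets (observed_until T s)"
proof -
  have "{w \<in> space N. min (\<tau> w) T \<le> s} = {w \<in> space N. \<tau> w \<le> s}" "min s T = s" using s by auto
  then show ?thesis using stopping_event[OF \<tau>, of s] s by simp
qed

text \<open>The martingale identity for X is the derivative at \<open>l = 0\<close> of the
  exponential one: \<open>(m l w - 1) / l\<close> has integral 0 and tends to
  \<open>X (t + \<tau> w) w - x\<close>. Second moments bounded uniformly in l justify the limit and
  give integrability.\<close>

lemma
  assumes path: "AE w in N. continuous_on {0..} (\<lambda>s. B s w)"
    and eq: "AE w in N. \<forall>s\<in>{0..<1 - t}. X (t + s) w = x + (B (t + s) w - B t w)"
    and \<tau>: "\<tau> \<in> admissible_times N X t"
  shows integrable_stopped_free: "integrable N (\<lambda>w. X (t + \<tau> w) w)"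
    and integral_stopped_free: "(\<integral>w. X (t + \<tau> w) w \<partial>N) = x * measure N (space N)"
proof -
  interpret exponential_martingale N "observed_until (1 - t)" "\<lambda>s. X (t + s)" "\<lambda>s. s" "1 - t" x
    using path eq by (rule exponential_martingale_free)
  define p where "p = measure N (space N)"
  have p: "emeasure N (space N) = ennreal p" "0 \<le> p"
    by (simp_all add: p_def emeasure_eq_measure)
  define m where "m l w = exp (l * (X (t + \<tau> w) w - x) - l\<^sup>2 * \<tau> w / 2)" for l w
  note [measurable] = measurable_admissible[OF \<tau>] measurable_X_at[OF measurable_admissible[OF \<tau>] admissible_range[OF \<tau>]]
  have [measurable]: "m l \<in> borel_measurable N" for l unfolding m_def by measurable
  have m_nn: "(\<integral>\<^sup>+w. ennreal (m l w) \<partial>N) = ennreal p" for l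
  proof -
    have "(\<integral>\<^sup>+w. ennreal (m l w) \<partial>N) = (\<integral>\<^sup>+w. ennreal (exp (- (l * x))) * ennreal (E l (\<tau> w) w) \<partial>N)"
    proof (rule nn_integral_cong)
      fix w
      have "m l w = exp (- (l * x)) * E l (\<tau> w) w"
        unfolding m_def E_def exp_add[symmetric] by (simp add: right_diff_distrib)
      then show "ennreal (m l w) = ennreal (exp (- (l * x))) * ennreal (E l (\<tau> w) w)"
        by (simp add: ennreal_mult')
    qed
    also have "\<dots> = ennreal (exp (- (l * x))) * (\<integral>\<^sup>+w. ennreal (E l (\<tau> w) w) \<partial>N)"
      unfolding E_def by (rule nn_integral_cmult) measurable
    also have "(\<integral>\<^sup>+w. ennreal (E l (\<tau> w) w) \<partial>N) = ennreal (exp (l * x)) * ennreal p"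
    proof (subst nn_integral_E_stopped)
      show "{w \<in> space N. \<tau> w \<le> s} \<in> sets (observed_until (1 - t) s)" if "s \<in> {0..<1 - t}" for s
        using stopping_event[OF \<tau>, of s] that by simp
    qed (use admissible_range[OF \<tau>] in \<open>auto simp: p\<close>)
    finally show ?thesis by (simp flip: mult.assoc ennreal_mult' exp_add)
  qed
  have m: "integrable N (m l)" "(\<integral>w. m l w \<partial>N) = p" for l
  proof -
    show "integrable N (m l)"
      using m_nn[of l] by (intro integrableI_nonneg) (auto simp: m_def)
    then show "(\<integral>w. m l w \<partial>N) = p"
      using m_nn[of l] p(2) by (subst integral_eq_nn_integral) (auto simp: m_def)
  qed
  \<comment> \<open>As \<open>\<tau> w \<le> 1\<close>, the square of \<open>m l\<close> is at most
    \<open>exp (l\<^sup>2) * m (2 * l)\<close>. So the second moment of the quotient is at most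
    \<open>p * (exp (l\<^sup>2) - 1) / l\<^sup>2\<close>, and \<open>exp y - 1 \<le> 2 * y\<close>
    on the unit interval.\<close>
  have sq: "(\<integral>\<^sup>+w. ennreal (((m l w - 1) / l)\<^sup>2) \<partial>N) \<le> ennreal (2 * p)" if l: "0 < l" "l \<le> 1" for l
  proof -
    have m_sq: "(m l w)\<^sup>2 \<le> exp (l\<^sup>2) * m (2 * l) w" if "w \<in> space N" for w
    proof -
      have "(m l w)\<^sup>2 = exp (l\<^sup>2 * \<tau> w) * m (2 * l) w"
        by (simp add: m_def power2_eq_square algebra_simps flip: exp_add)
      also have "l\<^sup>2 * \<tau> w \<le> l\<^sup>2 * 1"
        using admissible_range[OF \<tau> that] t by (intro mult_left_mono) auto
      then have "exp (l\<^sup>2 * \<tau> w) * m (2 * l) w \<le> exp (l\<^sup>2) * m (2 * l) w"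
        by (intro mult_right_mono) (auto simp: m_def)
      finally show ?thesis .
    qed
    have "(\<integral>\<^sup>+w. ennreal (((m l w - 1) / l)\<^sup>2) \<partial>N)
      \<le> (\<integral>\<^sup>+w. ennreal ((exp (l\<^sup>2) * m (2 * l) w - 2 * m l w + 1) / l\<^sup>2) \<partial>N)"
      using m_sq
      by (intro nn_integral_mono ennreal_leI)
         (auto simp: power_divide power2_diff intro!: divide_right_mono)
    also have "\<dots> = ennreal (\<integral>w. (exp (l\<^sup>2) * m (2 * l) w - 2 * m l w + 1) / l\<^sup>2 \<partial>N)"
    proof (rule nn_integral_eq_integral)
      show "AE w in N. 0 \<le> (exp (l\<^sup>2) * m (2 * l) w - 2 * m l w + 1) / l\<^sup>2"
      proof (rule AE_I2)
        fix w assume "w \<in> space N"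
        from m_sq[OF this] have "0 \<le> exp (l\<^sup>2) * m (2 * l) w - 2 * m l w + 1"
          using zero_le_power2[of "m l w - 1"] by (simp add: power2_diff)
        then show "0 \<le> (exp (l\<^sup>2) * m (2 * l) w - 2 * m l w + 1) / l\<^sup>2" by simp
      qed
    qed (use m in auto)
    also have "(\<integral>w. (exp (l\<^sup>2) * m (2 * l) w - 2 * m l w + 1) / l\<^sup>2 \<partial>N) = (exp (l\<^sup>2) * p - 2 * p + p) / l\<^sup>2"
      using m by (simp add: p_def)
    also have "\<dots> \<le> 2 * p"
    proof -
      have l2: "0 < l\<^sup>2" "l\<^sup>2 \<le> 1" using l by (auto simp: power_le_one)
      then have "exp (l\<^sup>2) \<le> 1 + l\<^sup>2 + (l\<^sup>2)\<^sup>2" by (intro exp_bound) auto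
      also have "(l\<^sup>2)\<^sup>2 \<le> l\<^sup>2"
        unfolding power2_eq_square[of "l\<^sup>2"] using l2 by (intro mult_left_le) auto
      finally have "exp (l\<^sup>2) - 1 \<le> 2 * l\<^sup>2" by simp
      then have "(exp (l\<^sup>2) - 1) * p \<le> 2 * l\<^sup>2 * p" using p(2) by (rule mult_right_mono)
      then show ?thesis using l2 by (simp add: pos_divide_le_eq algebra_simps)
    qed
    finally show ?thesis by (simp add: ennreal_leI)
  qed
  define l where "l n = inverse (real (Suc n))" for n
  have l: "0 < l n" "l n \<le> 1" for n by (auto simp: l_def inverse_le_1_iff)
  have "l \<longlonglongrightarrow> 0" unfolding l_def by (rule LIMSEQ_inverse_real_of_nat)
  then have l_at: "filterlim l (at 0) sequentially"
    using l(1) by (intro filterlim_atI) (auto intro!: always_eventually simp: less_imp_neq[symmetric])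
  have lim: "(\<lambda>n. (m (l n) w - 1) / l n) \<longlonglongrightarrow> X (t + \<tau> w) w - x" for w
  proof -
    have "((\<lambda>l. m l w) has_real_derivative (X (t + \<tau> w) w - x)) (at 0)"
      unfolding m_def by (auto intro!: derivative_eq_intros)
    then have "((\<lambda>l. (m l w - 1) / l) \<longlongrightarrow> X (t + \<tau> w) w - x) (at 0)"
      by (simp add: DERIV_def m_def)
    then show ?thesis by (rule filterlim_compose[OF _ l_at])
  qed
  note L = L2_bounded_limit[of "\<lambda>n w. (m (l n) w - 1) / l n" "\<lambda>w. X (t + \<tau> w) w - x" "2 * p",
      OF _ _ AE_I2[OF lim] _ sq[OF l]]
  have int: "integrable N (\<lambda>w. X (t + \<tau> w) w - x)"
    using L(2) p(2) by simp
  then have "integrable N (\<lambda>w. (X (t + \<tau> w) w - x) + x)" by (intro Bochner_Integration.integrable_add) auto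
  then show int': "integrable N (\<lambda>w. X (t + \<tau> w) w)" by simp
  have "(\<lambda>n. \<integral>w. (m (l n) w - 1) / l n \<partial>N) \<longlonglongrightarrow> (\<integral>w. X (t + \<tau> w) w - x \<partial>N)"
    using p(2) by (intro L(3)) auto
  moreover have "(\<integral>w. (m (l n) w - 1) / l n \<partial>N) = 0" for n using m by (simp add: p_def)
  ultimately have "(\<lambda>n. 0) \<longlonglongrightarrow> (\<integral>w. X (t + \<tau> w) w - x \<partial>N)" by (simp only:)
  then have "(\<integral>w. X (t + \<tau> w) w - x \<partial>N) = 0" by (simp only: LIMSEQ_const_iff)
  then show "(\<integral>w. X (t + \<tau> w) w \<partial>N) = x * measure N (space N)"
    using int' by (simp add: mult.commute)
qed

end

text \<open>A condition over uncountably many times becomes countable: a continuous path is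
  nonnegative somewhere on a compact interval exactly when, for each n, it exceeds
  \<open>- (1 / real (Suc n))\<close> at a point of some grid. Only times up to s enter, so the
  event lies in the raw filtration at s.\<close>

lemma hitting_event:
  fixes g :: "real \<Rightarrow> 'w \<Rightarrow> real"
  assumes s: "0 \<le> s" and g: "\<And>r. r \<in> {0..s} \<Longrightarrow> g r \<in> borel_measurable F"
    and cont: "\<And>w. w \<in> space F \<Longrightarrow> continuous_on {0..s} (\<lambda>r. g r w)"
  shows "{w \<in> space F. \<exists>r\<in>{0..s}. 0 \<le> g r w} \<in> sets F"
proof -
  define q where "q m k = s * (real k / real (Suc m))" for m k
  have q: "q m k \<in> {0..s}" if "k \<le> Suc m" for m k
  proof -
    have "s * (real k / real (Suc m)) \<le> s * 1"
      using s that by (intro mult_left_mono) (auto simp: divide_le_eq simp del: of_nat_Suc)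
    then show ?thesis using s by (simp add: q_def del: of_nat_Suc)
  qed
  have "(\<exists>r\<in>{0..s}. 0 \<le> g r w) \<longleftrightarrow> (\<forall>n::nat. \<exists>m. \<exists>k\<in>{..Suc m}. - (1 / real (Suc n)) < g (q m k) w)"
    if w: "w \<in> space F" for w
  proof
    assume "\<exists>r\<in>{0..s}. 0 \<le> g r w"
    then obtain r where r: "r \<in> {0..s}" "0 \<le> g r w" by blast
    define c where "c = (if s = 0 then 0 else r / s)"
    have c: "0 \<le> c" "c \<le> 1" "r = s * c" using r(1) by (auto simp: c_def divide_le_eq)
    define k where "k m = nat \<lfloor>real (Suc m) * c\<rfloor>" for m
    have k: "real (k m) \<le> real (Suc m) * c" "real (Suc m) * c - 1 \<le> real (k m)" for m
    proof -
      have "0 \<le> real (Suc m) * c" using c(1) by (intro mult_nonneg_nonneg) auto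
      then show "real (k m) \<le> real (Suc m) * c" "real (Suc m) * c - 1 \<le> real (k m)"
        unfolding k_def by linarith+
    qed
    have k_le: "k m \<le> Suc m" for m
    proof -
      have "real (Suc m) * c \<le> real (Suc m) * 1" using c by (intro mult_left_mono) auto
      then have "real (k m) \<le> real (Suc m)" using k(1)[of m] by (simp only: mult_1_right)
      then show ?thesis by (simp only: of_nat_le_iff)
    qed
    have "(\<lambda>m. real (k m) / real (Suc m)) \<longlonglongrightarrow> c"
    proof (rule tendsto_sandwich[where f = "\<lambda>m. c - inverse (real (Suc m))" and h = "\<lambda>m. c"])
      have "c - inverse (real (Suc m)) \<le> real (k m) / real (Suc m)" "real (k m) / real (Suc m) \<le> c" for m
      proof -
        have "(real (Suc m) * c - 1) / real (Suc m) \<le> real (k m) / real (Suc m)"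
          "real (k m) / real (Suc m) \<le> real (Suc m) * c / real (Suc m)"
          using k[of m] by (intro divide_right_mono; simp)+
        then show "c - inverse (real (Suc m)) \<le> real (k m) / real (Suc m)" "real (k m) / real (Suc m) \<le> c"
          by (simp_all add: diff_divide_distrib inverse_eq_divide del: of_nat_Suc)
      qed
      then show "\<forall>\<^sub>F m in sequentially. c - inverse (real (Suc m)) \<le> real (k m) / real (Suc m)"
        "\<forall>\<^sub>F m in sequentially. real (k m) / real (Suc m) \<le> c" by auto
      have "(\<lambda>m. c - inverse (real (Suc m))) \<longlonglongrightarrow> c - 0"
        by (intro tendsto_intros LIMSEQ_inverse_real_of_nat)
      then show "(\<lambda>m. c - inverse (real (Suc m))) \<longlonglongrightarrow> c" by simp
    qed simp
    then have "(\<lambda>m. q m (k m)) \<longlonglongrightarrow> r"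
      unfolding q_def c(3) by (intro tendsto_intros)
    then have lim: "(\<lambda>m. g (q m (k m)) w) \<longlonglongrightarrow> g r w"
      by (rule continuous_on_tendsto_compose[OF cont[OF w] _ r(1)]) (auto intro!: always_eventually q k_le simp del: atLeastAtMost_iff)
    show "\<forall>n::nat. \<exists>m. \<exists>k\<in>{..Suc m}. - (1 / real (Suc n)) < g (q m k) w"
    proof
      fix n :: nat
      have "- (1 / real (Suc n)) < g r w" using r(2) by (simp add: less_le_trans[of _ 0])
      from order_tendstoD(1)[OF lim this] obtain m where "- (1 / real (Suc n)) < g (q m (k m)) w"
        by (auto dest: eventually_happens)
      then show "\<exists>m. \<exists>k\<in>{..Suc m}. - (1 / real (Suc n)) < g (q m k) w" using k_le by blast
    qed
  next
    assume *: "\<forall>n::nat. \<exists>m. \<exists>k\<in>{..Suc m}. - (1 / real (Suc n)) < g (q m k) w"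
    obtain r where r: "r \<in> {0..s}" "\<And>u. u \<in> {0..s} \<Longrightarrow> g u w \<le> g r w"
      using continuous_attains_sup[OF compact_Icc _ cont[OF w]] s by auto
    have "- inverse (real (Suc n)) \<le> g r w" for n
      using *[rule_format, of n] r(2)[OF q] by (fastforce simp: divide_inverse)
    moreover have "(\<lambda>n. - inverse (real (Suc n))) \<longlonglongrightarrow> - 0"
      by (intro tendsto_intros LIMSEQ_inverse_real_of_nat)
    ultimately have "0 \<le> g r w" by (intro LIMSEQ_le_const2[of _ 0]) auto
    then show "\<exists>r\<in>{0..s}. 0 \<le> g r w" using r(1) by blast
  qed
  then have "{w \<in> space F. \<exists>r\<in>{0..s}. 0 \<le> g r w}
      = {w \<in> space F. \<forall>n::nat. \<exists>m. \<exists>k\<in>{..Suc m}. - (1 / real (Suc n)) < g (q m k) w}"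
    by blast
  also have "\<dots> \<in> sets F"
  proof (intro sets.sets_Collect_countable_All sets.sets_Collect_countable_Ex sets.sets_Collect_finite_Ex)
    fix n m k :: nat assume "k \<in> {..Suc m}"
    then have [measurable]: "g (q m k) \<in> borel_measurable F" using q by (intro g) auto
    show "{w \<in> space F. - (1 / real (Suc n)) < g (q m k) w} \<in> sets F" by measurable
  qed simp
  finally show ?thesis .
qed

section \<open>The pinned process: behaviour at maturity and the upper bound\<close>

locale observed_bridge = observed_process N B t x X
  for N :: "'w measure" and B :: "real \<Rightarrow> 'w \<Rightarrow> real" and t x :: real and X :: "real \<Rightarrow> 'w \<Rightarrow> real" +
  assumes bridge_equation: "AE w in N. \<forall>s\<in>{0..<1 - t}. X (t + s) w =
      x - integral {0..s} (\<lambda>r. X (t + r) w / (1 - t - r)) + (B (t + s) w - B t w)"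
begin

definition Z :: "real \<Rightarrow> 'w \<Rightarrow> real" where
  "Z s w = X (t + s) w / (1 - t - s)"

lemma exponential_martingale_Z:
  "0 < T \<Longrightarrow> T < 1 - t \<Longrightarrow>
    exponential_martingale N (observed_until T) Z (\<lambda>s. 1 / (1 - t - s)) T (x / (1 - t))"
  unfolding Z_def[abs_def] by (rule exponential_martingale_bridge[OF _ _ bridge_equation])

lemma measurable_Z_min:
  assumes \<tau>: "\<tau> \<in> admissible_times N X t" and T: "0 < T" "T < 1 - t"
  shows "(\<lambda>w. Z (min (\<tau> w) T) w) \<in> borel_measurable N"
proof -
  note [measurable] = measurable_admissible[OF \<tau>]
  have [measurable]: "(\<lambda>w. X (t + min (\<tau> w) T) w) \<in> borel_measurable N"
    using T admissible_range[OF \<tau>] by (intro measurable_X_at) auto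
  show ?thesis unfolding Z_def by measurable
qed

lemma nn_integral_exp_Z:
  assumes \<tau>: "\<tau> \<in> admissible_times N X t" and T: "0 < T" "T < 1 - t"
  shows "(\<integral>\<^sup>+w. ennreal (exp (l * Z (min (\<tau> w) T) w - l\<^sup>2 * (1 / (1 - t - min (\<tau> w) T)) / 2)) \<partial>N)
    = ennreal (exp (l * (x / (1 - t)) - l\<^sup>2 * (1 / (1 - t)) / 2)) * emeasure N (space N)"
proof -
  interpret exponential_martingale N "observed_until T" Z "\<lambda>s. 1 / (1 - t - s)" T "x / (1 - t)"
    by (rule exponential_martingale_Z[OF T])
  note [measurable] = measurable_admissible[OF \<tau>]
  have "(\<integral>\<^sup>+w. ennreal (E l (min (\<tau> w) T) w) \<partial>N)
      = ennreal (exp (l * (x / (1 - t)) - l\<^sup>2 * (1 / (1 - t - 0)) / 2)) * emeasure N (space N)"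
  proof (rule nn_integral_E_stopped)
    show "min (\<tau> w) T \<in> {0..T}" if "w \<in> space N" for w
      using admissible_range[OF \<tau> that] T by auto
  qed (use stopping_event_min[OF \<tau>] in auto)
  then show ?thesis by (simp add: E_def)
qed

text \<open>Tonelli's theorem integrates the exponential identities over \<open>l \<ge> 0\<close>.
  The shift d multiplies the integrand by \<open>exp (- (l\<^sup>2 * d / 2))\<close>, which does not
  involve w. The sign \<epsilon> is there because integrability of X calls for \<open>- Z\<close> as
  well as Z.\<close>

lemma nn_integral_exp_mixture_Z:
  assumes \<tau>: "\<tau> \<in> admissible_times N X t" and T: "0 < T" "T < 1 - t" and d: "0 \<le> d" and \<epsilon>: "\<epsilon> \<in> {1, - 1}"
  shows "(\<integral>\<^sup>+w. ennreal (exp_mixture (1 / (1 - t - min (\<tau> w) T) + d) (\<epsilon> * Z (min (\<tau> w) T) w)) \<partial>N)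
    = ennreal (exp_mixture (1 / (1 - t) + d) (\<epsilon> * (x / (1 - t)))) * emeasure N (space N)"
proof -
  interpret pair_sigma_finite N lborel ..
  note [measurable] = measurable_admissible[OF \<tau>] measurable_Z_min[OF \<tau> T]
  define r where "r w = 1 / (1 - t - min (\<tau> w) T)" for w
  have [measurable]: "r \<in> borel_measurable N" unfolding r_def by measurable
  have r: "0 < r w" for w using T by (auto simp: r_def)
  have \<epsilon>2: "\<epsilon>\<^sup>2 = 1" using \<epsilon> by auto
  have shift: "ennreal (exp (l * y - l\<^sup>2 * (r + d) / 2))
      = ennreal (exp (- (l\<^sup>2 * d / 2))) * ennreal (exp (l * y - l\<^sup>2 * r / 2))" for l y r
    by (simp add: algebra_simps add_divide_distrib flip: ennreal_mult' exp_add)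
  have "(\<integral>\<^sup>+w. ennreal (exp_mixture (r w + d) (\<epsilon> * Z (min (\<tau> w) T) w)) \<partial>N)
      = (\<integral>\<^sup>+w. (\<integral>\<^sup>+l. ennreal (exp (l * (\<epsilon> * Z (min (\<tau> w) T) w) - l\<^sup>2 * (r w + d) / 2)) * indicator {0..} l \<partial>lborel) \<partial>N)"
    using r d by (simp add: nn_integral_exp_mixture add_pos_nonneg)
  also have "\<dots> = (\<integral>\<^sup>+l. (\<integral>\<^sup>+w. ennreal (exp (l * (\<epsilon> * Z (min (\<tau> w) T) w) - l\<^sup>2 * (r w + d) / 2)) * indicator {0..} l \<partial>N) \<partial>lborel)"
    by (rule Fubini'[symmetric]) measurable
  also have "\<dots> = (\<integral>\<^sup>+l. (ennreal (exp (l * (\<epsilon> * (x / (1 - t))) - l\<^sup>2 * (1 / (1 - t) + d) / 2)) * indicator {0..} l)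
      * emeasure N (space N) \<partial>lborel)"
  proof (rule nn_integral_cong)
    fix l :: real
    have "(\<integral>\<^sup>+w. ennreal (exp (l * (\<epsilon> * Z (min (\<tau> w) T) w) - l\<^sup>2 * (r w + d) / 2)) * indicator {0..} l \<partial>N)
        = ennreal (exp (- (l\<^sup>2 * d / 2))) * indicator {0..} l *
          (\<integral>\<^sup>+w. ennreal (exp (l * (\<epsilon> * Z (min (\<tau> w) T) w) - l\<^sup>2 * r w / 2)) \<partial>N)"
      unfolding shift by (subst nn_integral_cmult[symmetric]) (auto intro!: nn_integral_cong simp: mult_ac)
    also have "(\<integral>\<^sup>+w. ennreal (exp (l * (\<epsilon> * Z (min (\<tau> w) T) w) - l\<^sup>2 * r w / 2)) \<partial>N)
        = ennreal (exp (l * (\<epsilon> * (x / (1 - t))) - l\<^sup>2 * (1 / (1 - t)) / 2)) * emeasure N (space N)"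
      using nn_integral_exp_Z[OF \<tau> T, of "l * \<epsilon>"] by (simp add: r_def power_mult_distrib \<epsilon>2 mult.assoc)
    finally show "(\<integral>\<^sup>+w. ennreal (exp (l * (\<epsilon> * Z (min (\<tau> w) T) w) - l\<^sup>2 * (r w + d) / 2)) * indicator {0..} l \<partial>N)
        = (ennreal (exp (l * (\<epsilon> * (x / (1 - t))) - l\<^sup>2 * (1 / (1 - t) + d) / 2)) * indicator {0..} l) * emeasure N (space N)"
      unfolding shift by (simp add: mult_ac)
  qed
  also have "\<dots> = ennreal (exp_mixture (1 / (1 - t) + d) (\<epsilon> * (x / (1 - t)))) * emeasure N (space N)"
  proof (subst nn_integral_multc)
    have "0 < 1 / (1 - t) + d" using t d by (simp add: add_pos_nonneg)
    then show "(\<integral>\<^sup>+l\<in>{0..}. ennreal (exp (l * (\<epsilon> * (x / (1 - t))) - l\<^sup>2 * (1 / (1 - t) + d) / 2)) \<partial>lborel)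
      * emeasure N (space N) = ennreal (exp_mixture (1 / (1 - t) + d) (\<epsilon> * (x / (1 - t)))) * emeasure N (space N)"
      by (simp only: nn_integral_exp_mixture)
  qed measurable
  finally show ?thesis by (simp add: r_def)
qed

text \<open>The 2 in the denominator makes even the term for \<open>n = 0\<close> positive, as a
  horizon must be.\<close>

definition exhaust :: "nat \<Rightarrow> real" where
  "exhaust n = (1 - t) * (1 - 1 / (2 + real n))"

lemma exhaust: "0 < exhaust n" "exhaust n < 1 - t"
  using t by (auto simp: exhaust_def)

lemma exhaust_lim: "exhaust \<longlonglongrightarrow> 1 - t"
proof -
  have "(\<lambda>n. 1 / (2 + real n)) \<longlonglongrightarrow> 0"
    using LIMSEQ_Suc[OF LIMSEQ_inverse_real_of_nat] by (simp add: divide_inverse)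
  then have "exhaust \<longlonglongrightarrow> (1 - t) * (1 - 0)" unfolding exhaust_def by (intro tendsto_intros)
  then show ?thesis by simp
qed

lemma const_admissible: "0 \<le> c \<Longrightarrow> c \<le> 1 - t \<Longrightarrow> (\<lambda>_. c) \<in> admissible_times N X t"
  by (simp add: admissible_times_def stopping_time_const)

text \<open>Pinning is a consequence of the equation: exponential moments of Z bound the second
  moment of X, when time e is left, by a constant times e, and Fatou's lemma carries this to
  maturity.\<close>

lemma X_1_eq_0: "AE w in N. X 1 w = 0"
proof -
  define C where "C = exp (\<bar>x / (1 - t)\<bar> + 1) * measure N (space N)"
  have C: "0 \<le> C" by (simp add: C_def)
  define e where "e n = 1 - t - exhaust n" for n
  have e: "0 < e n" "e n \<le> 1" for n using exhaust[of n] t by (auto simp: e_def)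
  have [measurable]: "X (t + exhaust n) \<in> borel_measurable N" "X 1 \<in> borel_measurable N" for n
    using exhaust[of n] t by (auto intro!: measurable_X)
  have bound: "(\<integral>\<^sup>+w. ennreal ((X (t + exhaust n) w)\<^sup>2) \<partial>N) \<le> ennreal (e n * (2 * C + 2 * C))" for n
  proof -
    \<comment> \<open>With this l the compensator \<open>l\<^sup>2 * (1 / e n) / 2\<close> is the
      constant \<open>1 / 2\<close>, so one C bounds the exponential moments for all n; moreover
      \<open>X (t + exhaust n) w\<close> has square
      \<open>e n * (l * Z (exhaust n) w)\<^sup>2\<close>.\<close>
    define l where "l = sqrt (e n)"
    have l: "0 < l" "l \<le> 1" "l\<^sup>2 = e n" using e[of n] by (auto simp: l_def)
    have Zl: "(\<integral>\<^sup>+w. ennreal (exp (b * Z (exhaust n) w)) \<partial>N) \<le> ennreal C"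
      if b: "\<bar>b\<bar> = l" for b
    proof -
      have b2: "b\<^sup>2 = e n" using b l by (metis power2_abs)
      have [measurable]: "Z (exhaust n) \<in> borel_measurable N"
        unfolding Z_def by measurable
      have "(\<integral>\<^sup>+w. ennreal (exp (b * Z (exhaust n) w)) \<partial>N)
        = (\<integral>\<^sup>+w. ennreal (exp (1 / 2)) * ennreal (exp (b * Z (exhaust n) w - b\<^sup>2 * (1 / (1 - t - exhaust n)) / 2)) \<partial>N)"
        using e[of n] unfolding b2 by (simp add: e_def[symmetric] flip: ennreal_mult' exp_add)
      also have "\<dots> = ennreal (exp (1 / 2)) * (ennreal (exp (b * (x / (1 - t)) - b\<^sup>2 * (1 / (1 - t)) / 2)) * emeasure N (space N))"
        using nn_integral_exp_Z[OF const_admissible, of "exhaust n" "exhaust n" b] exhaust[of n]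
        by (subst nn_integral_cmult) auto
      also have "\<dots> = ennreal (exp (1 / 2 + (b * (x / (1 - t)) - b\<^sup>2 * (1 / (1 - t)) / 2)) * measure N (space N))"
        by (simp add: emeasure_eq_measure exp_add mult.assoc flip: ennreal_mult')
      also have "\<dots> \<le> ennreal C"
        unfolding C_def
      proof (intro ennreal_leI mult_right_mono)
        have "b * (x / (1 - t)) \<le> \<bar>b\<bar> * \<bar>x / (1 - t)\<bar>" by (metis abs_ge_self abs_mult)
        also have "\<dots> \<le> 1 * \<bar>x / (1 - t)\<bar>" using b l by (intro mult_right_mono) auto
        moreover have "0 \<le> b\<^sup>2 * (1 / (1 - t)) / 2" using t by simp
        ultimately show "exp (1 / 2 + (b * (x / (1 - t)) - b\<^sup>2 * (1 / (1 - t)) / 2)) \<le> exp (\<bar>x / (1 - t)\<bar> + 1)"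
          by simp
      qed simp
      finally show ?thesis .
    qed
    have sq: "y\<^sup>2 \<le> 2 * exp y + 2 * exp (- y)" for y :: real
    proof -
      have "1 + \<bar>y\<bar> + \<bar>y\<bar>\<^sup>2 / 2 \<le> exp \<bar>y\<bar>" by (rule exp_lower_Taylor_quadratic) simp
      then have "y\<^sup>2 \<le> 2 * exp \<bar>y\<bar>" by simp
      also have "\<dots> \<le> 2 * exp y + 2 * exp (- y)" by (cases "0 \<le> y") auto
      finally show ?thesis .
    qed
    have "(X (t + exhaust n) w)\<^sup>2 \<le> e n * (2 * exp (l * Z (exhaust n) w) + 2 * exp ((- l) * Z (exhaust n) w))" for w
    proof -
      have "X (t + exhaust n) w = e n * Z (exhaust n) w" using e(1)[of n] by (simp add: Z_def e_def)
      then have "(X (t + exhaust n) w)\<^sup>2 = e n * (l * Z (exhaust n) w)\<^sup>2"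
        using l(3) by (simp add: power_mult_distrib power2_eq_square mult_ac)
      then show ?thesis using sq[of "l * Z (exhaust n) w"] e(1)[of n] by (simp add: mult_left_mono)
    qed
    then have "(\<integral>\<^sup>+w. ennreal ((X (t + exhaust n) w)\<^sup>2) \<partial>N)
      \<le> (\<integral>\<^sup>+w. ennreal (e n) * (2 * ennreal (exp (l * Z (exhaust n) w)) + 2 * ennreal (exp ((- l) * Z (exhaust n) w))) \<partial>N)"
      using e(1)[of n]
      by (intro nn_integral_mono) (auto simp: ennreal_mult'[symmetric] ennreal_plus[symmetric] simp del: ennreal_plus intro!: ennreal_leI
        simp flip: ennreal_numeral)
    also have "\<dots> = ennreal (e n) * (2 * (\<integral>\<^sup>+w. ennreal (exp (l * Z (exhaust n) w)) \<partial>N)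
        + 2 * (\<integral>\<^sup>+w. ennreal (exp ((- l) * Z (exhaust n) w)) \<partial>N))"
    proof -
      have [measurable]: "Z (exhaust n) \<in> borel_measurable N"
        unfolding Z_def by measurable
      show ?thesis by (simp add: nn_integral_cmult nn_integral_add)
    qed
    also have "\<dots> \<le> ennreal (e n) * (2 * ennreal C
        + 2 * ennreal C)"
      using l by (intro mult_left_mono add_mono Zl) auto
    also have "\<dots> = ennreal (e n * (2 * C + 2 * C))"
    proof -
      have "2 * ennreal C = ennreal (2 * C)" using C by (simp add: ennreal_mult')
      then show ?thesis
        using e(1)[of n] C by (simp only: ennreal_mult' ennreal_plus less_imp_le mult_nonneg_nonneg zero_le_numeral)
    qed
    finally show ?thesis .
  qed
  have "(\<integral>\<^sup>+w. ennreal ((X 1 w)\<^sup>2) \<partial>N) = (\<integral>\<^sup>+w. liminf (\<lambda>n. ennreal ((X (t + exhaust n) w)\<^sup>2)) \<partial>N)"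
  proof (rule nn_integral_cong)
    fix w assume w: "w \<in> space N"
    have "(\<lambda>n. X (t + exhaust n) w) \<longlonglongrightarrow> X (t + (1 - t)) w"
      using exhaust less_imp_le t
      by (intro continuous_on_tendsto_compose[OF continuous_X_shifted[OF w] exhaust_lim]) (auto intro!: always_eventually)
    then have "(\<lambda>n. ennreal ((X (t + exhaust n) w)\<^sup>2)) \<longlonglongrightarrow> ennreal ((X 1 w)\<^sup>2)"
      by (intro tendsto_ennrealI tendsto_power) simp
    then show "ennreal ((X 1 w)\<^sup>2) = liminf (\<lambda>n. ennreal ((X (t + exhaust n) w)\<^sup>2))"
      by (rule lim_imp_Liminf[OF sequentially_bot, symmetric])
  qed
  also have "\<dots> \<le> liminf (\<lambda>n. \<integral>\<^sup>+w. ennreal ((X (t + exhaust n) w)\<^sup>2) \<partial>N)"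
    by (rule nn_integral_liminf) measurable
  also have "\<dots> \<le> liminf (\<lambda>n. ennreal (e n * (2 * C + 2 * C)))"
    by (intro Liminf_mono always_eventually allI bound)
  also have "\<dots> = 0"
  proof -
    have "(\<lambda>n. ennreal (e n * (2 * C + 2 * C))) \<longlonglongrightarrow> ennreal ((1 - t - (1 - t)) * (2 * C + 2 * C))"
      unfolding e_def by (intro tendsto_ennrealI tendsto_intros exhaust_lim)
    then show ?thesis by (simp add: lim_imp_Liminf)
  qed
  finally have "AE w in N. ennreal ((X 1 w)\<^sup>2) = 0"
    by (subst nn_integral_0_iff_AE[symmetric]) auto
  then show ?thesis by eventually_elim simp
qed

end

lemma measurable_exp_mixture [measurable]:
  assumes [measurable]: "r \<in> borel_measurable M" "f \<in> borel_measurable M"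
  shows "(\<lambda>w. exp_mixture (r w) (f w)) \<in> borel_measurable M"
proof -
  have "continuous_on UNIV mills" unfolding mills_def[abs_def] by (intro continuous_intros) auto
  then have [measurable]: "mills \<in> borel_measurable borel" by (rule borel_measurable_continuous_onI)
  show ?thesis unfolding exp_mixture_def by measurable
qed

lemma V10_nonneg: "t < 1 \<Longrightarrow> 0 \<le> V10 t x"
  using alpha_pos alpha_sq_less_1 Phi_nonneg
  by (auto simp: V10_def not_less intro!: mult_nonneg_nonneg intro: order_trans[rotated])

context observed_bridge
begin

text \<open>Fatou's lemma along \<open>exhaust\<close>: once the horizon exceeds
  \<open>\<tau> w\<close>, the integrand no longer changes with n. Paths with
  \<open>\<tau> w = 1 - t\<close> are dropped, hence an inequality; their payoff is 0 by
  pinning.\<close>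

lemma nn_integral_exp_mixture_stopped:
  assumes \<tau>: "\<tau> \<in> admissible_times N X t" and d: "0 \<le> d" and \<epsilon>: "\<epsilon> \<in> {1, - 1}"
  shows "(\<integral>\<^sup>+w. indicator {..<1 - t} (\<tau> w) * ennreal (exp_mixture (1 / (1 - t - \<tau> w) + d) (\<epsilon> * Z (\<tau> w) w)) \<partial>N)
    \<le> ennreal (exp_mixture (1 / (1 - t) + d) (\<epsilon> * (x / (1 - t)))) * emeasure N (space N)"
proof -
  note [measurable] = measurable_admissible[OF \<tau>] measurable_Z_min[OF \<tau> exhaust]
  define f where "f n w = ennreal (exp_mixture (1 / (1 - t - min (\<tau> w) (exhaust n)) + d)
    (\<epsilon> * Z (min (\<tau> w) (exhaust n)) w))" for n w
  have "(\<integral>\<^sup>+w. indicator {..<1 - t} (\<tau> w) * ennreal (exp_mixture (1 / (1 - t - \<tau> w) + d) (\<epsilon> * Z (\<tau> w) w)) \<partial>N)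
    \<le> (\<integral>\<^sup>+w. liminf (\<lambda>n. f n w) \<partial>N)"
  proof (rule nn_integral_mono)
    fix w
    show "indicator {..<1 - t} (\<tau> w) * ennreal (exp_mixture (1 / (1 - t - \<tau> w) + d) (\<epsilon> * Z (\<tau> w) w))
      \<le> liminf (\<lambda>n. f n w)"
    proof (cases "\<tau> w < 1 - t")
      case True
      have "\<forall>\<^sub>F n in sequentially. f n w = ennreal (exp_mixture (1 / (1 - t - \<tau> w) + d) (\<epsilon> * Z (\<tau> w) w))"
        using order_tendstoD(1)[OF exhaust_lim True] by eventually_elim (simp add: f_def)
      then have "(\<lambda>n. f n w) \<longlonglongrightarrow> ennreal (exp_mixture (1 / (1 - t - \<tau> w) + d) (\<epsilon> * Z (\<tau> w) w))"
        by (rule tendsto_eventually)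
      then show ?thesis using True by (simp add: lim_imp_Liminf)
    qed simp
  qed
  also have "\<dots> \<le> liminf (\<lambda>n. \<integral>\<^sup>+w. f n w \<partial>N)"
    unfolding f_def by (rule nn_integral_liminf) measurable
  also have "\<dots> = ennreal (exp_mixture (1 / (1 - t) + d) (\<epsilon> * (x / (1 - t)))) * emeasure N (space N)"
    unfolding f_def nn_integral_exp_mixture_Z[OF \<tau> exhaust d \<epsilon>] by (simp add: Liminf_const)
  finally show ?thesis .
qed

text \<open>Before maturity the payoff is below a multiple of the mixture, at maturity it vanishes;
  so X and its negative are dominated by stopped mixtures of finite integral. The sharp constant
  comes from the majorant whose value at the start is \<open>V10 t x\<close>.\<close>

lemma
  assumes \<tau>: "\<tau> \<in> admissible_times N X t"
  shows integrable_stopped_bridge: "integrable N (\<lambda>w. X (t + \<tau> w) w)"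
    and integral_stopped_bridge_le: "(\<integral>w. X (t + \<tau> w) w \<partial>N) \<le> V10 t x * measure N (space N)"
proof -
  note [measurable] = measurable_admissible[OF \<tau>] measurable_X_at[OF measurable_admissible[OF \<tau>] admissible_range[OF \<tau>]]
  have [measurable]: "(\<lambda>w. Z (\<tau> w) w) \<in> borel_measurable N" unfolding Z_def by measurable
  define q where "q d \<epsilon> w = indicator {..<1 - t} (\<tau> w) * ennreal (exp_mixture (1 / (1 - t - \<tau> w) + d) (\<epsilon> * Z (\<tau> w) w))"
    for d \<epsilon> w
  have [measurable]: "q d \<epsilon> \<in> borel_measurable N" for d \<epsilon> unfolding q_def by measurable
  have q_le: "(\<integral>\<^sup>+w. q d \<epsilon> w \<partial>N) \<le> ennreal (exp_mixture (1 / (1 - t) + d) (\<epsilon> * (x / (1 - t)))) * emeasure N (space N)"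
    if "0 \<le> d" "\<epsilon> \<in> {1, - 1}" for d \<epsilon>
    unfolding q_def by (rule nn_integral_exp_mixture_stopped[OF \<tau> that])
  have bound: "ennreal (\<epsilon> * X (t + \<tau> w) w) \<le> ennreal K * q d \<epsilon> w"
    if w: "w \<in> space N" "X 1 w = 0" and K: "0 \<le> K"
      and maj: "\<And>r y. 1 / (1 - t) \<le> r \<Longrightarrow> y / r \<le> K * exp_mixture (r + d) y" for K d \<epsilon> w
  proof (cases "\<tau> w < 1 - t")
    case True
    have \<tau>w: "0 \<le> \<tau> w" using admissible_range[OF \<tau> w(1)] by simp
    then have "\<epsilon> * Z (\<tau> w) w / (1 / (1 - t - \<tau> w)) \<le> K * exp_mixture (1 / (1 - t - \<tau> w) + d) (\<epsilon> * Z (\<tau> w) w)"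
      using True t by (intro maj divide_left_mono) auto
    moreover have "\<epsilon> * Z (\<tau> w) w / (1 / (1 - t - \<tau> w)) = \<epsilon> * X (t + \<tau> w) w"
      using True by (simp add: Z_def)
    ultimately have "\<epsilon> * X (t + \<tau> w) w \<le> K * exp_mixture (1 / (1 - t - \<tau> w) + d) (\<epsilon> * Z (\<tau> w) w)"
      by (simp only:)
    then show ?thesis using True K by (simp add: q_def ennreal_leI flip: ennreal_mult')
  next
    case False
    then have "t + \<tau> w = 1" using admissible_range[OF \<tau> w(1)] by auto
    then show ?thesis using w by simp
  qed
  \<comment> \<open>A crude majorant with \<open>K = 1\<close> and \<open>d = 0\<close>, enough for
    integrability.\<close>
  have abs_maj: "y / r \<le> 1 * exp_mixture (r + 0) y" if "1 / (1 - t) \<le> r" for r y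
  proof -
    have "0 < 1 / (1 - t)" using t by simp
    then have r: "0 < r" using that by linarith
    have "(1 - alpha\<^sup>2) * exp_mixture r y \<le> 1 * exp_mixture r y"
      using exp_mixture_nonneg[OF r] by (intro mult_right_mono) auto
    then show ?thesis using div_le_exp_mixture[OF r, of y] by simp
  qed
  have "(\<integral>\<^sup>+w. ennreal (norm (X (t + \<tau> w) w)) \<partial>N) \<le> (\<integral>\<^sup>+w. q 0 1 w + q 0 (- 1) w \<partial>N)"
  proof (rule nn_integral_mono_AE)
    show "AE w in N. ennreal (norm (X (t + \<tau> w) w)) \<le> q 0 1 w + q 0 (- 1) w"
      using X_1_eq_0 AE_space
    proof eventually_elim
      case (elim w)
      have "ennreal (1 * X (t + \<tau> w) w) \<le> ennreal 1 * q 0 1 w"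
        "ennreal ((- 1) * X (t + \<tau> w) w) \<le> ennreal 1 * q 0 (- 1) w"
        using elim abs_maj by (intro bound; simp)+
      then show ?case
        by (cases "0 \<le> X (t + \<tau> w) w") (auto intro: order_trans simp: add_increasing add_increasing2)
    qed
  qed
  also have "\<dots> = (\<integral>\<^sup>+w. q 0 1 w \<partial>N) + (\<integral>\<^sup>+w. q 0 (- 1) w \<partial>N)"
    by (rule nn_integral_add) measurable
  also have "\<dots> < \<infinity>"
  proof -
    have "ennreal c * emeasure N (space N) < \<top>" for c
      by (simp add: emeasure_eq_measure ennreal_mult_less_top)
    then have "(\<integral>\<^sup>+w. q 0 1 w \<partial>N) < \<top>" "(\<integral>\<^sup>+w. q 0 (- 1) w \<partial>N) < \<top>"
      using q_le[of 0 1] q_le[of 0 "- 1"] by (auto intro: le_less_trans)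
    then show ?thesis by simp
  qed
  finally have "(\<integral>\<^sup>+w. ennreal (norm (X (t + \<tau> w) w)) \<partial>N) < \<infinity>" .
  then show "integrable N (\<lambda>w. X (t + \<tau> w) w)" by (intro integrableI_bounded) auto
  \<comment> \<open>\<open>ennreal\<close> sends negative values to 0, so the right-hand side is the
    integral of the positive part.\<close>
  then have "(\<integral>w. X (t + \<tau> w) w \<partial>N) \<le> enn2real (\<integral>\<^sup>+w. ennreal (X (t + \<tau> w) w) \<partial>N)"
    by (simp add: real_lebesgue_integral_def)
  also have "\<dots> \<le> V10 t x * measure N (space N)"
  proof -
    obtain K d where K: "0 \<le> K" "0 \<le> d" "K * exp_mixture (1 / (1 - t) + d) (x / (1 - t)) = V10 t x"
      and maj: "\<And>r w. 1 / (1 - t) \<le> r \<Longrightarrow> w / r \<le> K * exp_mixture (r + d) w"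
      using ex_exp_mixture_majorant[OF t(2), of x] by blast
    have "(\<integral>\<^sup>+w. ennreal (X (t + \<tau> w) w) \<partial>N) \<le> (\<integral>\<^sup>+w. ennreal K * q d 1 w \<partial>N)"
    proof (rule nn_integral_mono_AE)
      show "AE w in N. ennreal (X (t + \<tau> w) w) \<le> ennreal K * q d 1 w"
        using X_1_eq_0 AE_space
      proof eventually_elim
        case (elim w)
        have "ennreal (1 * X (t + \<tau> w) w) \<le> ennreal K * q d 1 w"
          by (rule bound) (use elim K maj in auto)
        then show ?case by simp
      qed
    qed
    also have "\<dots> = ennreal K * (\<integral>\<^sup>+w. q d 1 w \<partial>N)" by (rule nn_integral_cmult) measurable
    also have "\<dots> \<le> ennreal K * (ennreal (exp_mixture (1 / (1 - t) + d) (1 * (x / (1 - t)))) * emeasure N (space N))"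
      using K by (intro mult_left_mono q_le) auto
    also have "\<dots> = ennreal (V10 t x * measure N (space N))"
      using K(1) by (simp add: emeasure_eq_measure K(3)[symmetric] mult.assoc ennreal_mult' ennreal_mult'')
    finally show ?thesis
      using V10_nonneg[OF t(2), of x] by (intro enn2real_leI) auto
  qed
  finally show "(\<integral>w. X (t + \<tau> w) w \<partial>N) \<le> V10 t x * measure N (space N)" .
qed

section \<open>The rule of stopping at the boundary\<close>

definition excess :: "real \<Rightarrow> 'w \<Rightarrow> real" where
  "excess r w = X (t + r) w - alpha * sqrt (1 - t - r)"

text \<open>Inserting \<open>1 - t\<close> keeps the set nonempty, and a path that never reaches the
  boundary is held until maturity.\<close>

definition hit :: "'w \<Rightarrow> real" where
  "hit w = Inf (insert (1 - t) {r \<in> {0..1 - t}. 0 \<le> excess r w})"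

lemma continuous_excess: "w \<in> space N \<Longrightarrow> continuous_on {0..1 - t} (\<lambda>r. excess r w)"
  unfolding excess_def by (intro continuous_intros continuous_X_shifted)

lemma hit_mem:
  assumes w: "w \<in> space N"
  shows "hit w \<in> insert (1 - t) {r \<in> {0..1 - t}. 0 \<le> excess r w}"
  unfolding hit_def
proof (rule closed_contains_Inf)
  show "closed (insert (1 - t) {r \<in> {0..1 - t}. 0 \<le> excess r w})"
    by (intro closed_insert continuous_on_closed_Collect_le continuous_excess[OF w] continuous_on_const) auto
qed (use t in \<open>auto intro!: bdd_belowI[of _ 0]\<close>)

lemma hit_le: "r \<in> {0..1 - t} \<Longrightarrow> 0 \<le> excess r w \<Longrightarrow> hit w \<le> r"
  unfolding hit_def using t by (intro cInf_lower) (auto intro!: bdd_belowI[of _ 0])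

lemma hit_range: "w \<in> space N \<Longrightarrow> hit w \<in> {0..1 - t}"
  using hit_mem[of w] t by auto

lemma excess_hit: "w \<in> space N \<Longrightarrow> hit w < 1 - t \<Longrightarrow> 0 \<le> excess (hit w) w"
  using hit_mem[of w] by auto

text \<open>The infimum is attained, so before maturity \<open>hit w \<le> s\<close> means that the
  path is at or above the boundary at some time up to s. This is an event of the natural filtration
  at s itself, without passing to right limits.\<close>

lemma hit_admissible: "hit \<in> admissible_times N X t"
proof -
  have "Measurable.pred (natural_filtration N (\<lambda>s. X (t + s)) s) (\<lambda>w. hit w \<le> s)" for s
  proof -
    consider "s < 0" | "0 \<le> s" "s < 1 - t" | "1 - t \<le> s" by linarith
    then have "{w \<in> space N. hit w \<le> s} \<in> sets (natural_filtration N (\<lambda>s. X (t + s)) s)"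
    proof cases
      case 1
      have "\<not> hit w \<le> s" if "w \<in> space N" for w using hit_range[OF that] 1 by simp
      then have "{w \<in> space N. hit w \<le> s} = {}" by blast
      then show ?thesis by (simp only: sets.empty_sets)
    next
      case 2
      have "{w \<in> space N. hit w \<le> s} = {w \<in> space N. \<exists>r\<in>{0..s}. 0 \<le> excess r w}"
      proof (intro Collect_cong conj_cong refl iffI)
        fix w assume w: "w \<in> space N"
        show "\<exists>r\<in>{0..s}. 0 \<le> excess r w" if "hit w \<le> s"
          using that 2 hit_range[OF w] excess_hit[OF w] by (intro bexI[of _ "hit w"]) auto
        show "hit w \<le> s" if "\<exists>r\<in>{0..s}. 0 \<le> excess r w"
          using that 2 hit_le[of _ w] by fastforce
      qed
      moreover have "{w \<in> space (natural_filtration N (\<lambda>s. X (t + s)) s). \<exists>r\<in>{0..s}. 0 \<le> excess r w}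
          \<in> sets (natural_filtration N (\<lambda>s. X (t + s)) s)"
      proof (rule hitting_event[OF 2(1)])
        show "excess r \<in> borel_measurable (natural_filtration N (\<lambda>s. X (t + s)) s)" if "r \<in> {0..s}" for r
        proof -
          have "X (t + r) \<in> borel_measurable (natural_filtration N (\<lambda>s. X (t + s)) s)"
            unfolding natural_filtration_def
            using that by (rule measurable_generated_algebra[where Y = "\<lambda>s. X (t + s)"])
          then show ?thesis unfolding excess_def[abs_def] by simp
        qed
        show "continuous_on {0..s} (\<lambda>r. excess r w)" if "w \<in> space (natural_filtration N (\<lambda>s. X (t + s)) s)" for w
          using that 2 by (intro continuous_on_subset[OF continuous_excess]) auto
      qed
      ultimately show ?thesis by simp
    next
      case 3
      have "hit w \<le> s" if "w \<in> space N" for w using hit_range[OF that] 3 by simp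
      then have "{w \<in> space N. hit w \<le> s} = space (natural_filtration N (\<lambda>s. X (t + s)) s)" by auto
      then show ?thesis by (simp only: sets.top)
    qed
    then show ?thesis by (simp add: pred_def)
  qed
  then show ?thesis
    using hit_range unfolding admissible_times_def by (auto intro!: stopping_timeI)
qed

lemma excess_hit_eq_0:
  assumes w: "w \<in> space N" and start: "excess 0 w < 0" and hit: "hit w < 1 - t"
  shows "excess (hit w) w = 0"
proof -
  have "hit w \<noteq> 0" using excess_hit[OF w hit] start by auto
  then have pos: "0 < hit w" using hit_range[OF w] by simp
  \<comment> \<open>Times approaching \<open>hit w\<close> from the left, at which the path is still
    below the boundary; by continuity it cannot overshoot.\<close>
  define u where "u n = hit w * (1 - inverse (real (Suc n)))" for n
  have u: "0 \<le> u n" "u n < hit w" for n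
    using pos by (auto simp: u_def inverse_le_1_iff)
  have "u \<longlonglongrightarrow> hit w * (1 - 0)"
    unfolding u_def by (intro tendsto_intros LIMSEQ_inverse_real_of_nat)
  then have "u \<longlonglongrightarrow> hit w" by simp
  then have "(\<lambda>n. excess (u n) w) \<longlonglongrightarrow> excess (hit w) w"
    using u hit_range[OF w]
    by (intro continuous_on_tendsto_compose[OF continuous_excess[OF w]])
       (auto intro!: always_eventually dest: less_imp_le intro: order_trans)
  moreover have "excess (u n) w \<le> 0" for n
    using hit_le[of "u n" w] u[of n] hit by (rule_tac ccontr) auto
  ultimately have "excess (hit w) w \<le> 0" by (intro LIMSEQ_le_const2) auto
  then show ?thesis using excess_hit[OF w hit] by simp
qed

lemma X_start: "AE w in N. X t w = x"
  using bridge_equation by eventually_elim (use t in force)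

text \<open>For each horizon T the martingale identity is exact. On paths stopped by T the mixture
  equals the payoff, by contact at the boundary. On the others the position at T is below the
  boundary, where monotonicity of \<open>mills\<close> bounds the mixture by a multiple of
  \<open>sqrt (1 - t - T)\<close>, and this vanishes as T tends to maturity.\<close>

lemma integral_hit_ge:
  assumes x: "x < alpha * sqrt (1 - t)"
  shows "V10 t x * measure N (space N) \<le> (\<integral>w. X (t + hit w) w \<partial>N)"
proof -
  define K where "K = 1 - alpha\<^sup>2"
  have K: "0 < K" using alpha_sq_less_1 by (simp add: K_def)
  define p where "p = measure N (space N)"
  note [measurable] = measurable_admissible[OF hit_admissible]
    measurable_X_at[OF measurable_admissible[OF hit_admissible] admissible_range[OF hit_admissible]]
  note [measurable] = measurable_Z_min[OF hit_admissible exhaust]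
  have X_nonneg: "AE w in N. 0 \<le> X (t + hit w) w"
    using X_1_eq_0 AE_space
  proof eventually_elim
    case (elim w)
    show ?case
    proof (cases "hit w < 1 - t")
      case True
      then show ?thesis
        using excess_hit[OF elim(2) True] alpha_pos
        by (auto simp: excess_def intro: order_trans[rotated])
    next
      case False
      then have "t + hit w = 1" using hit_range[OF elim(2)] by simp
      then show ?thesis using elim by simp
    qed
  qed
  have step: "ennreal (V10 t x * p) \<le> ennreal (\<integral>w. X (t + hit w) w \<partial>N) + ennreal (K * mills alpha * sqrt (1 - t - exhaust n) * p)" for n
  proof -
    define T where "T = exhaust n"
    have T: "0 < T" "T < 1 - t" using exhaust by (simp_all add: T_def)
    have le: "AE w in N. ennreal K * ennreal (exp_mixture (1 / (1 - t - min (hit w) T) + 0) (1 * Z (min (hit w) T) w))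
      \<le> ennreal (X (t + hit w) w) + ennreal (K * mills alpha * sqrt (1 - t - T))"
      using X_start X_nonneg AE_space
    proof eventually_elim
      case (elim w)
      have start: "excess 0 w < 0" using elim x by (simp add: excess_def)
      show ?case
      proof (cases "hit w \<le> T")
        case True
        then have h: "hit w < 1 - t" using T by simp
        have "X (t + hit w) w = alpha * sqrt (1 - t - hit w)"
          using excess_hit_eq_0[OF elim(3) start h] by (simp add: excess_def)
        then have "K * exp_mixture (1 / (1 - t - hit w)) (Z (hit w) w) = X (t + hit w) w"
          using h alpha_root by (simp add: Z_def exp_mixture_bridge K_def)
        then show ?thesis using True K by (simp add: min_absorb1 flip: ennreal_mult')
      next
        case False
        then have "excess T w < 0" using hit_le[of T w] T by force
        then have "X (t + T) w / sqrt (1 - t - T) \<le> alpha"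
          using T by (simp add: excess_def pos_divide_le_eq)
        then have "K * exp_mixture (1 / (1 - t - T)) (Z T w) \<le> K * (sqrt (1 - t - T) * mills alpha)"
          using T K by (auto simp: Z_def exp_mixture_bridge intro!: mult_left_mono mills_mono)
        then have "ennreal (K * exp_mixture (1 / (1 - t - T)) (Z T w)) \<le> ennreal (K * mills alpha * sqrt (1 - t - T))"
          by (intro ennreal_leI) (simp add: mult_ac)
        then show ?thesis using False K by (simp add: min_absorb2 add_increasing flip: ennreal_mult')
      qed
    qed
    have "ennreal (V10 t x * p) = ennreal K * (ennreal (exp_mixture (1 / (1 - t) + 0) (1 * (x / (1 - t)))) * emeasure N (space N))"
      using x t K by (simp add: V10_eq K_def[symmetric] emeasure_eq_measure p_def mult.assoc ennreal_mult' ennreal_mult'')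
    also have "\<dots> = ennreal K * (\<integral>\<^sup>+w. ennreal (exp_mixture (1 / (1 - t - min (hit w) T) + 0) (1 * Z (min (hit w) T) w)) \<partial>N)"
      by (subst nn_integral_exp_mixture_Z[OF hit_admissible T]) auto
    also have "\<dots> = (\<integral>\<^sup>+w. ennreal K * ennreal (exp_mixture (1 / (1 - t - min (hit w) T) + 0) (1 * Z (min (hit w) T) w)) \<partial>N)"
      unfolding T_def by (rule nn_integral_cmult[symmetric]) measurable
    also have "\<dots> \<le> (\<integral>\<^sup>+w. ennreal (X (t + hit w) w) + ennreal (K * mills alpha * sqrt (1 - t - T)) \<partial>N)"
      using le by (rule nn_integral_mono_AE)
    also have "\<dots> = (\<integral>\<^sup>+w. ennreal (X (t + hit w) w) \<partial>N) + ennreal (K * mills alpha * sqrt (1 - t - T)) * emeasure N (space N)"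
      by (subst nn_integral_add) auto
    also have "(\<integral>\<^sup>+w. ennreal (X (t + hit w) w) \<partial>N) = ennreal (\<integral>w. X (t + hit w) w \<partial>N)"
      by (rule nn_integral_eq_integral[OF integrable_stopped_bridge[OF hit_admissible] X_nonneg])
    finally show ?thesis by (simp add: T_def p_def emeasure_eq_measure ennreal_mult'')
  qed
  have nonneg: "0 \<le> (\<integral>w. X (t + hit w) w \<partial>N)" using X_nonneg by (rule integral_nonneg_AE)
  have "V10 t x * p \<le> (\<integral>w. X (t + hit w) w \<partial>N) + K * mills alpha * sqrt (1 - t - exhaust n) * p" for n
  proof -
    have "0 \<le> K * mills alpha * sqrt (1 - t - exhaust n) * p"
      using K mills_pos[of alpha] exhaust[of n] by (simp add: p_def)
    then show ?thesis
      using step[of n] nonneg by (simp add: ennreal_le_iff flip: ennreal_plus)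
  qed
  moreover have "(\<lambda>n. (\<integral>w. X (t + hit w) w \<partial>N) + K * mills alpha * sqrt (1 - t - exhaust n) * p)
      \<longlonglongrightarrow> (\<integral>w. X (t + hit w) w \<partial>N) + K * mills alpha * sqrt (1 - t - (1 - t)) * p"
    by (intro tendsto_intros exhaust_lim)
  ultimately have "V10 t x * p \<le> (\<integral>w. X (t + hit w) w \<partial>N) + K * mills alpha * sqrt (1 - t - (1 - t)) * p"
    by (intro LIMSEQ_le_const) auto
  then show ?thesis by (simp add: p_def)
qed

lemma ex_optimal_stopped_bridge:
  "\<exists>\<tau>\<in>admissible_times N X t. V10 t x * measure N (space N) \<le> (\<integral>w. X (t + \<tau> w) w \<partial>N)"
proof (cases "x < alpha * sqrt (1 - t)")
  case True
  then show ?thesis using hit_admissible integral_hit_ge by blast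
next
  case False
  have "(\<integral>w. X (t + 0) w \<partial>N) = (\<integral>w. x \<partial>N)"
    using X_start measurable_X[of t] t by (intro integral_cong_AE) auto
  then show ?thesis
    using False t by (intro bexI[OF _ const_admissible[of 0]]) (auto simp: V10_def)
qed

end

section \<open>Splitting by the hidden variable\<close>

lemma generated_algebra_cong: "space N = space M \<Longrightarrow> generated_algebra N Y I = generated_algebra M Y I"
  by (simp add: generated_algebra_def)

lemma admissible_times_cong:
  assumes "space N = space M"
  shows "admissible_times N X t = admissible_times M X t"
proof -
  have "natural_filtration N Y = natural_filtration M Y" for Y
    by (rule ext) (simp add: natural_filtration_def generated_algebra_cong[OF assms])
  then show ?thesis by (simp add: admissible_times_def assms)
qed

context embedded_problem
begin

text \<open>Conditioning without normalisation, since the event may have probability 0.\<close>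

definition conditioned :: "real \<Rightarrow> 'w measure" where
  "conditioned i = density M (\<lambda>w. ennreal (indicator {w. \<theta> w = i} w))"

lemma space_conditioned [simp]: "space (conditioned i) = space M"
  and sets_conditioned [simp, measurable_cong]: "sets (conditioned i) = sets M"
  by (simp_all add: conditioned_def)

lemma measurable_theta_event: "{w \<in> space M. \<theta> w = i} \<in> sets M"
proof -
  note [measurable] = random_variable_theta
  show ?thesis by measurable
qed

lemma measurable_theta_indicator [measurable]: "(indicator {w. \<theta> w = i} :: 'w \<Rightarrow> real) \<in> borel_measurable M"
proof (rule measurable_cong[THEN iffD2])
  show "(indicator {w \<in> space M. \<theta> w = i} :: 'w \<Rightarrow> real) \<in> borel_measurable M"
    by (rule borel_measurable_indicator[OF measurable_theta_event])
qed (simp add: indicator_def)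

lemma emeasure_conditioned:
  assumes [measurable]: "A \<in> sets M"
  shows "emeasure (conditioned i) A = emeasure M (A \<inter> {w \<in> space M. \<theta> w = i})"
proof -
  have "emeasure (conditioned i) A = (\<integral>\<^sup>+w. indicator (A \<inter> {w \<in> space M. \<theta> w = i}) w \<partial>M)"
    unfolding conditioned_def
    by (subst emeasure_density) (auto intro!: nn_integral_cong split: split_indicator)
  also have "\<dots> = emeasure M (A \<inter> {w \<in> space M. \<theta> w = i})"
    using measurable_theta_event[of i] by (intro nn_integral_indicator) auto
  finally show ?thesis .
qed

lemma measure_conditioned: "measure (conditioned i) (space M) = prob {w \<in> space M. \<theta> w = i}"
  by (auto simp: measure_def emeasure_conditioned intro!: arg_cong[where f = "\<lambda>A. enn2real (emeasure M A)"])

lemma AE_conditioned: "(AE w in conditioned i. P w) \<longleftrightarrow> (AE w in M. \<theta> w = i \<longrightarrow> P w)"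
  unfolding conditioned_def by (subst AE_density) (measurable, simp add: indicator_def)

text \<open>Independence says that, given B, the indicator of \<open>\<theta> w = i\<close> has
  constant conditional expectation, which is the situation of
  \<open>nn_integral_mult_subalgebra\<close>. It is the reason why Brownian increments keep their
  law under \<open>conditioned i\<close>.\<close>

lemma nn_integral_conditioned:
  assumes f: "f \<in> borel_measurable (generated_algebra M B {0..})"
  shows "(\<integral>\<^sup>+w. f w \<partial>conditioned i) = emeasure M {w \<in> space M. \<theta> w = i} * (\<integral>\<^sup>+w. f w \<partial>M)"
proof -
  have sub: "subalgebra M (generated_algebra M B {0..})"
    unfolding subalgebra_def using sets_generated_algebra_subset[of "{0..}" B M] random_variable_B by auto
  have [measurable]: "f \<in> borel_measurable M" by (rule measurable_from_subalg[OF sub f])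
  have "(\<integral>\<^sup>+w. f w \<partial>conditioned i) = (\<integral>\<^sup>+w. f w * ennreal (indicator {w. \<theta> w = i} w) \<partial>M)"
    unfolding conditioned_def by (subst nn_integral_density) (auto simp: mult.commute)
  also have "\<dots> = emeasure M {w \<in> space M. \<theta> w = i} * (\<integral>\<^sup>+w. f w \<partial>M)"
  proof (rule nn_integral_mult_subalgebra[OF finite_measure_axioms sub sets.Int_stable _ _ _ _ _ _ f])
    show "sets (generated_algebra M B {0..}) = sigma_sets (space M) (sets (generated_algebra M B {0..}))"
      using sets.sigma_sets_eq[of "generated_algebra M B {0..}"] by simp
    show "space M \<in> sets (generated_algebra M B {0..})"
      using sets.top[of "generated_algebra M B {0..}"] by simp
    show "sets (generated_algebra M B {0..}) \<subseteq> Pow (space M)"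
      using sets.space_closed[of "generated_algebra M B {0..}"] by simp
    fix A assume A: "A \<in> sets (generated_algebra M B {0..})"
    then have A_M: "A \<in> sets M" using sub by (auto simp: subalgebra_def)
    have "{w \<in> space M. \<theta> w = i} = \<theta> -` {i} \<inter> space M" by auto
    then have "{w \<in> space M. \<theta> w = i} \<in> sets (vimage_algebra (space M) \<theta> borel)"
      by (simp add: in_vimage_algebra)
    then have "prob ({w \<in> space M. \<theta> w = i} \<inter> A) = prob {w \<in> space M. \<theta> w = i} * prob A"
      using A by (rule indep_setD[OF independent_theta_B])
    then have "emeasure M (A \<inter> {w \<in> space M. \<theta> w = i}) = emeasure M {w \<in> space M. \<theta> w = i} * emeasure M A"
      by (simp add: emeasure_eq_measure Int_commute ennreal_mult')
    moreover have "(\<integral>\<^sup>+w. indicator A w * ennreal (indicator {w. \<theta> w = i} w) \<partial>M) = emeasure (conditioned i) A"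
      unfolding conditioned_def using A_M by (subst emeasure_density) (auto simp: mult.commute)
    ultimately show "(\<integral>\<^sup>+w. indicator A w * ennreal (indicator {w. \<theta> w = i} w) \<partial>M)
        = emeasure M {w \<in> space M. \<theta> w = i} * emeasure M A"
      by (simp add: emeasure_conditioned[OF A_M])
  qed (auto simp: less_top[symmetric])
  finally show ?thesis .
qed

lemma brownian_increments_conditioned: "brownian_increments (conditioned i) B"
proof -
  interpret conditioned: finite_measure "conditioned i"
    by (rule finite_measureI) (simp add: emeasure_conditioned)
  show ?thesis
  proof
    show "B s \<in> borel_measurable (conditioned i)" if "0 \<le> s" for s
      using random_variable_B[OF that] by simp
    fix u v c :: real and f :: "'w \<Rightarrow> ennreal"
    assume uv: "0 \<le> u" "u \<le> v" and f: "f \<in> borel_measurable (generated_algebra (conditioned i) B {0..u})"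
    then have f: "f \<in> borel_measurable (generated_algebra M B {0..u})"
      by (simp add: generated_algebra_cong[of "conditioned i" M])
    have "subalgebra (generated_algebra M B {0..}) (generated_algebra M B {0..u})"
      using sets_generated_algebra_mono[of "{0..u}" "{0..}" M B] by (simp add: subalgebra_def)
    then have f_all [measurable]: "f \<in> borel_measurable (generated_algebra M B {0..})"
      using f by (rule measurable_from_subalg)
    have [measurable]: "B u \<in> borel_measurable (generated_algebra M B {0..})"
      "B v \<in> borel_measurable (generated_algebra M B {0..})"
      using uv by (auto intro!: measurable_generated_algebra)
    show "(\<integral>\<^sup>+w. f w * ennreal (exp (c * (B v w - B u w))) \<partial>conditioned i)
        = ennreal (exp (c\<^sup>2 * (v - u) / 2)) * (\<integral>\<^sup>+w. f w \<partial>conditioned i)"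
      by (simp add: nn_integral_conditioned nn_integral_exp_increment[OF uv f] mult.left_commute)
  qed
qed

lemma observed_process_conditioned:
  assumes "t \<in> {0..<1}"
  shows "observed_process (conditioned i) B t X"
proof -
  interpret brownian_increments "conditioned i" B by (rule brownian_increments_conditioned)
  show ?thesis
    by unfold_locales (use assms random_variable_X continuous_X in auto)
qed

lemma observed_bridge_conditioned:
  assumes "t \<in> {0..<1}"
  shows "observed_bridge (conditioned 1) B t x X"
proof -
  interpret observed_process "conditioned 1" B t x X by (rule observed_process_conditioned[OF assms])
  show ?thesis
    by unfold_locales (use X_equation in \<open>auto simp: AE_conditioned elim!: eventually_mono\<close>)
qed

lemma AE_theta: "AE w in M. \<theta> w = 0 \<or> \<theta> w = 1"
proof -
  have "prob ({w \<in> space M. \<theta> w = 0} \<union> {w \<in> space M. \<theta> w = 1}) = 1"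
    using measurable_theta_event
    by (subst finite_measure_Union) (auto simp: prob_theta_0 prob_theta_1)
  from AE_prob_1[OF this] show ?thesis by eventually_elim auto
qed

lemma integral_conditioned:
  assumes f [measurable]: "f \<in> borel_measurable M"
    and "integrable (conditioned 0) f" "integrable (conditioned 1) f"
  shows "(\<integral>w. f w \<partial>M) = (\<integral>w. f w \<partial>conditioned 0) + (\<integral>w. (f w :: real) \<partial>conditioned 1)"
proof -
  have int: "integrable M (\<lambda>w. indicator {w. \<theta> w = i} w * f w)" if "i \<in> {0, 1}" for i
    using that assms(2,3) unfolding conditioned_def by (auto simp: integrable_real_density)
  have "(\<integral>w. f w \<partial>M) = (\<integral>w. indicator {w. \<theta> w = 0} w * f w + indicator {w. \<theta> w = 1} w * f w \<partial>M)"
    by (rule integral_cong_AE) (use AE_theta in \<open>auto elim!: eventually_mono\<close>)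
  also have "\<dots> = (\<integral>w. indicator {w. \<theta> w = 0} w * f w \<partial>M) + (\<integral>w. indicator {w. \<theta> w = 1} w * f w \<partial>M)"
    by (intro Bochner_Integration.integral_add int) auto
  also have "\<dots> = (\<integral>w. f w \<partial>conditioned 0) + (\<integral>w. f w \<partial>conditioned 1)"
    unfolding conditioned_def by (simp add: integral_real_density)
  finally show ?thesis .
qed

text \<open>The part with \<theta> equal to 0 contributes the same amount for every stopping time,
  so only the bridge part is optimised, and one rule attains its bound.\<close>

lemma value_function_eq:
  assumes t: "t \<in> {0..<1}"
  shows "value_function M X t = ereal (x + belief t x p * (V10 t x - x))"
proof -
  interpret free: observed_process "conditioned 0" B t x X by (rule observed_process_conditioned[OF t])
  interpret bridge: observed_bridge "conditioned 1" B t x X by (rule observed_bridge_conditioned[OF t])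
  \<comment> \<open>Admissibility depends on the measure only through its space, so the same \<tau>
    is admissible before and after conditioning.\<close>
  have adm: "admissible_times (conditioned i) X t = admissible_times M X t" for i
    by (rule admissible_times_cong) simp
  have path: "AE w in conditioned 0. continuous_on {0..} (\<lambda>s. B s w)"
    using continuous_paths by (auto simp: AE_conditioned elim!: eventually_mono)
  have eq: "AE w in conditioned 0. \<forall>s\<in>{0..<1 - t}. X (t + s) w = x + (B (t + s) w - B t w)"
    using X_equation by (auto simp: AE_conditioned elim!: eventually_mono)
  have total: "(\<integral>w. X (t + \<tau> w) w \<partial>M) = x * (1 - belief t x p) + (\<integral>w. X (t + \<tau> w) w \<partial>conditioned 1)"
    if \<tau>: "\<tau> \<in> admissible_times M X t" for \<tau>
  proof -
    note \<tau>' = \<tau>[folded adm[of 0]] and \<tau>'' = \<tau>[folded adm[of 1]]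
    have "(\<lambda>w. X (t + \<tau> w) w) \<in> borel_measurable (conditioned 0)"
      by (rule free.measurable_X_at[OF free.measurable_admissible[OF \<tau>'] free.admissible_range[OF \<tau>']])
    then have "(\<lambda>w. X (t + \<tau> w) w) \<in> borel_measurable M" by simp
    from integral_conditioned[OF this free.integrable_stopped_free[OF path eq \<tau>'] bridge.integrable_stopped_bridge[OF \<tau>'']]
    show ?thesis
      using free.integral_stopped_free[OF path eq \<tau>'] by (simp add: measure_conditioned prob_theta_0)
  qed
  have le: "value_function M X t \<le> ereal (x + belief t x p * (V10 t x - x))"
    unfolding value_function_def
  proof (rule SUP_least)
    fix \<tau> assume \<tau>: "\<tau> \<in> admissible_times M X t"
    from bridge.integral_stopped_bridge_le[OF \<tau>[folded adm[of 1]]]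
    have "(\<integral>w. X (t + \<tau> w) w \<partial>conditioned 1) \<le> V10 t x * belief t x p"
      by (simp add: measure_conditioned prob_theta_1)
    then show "ereal (\<integral>w. X (t + \<tau> w) w \<partial>M) \<le> ereal (x + belief t x p * (V10 t x - x))"
      unfolding total[OF \<tau>] by (simp add: algebra_simps)
  qed
  obtain \<tau> where \<tau>: "\<tau> \<in> admissible_times M X t"
    and opt: "V10 t x * belief t x p \<le> (\<integral>w. X (t + \<tau> w) w \<partial>conditioned 1)"
    using bridge.ex_optimal_stopped_bridge unfolding adm by (auto simp: measure_conditioned prob_theta_1)
  have "ereal (x + belief t x p * (V10 t x - x)) \<le> ereal (\<integral>w. X (t + \<tau> w) w \<partial>M)"
    using opt unfolding total[OF \<tau>] by (simp add: algebra_simps)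
  also have "\<dots> \<le> value_function M X t"
    unfolding value_function_def using \<tau> by (rule SUP_upper)
  finally show ?thesis using le by (intro antisym)
qed

end

section \<open>Dependence on the prior belief\<close>

lemma L0_pos: "t < 1 \<Longrightarrow> 0 < L0 t x"
  by (simp add: L0_def)

lemma belief_denominator_pos:
  assumes "t < 1" "0 \<le> p" "p \<le> 1"
  shows "0 < 1 - p + p * L0 t x"
proof (cases "p = 1")
  case False
  then show ?thesis using assms L0_pos[of t x] by (intro add_pos_nonneg) auto
qed (use assms L0_pos in auto)

text \<open>After cross-multiplication the terms in \<open>p * q\<close> cancel, and
  \<open>p * L0 t x \<le> q * L0 t x\<close> remains.\<close>

lemma belief_mono:
  assumes t: "t < 1" and p: "0 \<le> p" "p \<le> q" "q \<le> 1"
  shows "belief t x p \<le> belief t x q"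
proof -
  have "p * L0 t x * (1 - q + q * L0 t x) \<le> q * L0 t x * (1 - p + p * L0 t x)"
    using mult_right_mono[OF p(2), of "L0 t x"] L0_pos[OF t, of x] by (simp add: algebra_simps)
  moreover have "0 < 1 - p + p * L0 t x" "0 < 1 - q + q * L0 t x"
    using t p by (auto intro!: belief_denominator_pos)
  ultimately show ?thesis by (simp add: belief_def divide_le_eq le_divide_eq mult_ac)
qed

lemma belief_0 [simp]: "belief t x 0 = 0"
  by (simp add: belief_def)

lemma belief_1: "t < 1 \<Longrightarrow> belief t x 1 = 1"
  using L0_pos[of t x] by (simp add: belief_def)

theorem corollary4p4:
  fixes M :: "real \<Rightarrow> real \<Rightarrow> real \<Rightarrow> 'w measure"
    and B X :: "real \<Rightarrow> real \<Rightarrow> real \<Rightarrow> real \<Rightarrow> 'w \<Rightarrow> real"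
    and \<theta> :: "real \<Rightarrow> real \<Rightarrow> real \<Rightarrow> 'w \<Rightarrow> real"
    and V :: "real \<Rightarrow> real \<Rightarrow> real \<Rightarrow> ereal"
  assumes "\<And>t x p. t \<in> {0..<1} \<Longrightarrow> p \<in> {0..1} \<Longrightarrow>
      embedded_problem (M t x p) (B t x p) t x p (\<theta> t x p) (X t x p)"
    and "\<And>t x p. V t x p = value_function (M t x p) (X t x p) t"
  shows "(\<forall>t\<in>{0..<1}. \<forall>x. \<forall>p\<in>{0..1}. ereal x \<le> V t x p \<and> V t x p \<le> ereal (V10 t x)) \<and>
    (\<forall>t\<in>{0..<1}. \<forall>x. mono_on {0..1} (\<lambda>p. V t x p) \<and>
       V t x 0 = ereal x \<and> V t x 1 = ereal (V10 t x))"
proof -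
  \<comment> \<open>Problems with different parameters may live on unrelated probability spaces;
    their values are compared through this explicit formula instead of a coupling.\<close>
  have V: "V t x p = ereal (x + belief t x p * (V10 t x - x))" if "t \<in> {0..<1}" "p \<in> {0..1}" for t x p
    using embedded_problem.value_function_eq[OF assms(1)[OF that] that(1)] by (simp add: assms(2))
  have excess: "0 \<le> V10 t x - x" if "t \<in> {0..<1}" for t x
    using le_V10[of t x] that by simp
  have belief: "0 \<le> belief t x p" "belief t x p \<le> 1" if "t \<in> {0..<1}" "p \<in> {0..1}" for t x p
    using belief_mono[of t 0 p x] belief_mono[of t p 1 x] belief_1[of t x] that by auto
  have "x \<le> x + belief t x p * (V10 t x - x)" "x + belief t x p * (V10 t x - x) \<le> V10 t x"
    if "t \<in> {0..<1}" "p \<in> {0..1}" for t x p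
    using mult_nonneg_nonneg[OF belief(1)[OF that, of x] excess[OF that(1), of x]]
      mult_right_mono[OF belief(2)[OF that, of x] excess[OF that(1), of x]] by auto
  moreover have "mono_on {0..1} (\<lambda>p. V t x p)" if "t \<in> {0..<1}" for t x
    using that excess[OF that, of x] by (intro mono_onI) (auto simp: V intro!: mult_right_mono belief_mono)
  ultimately show ?thesis by (simp add: V belief_1)
qed

end
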